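(* Let $p$ be a prime, let $k\ge 1$ be an integer with $q=p^k>2$, and let $r=p^{k+1}$ if $p=3$ and $r=p^k$ if $p\neq 3$. Let $T=\langle a,b \mid a^q=b^q=(ab)^r=1\rangle$. Then the following hold: (i) The lower central quotient $T/\gamma_n(T)$ is a strongly real Beauville group for every $n\ge 3$ if $p>3$, and for every $n\ge 4$ if $p=2$ or $p=3$. (ii) The series $\{\gamma_n(T)\}_{n\ge 3}$ if $p>3$, respectively $\{\gamma_n(T)\}_{n\ge 4}$ if $p=2$ or $3$, can be refined to a (descending) series of normal subgroups of $T$ such that any two consecutive terms of the series have index $p$ and, for every term $N$ of the series, $T/N$ is a strongly real Beauville group.
   Context: For a group $T$, $\gamma_n(T)$ denotes the $n$-th term of the lower central series, with $\gamma_1(T)=T$ and $\gamma_{n+1}(T)=[\gamma_n(T),T]$. For a finite group $G$ and $x,y\in G$, put $\Sigma(x,y)=\bigcup_{g\in G}\big(\langle x\rangle^g\cup\langle y\rangle^g\cup\langle xy\rangle^g\big)$. The finite group $G$ is a Beauville group if it is a $2$-generator group and there exist generating sets $\{x_1,y_1\}$ and $\{x_2,y_2\}$ of $G$ such that $\Sigma(x_1,y_1)\cap\Sigma(x_2,y_2)=1$; in that case $\{x_1,y_1\}$ and $\{x_2,y_2\}$ are said to form a Beauville structure for $G$. A Beauville group $G$ is strongly real if there exist a Beauville structure $\{\{x_1,y_1\},\{x_2,y_2\}\}$ for $G$, an automorphism $\theta\in\operatorname{Aut}(G)$ and elements $g_1,g_2\in G$ such that $g_i\theta(x_i)g_i^{-1}=x_i^{-1}$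 and $g_i\theta(y_i)g_i^{-1}=y_i^{-1}$ for $i=1,2$; such a Beauville structure is then called strongly real. *)

theory Defs
  imports "HOL-Algebra.Algebra"
begin

section \<open>Groups given by generators and relators\<close>

text \<open>The letter \<open>(x, True)\<close> stands for the generator \<open>x\<close> and \<open>(x, False)\<close> for its formal
  inverse. The generators are all the elements of the type \<open>'g\<close>.\<close>

type_synonym 'g gword = "('g \<times> bool) list"

inductive pres_eq :: "'g gword set \<Rightarrow> 'g gword \<Rightarrow> 'g gword \<Rightarrow> bool" for R where
  cancel: "pres_eq R [(x, s), (x, \<not> s)] []"
| relator: "w \<in> R \<Longrightarrow> pres_eq R w []"
| append: "pres_eq R u u' \<Longrightarrow> pres_eq R v v' \<Longrightarrow> pres_eq R (u @ v) (u' @ v')"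
| refl: "pres_eq R w w"
| sym: "pres_eq R u v \<Longrightarrow> pres_eq R v u"
| trans: "pres_eq R u v \<Longrightarrow> pres_eq R v w \<Longrightarrow> pres_eq R u w"

definition pres_class :: "'g gword set \<Rightarrow> 'g gword \<Rightarrow> 'g gword set" where
  "pres_class R w = {v. pres_eq R w v}"

definition presented_group :: "'g gword set \<Rightarrow> 'g gword set monoid" where
  "presented_group R =
     \<lparr>carrier = range (pres_class R),
      monoid.mult = (\<lambda>C D. {w. \<exists>u\<in>C. \<exists>v\<in>D. pres_eq R (u @ v) w}),
      one = pres_class R []\<rparr>"

definition gword_eval :: "('a, 'b) monoid_scheme \<Rightarrow> ('g \<Rightarrow> 'a) \<Rightarrow> 'g gword \<Rightarrow> 'a" where
  "gword_eval G f w =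
     foldr (\<lambda>(x, s) z. (if s then f x else inv\<^bsub>G\<^esub> f x) \<otimes>\<^bsub>G\<^esub> z) w \<one>\<^bsub>G\<^esub>"

lemma pres_class_eq_iff: "pres_class R u = pres_class R v \<longleftrightarrow> pres_eq R u v"
proof
  assume "pres_class R u = pres_class R v"
  moreover have "v \<in> pres_class R v" by (simp add: pres_class_def pres_eq.refl)
  ultimately have "v \<in> pres_class R u" by simp
  then show "pres_eq R u v" by (simp add: pres_class_def)
next
  assume "pres_eq R u v"
  then have "pres_eq R u w \<longleftrightarrow> pres_eq R v w" for w
    using pres_eq.trans pres_eq.sym by metis
  then show "pres_class R u = pres_class R v" by (simp add: pres_class_def)
qed

lemma carrier_presented_group: "carrier (presented_group R) = range (pres_class R)"
  by (simp add: presented_group_def)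

lemma one_presented_group: "\<one>\<^bsub>presented_group R\<^esub> = pres_class R []"
  by (simp add: presented_group_def)

lemma mult_presented_group:
  "pres_class R u \<otimes>\<^bsub>presented_group R\<^esub> pres_class R v = pres_class R (u @ v)"
proof -
  have "(\<exists>u'. pres_eq R u u' \<and> (\<exists>v'. pres_eq R v v' \<and> pres_eq R (u' @ v') w))
        \<longleftrightarrow> pres_eq R (u @ v) w" for w
    using pres_eq.refl pres_eq.trans[OF pres_eq.append] by metis
  then show ?thesis
    by (simp add: presented_group_def pres_class_def Bex_def)
qed

lemma pres_eq_inverse_left: "\<exists>v. pres_eq R (v @ w) []"
proof (induction w)
  case Nil
  show ?case using pres_eq.refl[of R "[]"] by (metis append_Nil)
next
  case (Cons l w)
  then obtain v where v: "pres_eq R (v @ w) []" by blast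
  obtain x s where l: "l = (x, s)" by force
  have c: "pres_eq R [(x, \<not> s), (x, s)] []"
    using pres_eq.cancel[of R x "\<not> s"] by simp
  have "pres_eq R (([(x, \<not> s), (x, s)]) @ w) ([] @ w)"
    by (rule pres_eq.append[OF c pres_eq.refl])
  then have "pres_eq R (v @ ([(x, \<not> s), (x, s)] @ w)) (v @ w)"
    using pres_eq.append[OF pres_eq.refl] by force
  then have "pres_eq R ((v @ [(x, \<not> s)]) @ (l # w)) []"
    using pres_eq.trans[OF _ v] l by simp
  then show ?case by blast
qed

lemma group_presented_group: "group (presented_group R)"
proof (rule groupI)
  fix C assume "C \<in> carrier (presented_group R)"
  then obtain w where w: "C = pres_class R w" by (auto simp: carrier_presented_group)
  obtain v where "pres_eq R (v @ w) []" using pres_eq_inverse_left by blast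
  then have "pres_class R v \<otimes>\<^bsub>presented_group R\<^esub> C = \<one>\<^bsub>presented_group R\<^esub>"
    by (simp add: w mult_presented_group one_presented_group pres_class_eq_iff)
  then show "\<exists>D\<in>carrier (presented_group R). D \<otimes>\<^bsub>presented_group R\<^esub> C = \<one>\<^bsub>presented_group R\<^esub>"
    by (auto simp: carrier_presented_group)
qed (auto simp: carrier_presented_group one_presented_group mult_presented_group)

lemma (in group) gword_eval_closed:
  assumes "\<And>x. f x \<in> carrier G"
  shows "gword_eval G f w \<in> carrier G"
  using assms by (induction w) (auto simp: gword_eval_def)

lemma (in group) gword_eval_append:
  assumes "\<And>x. f x \<in> carrier G"
  shows "gword_eval G f (u @ v) = gword_eval G f u \<otimes> gword_eval G f v"
proof (induction u)
  case Nil
  then show ?case using gword_eval_closed[of f v] assms by (simp add: gword_eval_def)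
next
  case (Cons l u)
  then show ?case
    using gword_eval_closed[of f u] gword_eval_closed[of f v] assms
    by (cases l) (simp add: gword_eval_def m_assoc)
qed

lemma (in group) gword_eval_pres_eq:
  assumes f: "\<And>x. f x \<in> carrier G" and R: "\<And>w. w \<in> R \<Longrightarrow> gword_eval G f w = \<one>"
  shows "pres_eq R u v \<Longrightarrow> gword_eval G f u = gword_eval G f v"
proof (induction rule: pres_eq.induct)
  case (cancel x s)
  then show ?case using f by (simp add: gword_eval_def)
next
  case (relator w)
  then show ?case using R by (simp add: gword_eval_def)
qed (simp_all add: gword_eval_append f)

text \<open>The universal property.\<close>

lemma (in group) presented_group_universal:
  assumes f: "\<And>x. f x \<in> carrier G" and R: "\<And>w. w \<in> R \<Longrightarrow> gword_eval G f w = \<one>"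
  shows "\<exists>h\<in>hom (presented_group R) G. \<forall>w. h (pres_class R w) = gword_eval G f w"
proof -
  define h where "h C = gword_eval G f (SOME w. C = pres_class R w)" for C
  have h: "h (pres_class R w) = gword_eval G f w" for w
  proof -
    have "pres_class R w = pres_class R (SOME v. pres_class R w = pres_class R v)"
      by (rule someI_ex) blast
    then show ?thesis
      unfolding h_def using gword_eval_pres_eq[OF f R] pres_class_eq_iff by metis
  qed
  have "h \<in> hom (presented_group R) G"
    by (rule homI) (auto simp: carrier_presented_group mult_presented_group h
      gword_eval_closed[OF f] gword_eval_append[OF f])
  with h show ?thesis by blast
qed

section \<open>The group \<open>\<langle>a, b | a^q = b^q = (ab)^r = 1\<rangle>\<close>\<close>

datatype two_gens = gen_a | gen_b

definition triangle_group :: "nat \<Rightarrow> nat \<Rightarrow> two_gens gword set monoid" where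
  "triangle_group q r = presented_group
     {replicate q (gen_a, True), replicate q (gen_b, True),
      concat (replicate r [(gen_a, True), (gen_b, True)])}"

section \<open>Lower central series\<close>

definition commutator_subgroup :: "('a, 'b) monoid_scheme \<Rightarrow> 'a set \<Rightarrow> 'a set \<Rightarrow> 'a set" where
  "commutator_subgroup G H K =
     generate G (\<Union>h\<in>H. \<Union>k\<in>K. {h \<otimes>\<^bsub>G\<^esub> k \<otimes>\<^bsub>G\<^esub> inv\<^bsub>G\<^esub> h \<otimes>\<^bsub>G\<^esub> inv\<^bsub>G\<^esub> k})"

text \<open>Indexed from 1; the value at 0 is irrelevant.\<close>

fun lower_central :: "('a, 'b) monoid_scheme \<Rightarrow> nat \<Rightarrow> 'a set" where
  "lower_central G 0 = carrier G"
| "lower_central G (Suc 0) = carrier G"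
| "lower_central G (Suc (Suc n)) = commutator_subgroup G (lower_central G (Suc n)) (carrier G)"

section \<open>Beauville groups\<close>

definition Beauville_Sigma :: "('a, 'b) monoid_scheme \<Rightarrow> 'a \<Rightarrow> 'a \<Rightarrow> 'a set" where
  "Beauville_Sigma G x y =
     (\<Union>g\<in>carrier G. (\<lambda>h. inv\<^bsub>G\<^esub> g \<otimes>\<^bsub>G\<^esub> h \<otimes>\<^bsub>G\<^esub> g) `
        (generate G {x} \<union> generate G {y} \<union> generate G {x \<otimes>\<^bsub>G\<^esub> y}))"

definition Beauville_structure ::
    "('a, 'b) monoid_scheme \<Rightarrow> 'a \<Rightarrow> 'a \<Rightarrow> 'a \<Rightarrow> 'a \<Rightarrow> bool" where
  "Beauville_structure G x1 y1 x2 y2 \<longleftrightarrow>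
     {x1, y1, x2, y2} \<subseteq> carrier G \<and>
     generate G {x1, y1} = carrier G \<and> generate G {x2, y2} = carrier G \<and>
     Beauville_Sigma G x1 y1 \<inter> Beauville_Sigma G x2 y2 = {\<one>\<^bsub>G\<^esub>}"

definition two_generator_group :: "('a, 'b) monoid_scheme \<Rightarrow> bool" where
  "two_generator_group G \<longleftrightarrow>
     group G \<and> (\<exists>x\<in>carrier G. \<exists>y\<in>carrier G. generate G {x, y} = carrier G)"

definition Beauville_group :: "('a, 'b) monoid_scheme \<Rightarrow> bool" where
  "Beauville_group G \<longleftrightarrow>
     group G \<and> finite (carrier G) \<and> two_generator_group G \<and>
     (\<exists>x1 y1 x2 y2. Beauville_structure G x1 y1 x2 y2)"

definition strongly_real_Beauville_structure ::
    "('a, 'b) monoid_scheme \<Rightarrow> 'a \<Rightarrow> 'a \<Rightarrow> 'a \<Rightarrow> 'a \<Rightarrow> bool" where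
  "strongly_real_Beauville_structure G x1 y1 x2 y2 \<longleftrightarrow>
     Beauville_structure G x1 y1 x2 y2 \<and>
     (\<exists>\<theta>\<in>iso G G. \<exists>g1\<in>carrier G. \<exists>g2\<in>carrier G.
        g1 \<otimes>\<^bsub>G\<^esub> \<theta> x1 \<otimes>\<^bsub>G\<^esub> inv\<^bsub>G\<^esub> g1 = inv\<^bsub>G\<^esub> x1 \<and>
        g1 \<otimes>\<^bsub>G\<^esub> \<theta> y1 \<otimes>\<^bsub>G\<^esub> inv\<^bsub>G\<^esub> g1 = inv\<^bsub>G\<^esub> y1 \<and>
        g2 \<otimes>\<^bsub>G\<^esub> \<theta> x2 \<otimes>\<^bsub>G\<^esub> inv\<^bsub>G\<^esub> g2 = inv\<^bsub>G\<^esub> x2 \<and>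
        g2 \<otimes>\<^bsub>G\<^esub> \<theta> y2 \<otimes>\<^bsub>G\<^esub> inv\<^bsub>G\<^esub> g2 = inv\<^bsub>G\<^esub> y2)"

definition strongly_real_Beauville_group :: "('a, 'b) monoid_scheme \<Rightarrow> bool" where
  "strongly_real_Beauville_group G \<longleftrightarrow>
     Beauville_group G \<and> (\<exists>x1 y1 x2 y2. strongly_real_Beauville_structure G x1 y1 x2 y2)"

end

theory Submission
  imports Defs "HOL-Library.Function_Algebras" "HOL-Library.Product_Plus"
begin

text \<open>The automorphism \<open>\<theta>\<close> of \<open>T\<close> inverting \<open>a\<close> and \<open>b\<close> acts on each factor
  \<open>\<gamma>\<^sub>n(T) / \<gamma>\<^sub>n\<^sub>+\<^sub>1(T)\<close> as \<open>1\<close> or as \<open>-1\<close>, so it preserves every subgroup between the two terms; such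
  subgroups are also normal. Each factor is a finite abelian \<open>p\<close>-group, hence refines into steps of
  index \<open>p\<close>, and it is nontrivial because \<open>T\<close> maps onto a group \<open>\<int>[\<zeta>] \<rtimes> \<langle>\<zeta>\<rangle>\<close> with
  \<open>\<zeta>\<close> a root of unity of order \<open>p\<close> (or \<open>4\<close> if \<open>p = 2\<close>), where the powers of the ideal \<open>(1 - \<zeta>)\<close>
  intersect in \<open>0\<close>.

  For the Beauville structure one pair is the image of \<open>a, b\<close>, the other consists of two palindromes
  \<open>x, y\<close> in \<open>a\<^sup>\<plusminus>\<^sup>1, b\<^sup>\<plusminus>\<^sup>1\<close>; these are inverted by \<open>\<theta>\<close> as well. If a power \<open>s\<^sup>i\<close> of
  \<open>a\<close>, \<open>b\<close> or \<open>ab\<close> becomes conjugate to a power of \<open>x\<close>, \<open>y\<close> or \<open>xy\<close> modulo \<open>N\<close>, then so it does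
  modulo \<open>\<gamma>\<^sub>3(T)\<close> (if \<open>p > 3\<close>) or \<open>\<gamma>\<^sub>4(T)\<close>, and this already forces \<open>s\<^sup>i = 1\<close> in \<open>T\<close>: when the
  two elements are independent modulo \<open>p\<close> in the abelianization this is immediate, except that
  \<open>ab\<close> has order \<open>3q\<close> if \<open>p = 3\<close>. The remaining cases are decided in quotients
  \<open>\<int>[t]/(t\<^sup>3) \<rtimes> \<langle>1 + t\<rangle>\<close> with the coefficients reduced modulo \<open>q\<close> or \<open>q/2\<close>.\<close>

section \<open>Commutators and the lower central series\<close>

text \<open>The number of lines in (Z/p)^2 shapes the proof. Modulo p the elements a, b, ab span
  three lines and so do x, y, xy, while only p + 1 lines exist. For p > 3 six distinct lines can be
  chosen, and determinants settle every comparison. There are four lines for p = 3 and three for p =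
  2, so coincidences are forced; they are resolved by the t^2 coefficient of the class three
  quotients, whence the fourth term of the series as the starting point. A single \<theta> inverts
  all four chosen elements, so both conjugators in the definition of strongly real can be 1. As T/N
  is nilpotent, the second pair needs to generate T only modulo the derived subgroup. Conjugacy is
  tested once, modulo the first term of the series, and the conclusion
  \<open>s [^] i = \<one>\<close> holds in T itself, so it serves every N below that term. The
  layers must be nontrivial because the series is a sequence over all natural numbers in which each
  step has index exactly p.\<close>

definition grp_comm :: "('a, 'b) monoid_scheme \<Rightarrow> 'a \<Rightarrow> 'a \<Rightarrow> 'a" where
  "grp_comm G x y = x \<otimes>\<^bsub>G\<^esub> y \<otimes>\<^bsub>G\<^esub> inv\<^bsub>G\<^esub> x \<otimes>\<^bsub>G\<^esub> inv\<^bsub>G\<^esub> y"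

lemma commutator_subgroup_eq:
  "commutator_subgroup G H K = generate G {grp_comm G h k | h k. h \<in> H \<and> k \<in> K}"
  unfolding commutator_subgroup_def grp_comm_def by (rule arg_cong[where f = "generate G"]) blast

declare lower_central.simps(3) [simp del]

lemma lower_central_Suc:
  "n \<ge> 1 \<Longrightarrow> lower_central G (Suc n) = commutator_subgroup G (lower_central G n) (carrier G)"
  by (cases n) (auto simp: lower_central.simps(3))

lemma (in group_hom) hom_grp_comm:
  "x \<in> carrier G \<Longrightarrow> y \<in> carrier G \<Longrightarrow> h (grp_comm G x y) = grp_comm H (h x) (h y)"
  by (simp add: grp_comm_def)

context group
begin

lemma m_inv_cancel [simp]:
  "x \<in> carrier G \<Longrightarrow> y \<in> carrier G \<Longrightarrow> inv x \<otimes> (x \<otimes> y) = y"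
  "x \<in> carrier G \<Longrightarrow> y \<in> carrier G \<Longrightarrow> x \<otimes> (inv x \<otimes> y) = y"
  by (simp_all flip: m_assoc)

lemma grp_comm_closed [simp, intro]:
  "x \<in> carrier G \<Longrightarrow> y \<in> carrier G \<Longrightarrow> grp_comm G x y \<in> carrier G"
  by (simp add: grp_comm_def)

lemma grp_comm_conj:
  assumes "x \<in> carrier G" "y \<in> carrier G" "g \<in> carrier G"
  shows "g \<otimes> grp_comm G x y \<otimes> inv g = grp_comm G (g \<otimes> x \<otimes> inv g) (g \<otimes> y \<otimes> inv g)"
  using assms by (simp add: grp_comm_def m_assoc inv_mult_group)

lemma grp_comm_mult_left:
  assumes "x \<in> carrier G" "y \<in> carrier G" "h \<in> carrier G"
  shows "grp_comm G (x \<otimes> y) h = x \<otimes> grp_comm G y h \<otimes> inv x \<otimes> grp_comm G x h"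
  using assms by (simp add: grp_comm_def m_assoc inv_mult_group)

lemma grp_comm_mult_right:
  assumes "x \<in> carrier G" "y \<in> carrier G" "h \<in> carrier G"
  shows "grp_comm G x (y \<otimes> h) = grp_comm G x y \<otimes> (y \<otimes> grp_comm G x h \<otimes> inv y)"
  using assms by (simp add: grp_comm_def m_assoc inv_mult_group)

lemma grp_comm_inv_left:
  assumes "x \<in> carrier G" "h \<in> carrier G"
  shows "grp_comm G (inv x) h = inv x \<otimes> inv (grp_comm G x h) \<otimes> x"
  using assms by (simp add: grp_comm_def m_assoc inv_mult_group)

lemma grp_comm_inv_right:
  assumes "x \<in> carrier G" "h \<in> carrier G"
  shows "grp_comm G x (inv h) = inv h \<otimes> inv (grp_comm G x h) \<otimes> h"
  using assms by (simp add: grp_comm_def m_assoc inv_mult_group)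

lemma conj_eq_grp_comm:
  assumes "x \<in> carrier G" "g \<in> carrier G"
  shows "g \<otimes> x \<otimes> inv g = inv (grp_comm G x g) \<otimes> x"
  using assms by (simp add: grp_comm_def m_assoc inv_mult_group)

lemma grp_comm_in_normal:
  assumes "H \<lhd> G" "h \<in> H" "k \<in> carrier G"
  shows "grp_comm G h k \<in> H"
proof -
  interpret normal H G by fact
  have "h \<otimes> (k \<otimes> inv h \<otimes> inv k) \<in> H"
    using assms(2,3) inv_op_closed2[of k "inv h"] by blast
  then show ?thesis using assms by (simp add: grp_comm_def m_assoc)
qed

lemma commutator_subgroup_normal:
  assumes "H \<lhd> G"
  shows "commutator_subgroup G H (carrier G) \<lhd> G"
proof -
  interpret normal H G by fact
  show ?thesis unfolding commutator_subgroup_eq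
  proof (rule normal_generateI)
    show "{grp_comm G h k |h k. h \<in> H \<and> k \<in> carrier G} \<subseteq> carrier G" by auto
  next
    fix c g assume "c \<in> {grp_comm G h k |h k. h \<in> H \<and> k \<in> carrier G}" and g: "g \<in> carrier G"
    then obtain h k where "c = grp_comm G h k" "h \<in> H" "k \<in> carrier G" by blast
    moreover from this have "g \<otimes> h \<otimes> inv g \<in> H" "g \<otimes> k \<otimes> inv g \<in> carrier G"
      using inv_op_closed2 g by auto
    ultimately show "g \<otimes> c \<otimes> inv g \<in> {grp_comm G h k |h k. h \<in> H \<and> k \<in> carrier G}"
      using grp_comm_conj[of h k g] g by auto
  qed
qed

lemma lower_central_normal: "lower_central G n \<lhd> G"
proof (induction n)
  case (Suc n)
  then show ?case
    by (cases "n \<ge> 1") (simp_all add: lower_central_Suc commutator_subgroup_normal not_less_eq_eq normal_self)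
qed (simp add: normal_self)

lemma lower_central_subgroup: "subgroup (lower_central G n) G"
  using lower_central_normal normal_imp_subgroup by blast

lemma lower_central_carrier: "x \<in> lower_central G n \<Longrightarrow> x \<in> carrier G"
  using lower_central_subgroup subgroup.mem_carrier by metis

lemma grp_comm_lower_central:
  "n \<ge> 1 \<Longrightarrow> x \<in> lower_central G n \<Longrightarrow> g \<in> carrier G \<Longrightarrow> grp_comm G x g \<in> lower_central G (Suc n)"
  by (auto simp: lower_central_Suc commutator_subgroup_eq intro!: generate.incl)

lemma lower_central_Suc_subset: "lower_central G (Suc n) \<subseteq> lower_central G n"
proof (cases "n \<ge> 1")
  case True
  have "{grp_comm G h k | h k. h \<in> lower_central G n \<and> k \<in> carrier G} \<subseteq> lower_central G n"
    using grp_comm_in_normal[OF lower_central_normal] by blast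
  then show ?thesis
    using True generate_subgroup_incl[OF _ lower_central_subgroup]
    by (simp add: lower_central_Suc commutator_subgroup_eq)
next
  case False
  then have "n = 0" by simp
  then show ?thesis by simp
qed

lemma lower_central_antimono: "m \<le> n \<Longrightarrow> lower_central G n \<subseteq> lower_central G m"
  using lift_Suc_antimono_le[of "lower_central G", OF lower_central_Suc_subset] by blast

text \<open>A conjugate of x is x times the inverse of a commutator of x, and that commutator lies
  in the lower of the two terms, hence in B.\<close>

lemma layer_subgroup_normal:
  assumes "n \<ge> 1" "subgroup B G" "lower_central G (Suc n) \<subseteq> B" "B \<subseteq> lower_central G n"
  shows "B \<lhd> G"
  unfolding normal_inv_iff
proof (intro conjI ballI)
  fix g x assume g: "g \<in> carrier G" and x: "x \<in> B"
  then have "inv (grp_comm G x g) \<in> B"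
    using assms grp_comm_lower_central[of n x g] subgroup.m_inv_closed[OF assms(2)] by blast
  then show "g \<otimes> x \<otimes> inv g \<in> B"
    using g x assms(2) conj_eq_grp_comm[of x g] subgroup.m_closed[OF assms(2)]
      subgroup.mem_carrier[OF assms(2)] by metis
qed fact

text \<open>These are the elements whose image in G/B commutes with that of h. Because they form a
  subgroup, commutator containments need checking on generators only.\<close>

lemma subgroup_centralizer_mod_left:
  assumes "B \<lhd> G" "h \<in> carrier G"
  shows "subgroup {x \<in> carrier G. grp_comm G x h \<in> B} G"
proof -
  interpret B: normal B G by fact
  show ?thesis
  proof (rule subgroupI)
    have "grp_comm G \<one> h = \<one>" using assms by (simp add: grp_comm_def)
    then show "{x \<in> carrier G. grp_comm G x h \<in> B} \<noteq> {}" by force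
  qed (use assms B.inv_op_closed1 B.inv_op_closed2 in
      \<open>auto simp: grp_comm_mult_left grp_comm_inv_left\<close>)
qed

lemma subgroup_centralizer_mod_right:
  assumes "B \<lhd> G" "x \<in> carrier G"
  shows "subgroup {h \<in> carrier G. grp_comm G x h \<in> B} G"
proof -
  interpret B: normal B G by fact
  show ?thesis
  proof (rule subgroupI)
    have "grp_comm G x \<one> = \<one>" using assms by (simp add: grp_comm_def)
    then show "{h \<in> carrier G. grp_comm G x h \<in> B} \<noteq> {}" by force
  qed (use assms B.inv_op_closed1 B.inv_op_closed2 in
      \<open>auto simp: grp_comm_mult_right grp_comm_inv_right\<close>)
qed

lemma grp_comm_pow_right:
  assumes "x \<in> carrier G" "h \<in> carrier G"
    and c: "\<And>g. g \<in> carrier G \<Longrightarrow> g \<otimes> grp_comm G x h = grp_comm G x h \<otimes> g"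
  shows "grp_comm G x (h [^] (k::nat)) = grp_comm G x h [^] k"
proof (induction k)
  case 0
  then show ?case using assms by (simp add: grp_comm_def)
next
  case (Suc k)
  have "h [^] k \<otimes> grp_comm G x h \<otimes> inv (h [^] k) = grp_comm G x h"
    using assms(1,2) c[of "h [^] k"] by (simp add: m_assoc)
  then show ?case using Suc assms by (simp add: grp_comm_mult_right)
qed

text \<open>A central commutator is bilinear and blind to the central factor d: inverting one
  argument inverts it, inverting both leaves it alone. The two cases are those where an automorphism
  sends x to dx or to d times the inverse of x, and inverts h.\<close>

lemma grp_comm_central_cases:
  assumes "x \<in> carrier G" "h \<in> carrier G" "d \<in> carrier G"
    and d: "\<And>g. g \<in> carrier G \<Longrightarrow> g \<otimes> d = d \<otimes> g"
    and c: "\<And>g. g \<in> carrier G \<Longrightarrow> g \<otimes> grp_comm G x h = grp_comm G x h \<otimes> g"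
  shows "grp_comm G (d \<otimes> x) (inv h) = inv (grp_comm G x h)"
    and "grp_comm G (d \<otimes> inv x) (inv h) = grp_comm G x h"
proof -
  have drop: "grp_comm G (d \<otimes> y) g = grp_comm G y g" if "y \<in> carrier G" "g \<in> carrier G" for y g
  proof -
    have "grp_comm G (d \<otimes> y) g = (d \<otimes> grp_comm G y g) \<otimes> inv d \<otimes> (d \<otimes> g \<otimes> inv d \<otimes> inv g)"
      using assms(1-3) that by (simp add: grp_comm_mult_left) (simp add: grp_comm_def)
    also have "d \<otimes> g \<otimes> inv d \<otimes> inv g = \<one>"
      using assms(3) that by (simp add: d[OF that(2), symmetric]) (simp add: m_assoc)
    also have "d \<otimes> grp_comm G y g = grp_comm G y g \<otimes> d"
      using that by (simp add: d)
    also have "grp_comm G y g \<otimes> d \<otimes> inv d = grp_comm G y g"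
      using assms(3) that by (simp add: m_assoc)
    finally show ?thesis using assms(3) that by simp
  qed
  have ci: "g \<otimes> inv (grp_comm G x h) = inv (grp_comm G x h) \<otimes> g" if "g \<in> carrier G" for g
    using c[of "inv g"] that assms(1,2)
    by (metis grp_comm_closed inv_closed inv_inv inv_mult_group)
  have 1: "inv g \<otimes> inv (grp_comm G x h) \<otimes> g = inv (grp_comm G x h)" if "g \<in> carrier G" for g
    using that assms(1,2) by (simp add: m_assoc ci[OF that, symmetric])
  show i: "grp_comm G (d \<otimes> x) (inv h) = inv (grp_comm G x h)"
    using assms(1-3) drop[of x "inv h"] 1[of h] by (simp add: grp_comm_inv_right)
  have "grp_comm G (inv x) (inv h) = inv h \<otimes> inv (inv x \<otimes> inv (grp_comm G x h) \<otimes> x) \<otimes> h"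
    using assms(1,2) by (simp add: grp_comm_inv_left grp_comm_inv_right)
  also have "\<dots> = inv h \<otimes> (grp_comm G x h \<otimes> h)"
    using assms(1,2) by (simp add: 1) (simp add: m_assoc)
  also have "\<dots> = grp_comm G x h"
    using assms(1,2) by (simp add: c[OF assms(2), symmetric])
  finally show "grp_comm G (d \<otimes> inv x) (inv h) = grp_comm G x h"
    using assms(1-3) drop[of "inv x" "inv h"] by simp
qed

lemma grp_comm_central_mod:
  assumes "K \<lhd> G" "c \<in> carrier G" "\<And>g. g \<in> carrier G \<Longrightarrow> grp_comm G c g \<in> K"
    and "C \<in> carrier (G Mod K)"
  shows "C \<otimes>\<^bsub>G Mod K\<^esub> (K #> c) = (K #> c) \<otimes>\<^bsub>G Mod K\<^esub> C"
proof -
  interpret K: normal K G by fact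
  obtain g where g: "g \<in> carrier G" "C = K #> g"
    using assms(4) by (auto simp: carrier_FactGroup)
  have "K #> (grp_comm G c g \<otimes> (g \<otimes> c)) = K #> (g \<otimes> c)"
    using assms(2,3) g K.subgroup_axioms
    by (metis K.rcos_const coset_mult_assoc K.subset grp_comm_closed m_closed is_group)
  moreover have "grp_comm G c g \<otimes> (g \<otimes> c) = c \<otimes> g"
    using assms(2) g by (simp add: grp_comm_def m_assoc)
  ultimately show ?thesis using assms(2) g by (simp add: K.rcos_sum)
qed

lemma r_coset_eq_iff:
  assumes "subgroup K G" "x \<in> carrier G" "y \<in> carrier G"
  shows "K #> x = K #> y \<longleftrightarrow> x \<otimes> inv y \<in> K"
  using assms repr_independence repr_independenceD subgroup.rcos_module is_group by metis

lemma r_coset_eq_self_iff: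
  assumes "subgroup K G" "x \<in> carrier G"
  shows "K #> x = K \<longleftrightarrow> x \<in> K"
  using assms coset_join1 coset_join2 by blast

lemma group_hom_r_coset: "K \<lhd> G \<Longrightarrow> group_hom G (G Mod K) ((#>) K)"
  by (simp add: group_hom_def group_hom_axioms_def normal.factorgroup_is_group normal.r_coset_hom_Mod)

text \<open>Modulo K the commutator is central, so its k-th power is the commutator of x with the
  k-th power of h, which is trivial.\<close>

lemma grp_comm_pow_mod:
  assumes "K \<lhd> G" "x \<in> carrier G" "h \<in> carrier G"
    and "\<And>g. g \<in> carrier G \<Longrightarrow> grp_comm G (grp_comm G x h) g \<in> K"
    and "h [^] (k::nat) = \<one>"
  shows "grp_comm G x h [^] k \<in> K"
proof -
  interpret K: normal K G by fact
  interpret \<pi>: group_hom G "G Mod K" "(#>) K" by (rule group_hom_r_coset[OF assms(1)])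
  note carr = \<pi>.hom_closed[OF assms(2)] \<pi>.hom_closed[OF assms(3)]
  have "K #> (grp_comm G x h [^] k) = grp_comm (G Mod K) (K #> x) (K #> h) [^]\<^bsub>G Mod K\<^esub> k"
    using assms(2,3) by (simp add: \<pi>.hom_nat_pow \<pi>.hom_grp_comm)
  also have "\<dots> = grp_comm (G Mod K) (K #> x) ((K #> h) [^]\<^bsub>G Mod K\<^esub> k)"
    using \<pi>.H.grp_comm_pow_right[OF carr] grp_comm_central_mod[OF assms(1) _ assms(4)] assms(2,3)
    by (metis \<pi>.hom_grp_comm grp_comm_closed)
  also have "\<dots> = K #> grp_comm G x (h [^] k)"
    using assms(2,3) by (simp add: \<pi>.hom_nat_pow \<pi>.hom_grp_comm)
  also have "\<dots> = K"
    using assms(2,3,5) K.subset by (simp add: grp_comm_def)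
  finally show ?thesis
    using r_coset_eq_self_iff[OF K.subgroup_axioms] assms(2,3) by simp
qed

text \<open>Modulo the term of index n + 2 the commutator is bilinear, so bracketing generators of
  one layer with a and b yields generators of the next. The subgroup \<open>?B\<close> so generated
  lies between consecutive terms, hence is normal, and commuting modulo \<open>?B\<close> passes to
  products in either argument.\<close>

lemma lower_central_Suc_generators:
  assumes ab: "a \<in> carrier G" "b \<in> carrier G" "generate G {a, b} = carrier G"
    and n: "n \<ge> 1"
    and Y: "Y \<subseteq> lower_central G n" "generate G (Y \<union> lower_central G (Suc n)) = lower_central G n"
  shows "generate G ((\<lambda>x. grp_comm G x a) ` Y \<union> (\<lambda>x. grp_comm G x b) ` Y \<union> lower_central G (Suc (Suc n)))
    = lower_central G (Suc n)" (is "?B = _")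
proof
  have gens: "(\<lambda>x. grp_comm G x a) ` Y \<union> (\<lambda>x. grp_comm G x b) ` Y \<union> lower_central G (Suc (Suc n))
      \<subseteq> lower_central G (Suc n)"
    using Y(1) ab(1,2) n lower_central_Suc_subset[of "Suc n"] by (auto intro: grp_comm_lower_central)
  then show le: "?B \<subseteq> lower_central G (Suc n)"
    by (rule generate_subgroup_incl[OF _ lower_central_subgroup])
  have sub: "subgroup ?B G"
    using gens lower_central_carrier by (intro generate_is_subgroup) blast
  have B: "?B \<lhd> G"
    by (rule layer_subgroup_normal[OF _ sub _ le]) (auto intro: generate.incl)
  have 1: "grp_comm G x h \<in> ?B" if "x \<in> lower_central G n" "h \<in> {a, b}" for x h
  proof -
    have h: "h \<in> carrier G" using that ab by auto
    have "Y \<union> lower_central G (Suc n) \<subseteq> {x \<in> carrier G. grp_comm G x h \<in> ?B}"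
      using that(2) h Y(1) grp_comm_lower_central[of "Suc n" _ h]
      by (auto intro!: generate.incl lower_central_carrier dest: subsetD)
    from generate_subgroup_incl[OF this subgroup_centralizer_mod_left[OF B h]] that(1)
    show ?thesis using Y(2) by auto
  qed
  have 2: "grp_comm G x h \<in> ?B" if "x \<in> lower_central G n" "h \<in> carrier G" for x h
  proof -
    have "{a, b} \<subseteq> {h \<in> carrier G. grp_comm G x h \<in> ?B}"
      using 1[OF that(1)] ab by auto
    from generate_subgroup_incl[OF this subgroup_centralizer_mod_right[OF B]] that
    show ?thesis using lower_central_carrier ab(3) by blast
  qed
  then show "lower_central G (Suc n) \<subseteq> ?B"
    unfolding lower_central_Suc[OF n] commutator_subgroup_eq
    by (intro generate_subgroup_incl[OF _ sub]) auto
qed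

text \<open>The exponent q survives from layer to layer because the second entry of each new bracket
  is a or b, whose q-th power is trivial.\<close>

lemma lower_central_layer_generators:
  assumes ab: "a \<in> carrier G" "b \<in> carrier G" "generate G {a, b} = carrier G"
    and q: "a [^] (q::nat) = \<one>" "b [^] q = \<one>" and "n \<ge> 1"
  shows "\<exists>Y. finite Y \<and> Y \<subseteq> lower_central G n \<and>
    generate G (Y \<union> lower_central G (Suc n)) = lower_central G n \<and>
    (\<forall>x\<in>Y. x [^] q \<in> lower_central G (Suc n))"
  using \<open>n \<ge> 1\<close>
proof (induction n rule: nat_induct_at_least)
  case base
  have "generate G ({a, b} \<union> lower_central G 2) = carrier G"
    using mono_generate[of "{a, b}" "{a, b} \<union> lower_central G 2"]
      generate_incl[of "{a, b} \<union> lower_central G 2"] ab lower_central_carrier by blast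
  then show ?case
    using ab q subgroup.one_closed[OF lower_central_subgroup[of 2]]
    by (intro exI[of _ "{a, b}"]) (simp add: numeral_2_eq_2)
next
  case (Suc n)
  then obtain Y where Y: "finite Y" "Y \<subseteq> lower_central G n"
      "generate G (Y \<union> lower_central G (Suc n)) = lower_central G n" by blast
  have pow: "grp_comm G x h [^] q \<in> lower_central G (Suc (Suc n))"
    if "x \<in> Y" "h \<in> {a, b}" for x h
  proof (rule grp_comm_pow_mod[OF lower_central_normal])
    show "x \<in> carrier G" "h \<in> carrier G" "h [^] q = \<one>"
      using that ab q Y(2) lower_central_carrier by auto
    then show "grp_comm G (grp_comm G x h) g \<in> lower_central G (Suc (Suc n))" if "g \<in> carrier G" for g
      using that \<open>x \<in> Y\<close> Y(2) Suc.hyps by (intro grp_comm_lower_central) auto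
  qed
  show ?case
  proof (intro exI conjI)
    show "finite ((\<lambda>x. grp_comm G x a) ` Y \<union> (\<lambda>x. grp_comm G x b) ` Y)" using Y(1) by simp
    show "(\<lambda>x. grp_comm G x a) ` Y \<union> (\<lambda>x. grp_comm G x b) ` Y \<subseteq> lower_central G (Suc n)"
      using Y(2) ab(1,2) Suc.hyps by (auto intro: grp_comm_lower_central)
  qed (use pow lower_central_Suc_generators[OF ab Suc.hyps Y(2,3)] in auto)
qed

section \<open>An endomorphism that inverts the generators, acting on the layers\<close>

lemma hom_lower_central:
  assumes "\<theta> \<in> hom G G" "x \<in> lower_central G n"
  shows "\<theta> x \<in> lower_central G n"
proof -
  interpret \<theta>: group_hom G G \<theta> using assms(1) by unfold_locales
  have "\<theta> ` lower_central G n \<subseteq> lower_central G n"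
  proof (induction n)
    case (Suc n)
    show ?case
    proof (cases "n \<ge> 1")
      case True
      let ?C = "{grp_comm G h k |h k. h \<in> lower_central G n \<and> k \<in> carrier G}"
      have C: "?C \<subseteq> carrier G" using lower_central_carrier by auto
      have "\<theta> ` ?C \<subseteq> ?C"
        using Suc lower_central_carrier by (force simp: \<theta>.hom_grp_comm)
      then have "generate G (\<theta> ` ?C) \<subseteq> generate G ?C" by (rule mono_generate)
      then show ?thesis
        using \<theta>.generate_img[OF C] True by (simp add: lower_central_Suc commutator_subgroup_eq)
    next
      case False
      then show ?thesis by (simp add: not_less_eq_eq image_subset_iff)
    qed
  qed (simp add: image_subset_iff)
  then show ?thesis using assms(2) by blast
qed

lemma subgroup_hom_eq_mod:
  assumes "\<theta> \<in> hom G G" "K \<lhd> G" "subgroup H G"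
  shows "subgroup {x \<in> H. \<theta> x \<otimes> inv x \<in> K} G"
proof -
  interpret \<theta>: group_hom G G \<theta> using assms(1) by unfold_locales
  interpret K: normal K G by fact
  interpret H: subgroup H G by fact
  show ?thesis
  proof (rule subgroupI)
    have "\<one> \<in> {x \<in> H. \<theta> x \<otimes> inv x \<in> K}" by simp
    then show "{x \<in> H. \<theta> x \<otimes> inv x \<in> K} \<noteq> {}" by blast
  next
    fix x assume "x \<in> {x \<in> H. \<theta> x \<otimes> inv x \<in> K}"
    moreover from this have "inv (\<theta> x) \<otimes> inv (\<theta> x \<otimes> inv x) \<otimes> \<theta> x \<in> K"
      by (intro K.inv_op_closed1 K.m_inv_closed) simp_all
    ultimately show "inv x \<in> {x \<in> H. \<theta> x \<otimes> inv x \<in> K}"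
      by (simp add: inv_mult_group m_assoc)
  next
    fix x y assume x: "x \<in> {x \<in> H. \<theta> x \<otimes> inv x \<in> K}" and y: "y \<in> {x \<in> H. \<theta> x \<otimes> inv x \<in> K}"
    have "(\<theta> x \<otimes> (\<theta> y \<otimes> inv y) \<otimes> inv (\<theta> x)) \<otimes> (\<theta> x \<otimes> inv x) \<in> K"
      using x y by (intro K.m_closed[OF K.inv_op_closed2]) simp_all
    then show "x \<otimes> y \<in> {x \<in> H. \<theta> x \<otimes> inv x \<in> K}"
      using x y by (simp add: inv_mult_group m_assoc)
  qed auto
qed

text \<open>Inversion respects products only in an abelian group, hence the hypothesis on the
  commutators of H.\<close>

lemma subgroup_hom_inv_mod:
  assumes "\<theta> \<in> hom G G" "K \<lhd> G" "subgroup H G"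
    and ab: "\<And>x y. x \<in> H \<Longrightarrow> y \<in> H \<Longrightarrow> grp_comm G x y \<in> K"
  shows "subgroup {x \<in> H. \<theta> x \<otimes> x \<in> K} G"
proof -
  interpret \<theta>: group_hom G G \<theta> using assms(1) by unfold_locales
  interpret K: normal K G by fact
  interpret H: subgroup H G by fact
  show ?thesis
  proof (rule subgroupI)
    have "\<one> \<in> {x \<in> H. \<theta> x \<otimes> x \<in> K}" by simp
    then show "{x \<in> H. \<theta> x \<otimes> x \<in> K} \<noteq> {}" by blast
  next
    fix x assume "x \<in> {x \<in> H. \<theta> x \<otimes> x \<in> K}"
    moreover from this have "x \<otimes> inv (\<theta> x \<otimes> x) \<otimes> inv x \<in> K"
      by (intro K.inv_op_closed2 K.m_inv_closed) simp_all
    ultimately show "inv x \<in> {x \<in> H. \<theta> x \<otimes> x \<in> K}"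
      by (simp add: inv_mult_group m_assoc)
  next
    fix x y assume x: "x \<in> {x \<in> H. \<theta> x \<otimes> x \<in> K}" and y: "y \<in> {x \<in> H. \<theta> x \<otimes> x \<in> K}"
    \<comment> \<open>The first two factors multiply to
      \<open>\<theta> x \<otimes> \<theta> y \<otimes> y \<otimes> x\<close>; the commutator of the
      inverses then turns \<open>y \<otimes> x\<close> into \<open>x \<otimes> y\<close>.\<close>
    have "(\<theta> x \<otimes> (\<theta> y \<otimes> y) \<otimes> inv (\<theta> x)) \<otimes> (\<theta> x \<otimes> x) \<otimes> grp_comm G (inv x) (inv y) \<in> K"
      using x y by (intro K.m_closed[OF K.m_closed[OF K.inv_op_closed2] ab]) simp_all
    then show "x \<otimes> y \<in> {x \<in> H. \<theta> x \<otimes> x \<in> K}"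
      using x y by (simp add: m_assoc grp_comm_def)
  qed auto
qed

text \<open>The sign is -1 on the abelianization, and each bracket with an inverted generator flips
  it, so it alternates with n. The disjunction avoids recording the parity; each half of the
  induction step proves the opposite sign one layer down.\<close>

lemma hom_on_layer:
  assumes \<theta>: "\<theta> \<in> hom G G" "\<theta> a = inv a" "\<theta> b = inv b"
    and ab: "a \<in> carrier G" "b \<in> carrier G" "generate G {a, b} = carrier G"
    and "n \<ge> 1"
  shows "(\<forall>x\<in>lower_central G n. \<theta> x \<otimes> inv x \<in> lower_central G (Suc n)) \<or>
    (\<forall>x\<in>lower_central G n. \<theta> x \<otimes> x \<in> lower_central G (Suc n))"
  using \<open>n \<ge> 1\<close>
proof (induction n rule: nat_induct_at_least)
  case base
  have "subgroup {x \<in> carrier G. \<theta> x \<otimes> x \<in> lower_central G 2} G"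
    using grp_comm_lower_central[of 1]
    by (intro subgroup_hom_inv_mod[OF \<theta>(1) lower_central_normal subgroup_self])
      (simp add: numeral_2_eq_2)
  from generate_subgroup_incl[OF _ this, of "{a, b}"]
  have "carrier G \<subseteq> {x \<in> carrier G. \<theta> x \<otimes> x \<in> lower_central G 2}"
    using ab \<theta> subgroup.one_closed[OF lower_central_subgroup[of 2]] by simp
  then show ?case by (auto simp: numeral_2_eq_2)
next
  case (Suc n)
  interpret \<theta>: group_hom G G \<theta> using \<theta>(1) by unfold_locales
  let ?L = "lower_central G (Suc n)" and ?K = "lower_central G (Suc (Suc n))"
  let ?Q = "G Mod ?K"
  interpret K: normal ?K G by (rule lower_central_normal)
  interpret \<pi>: group_hom G ?Q "(#>) ?K" by (rule group_hom_r_coset[OF lower_central_normal])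
  have central: "C \<otimes>\<^bsub>?Q\<^esub> (?K #> c) = (?K #> c) \<otimes>\<^bsub>?Q\<^esub> C"
    if "c \<in> ?L" "C \<in> carrier ?Q" for c C
    using that grp_comm_lower_central[of "Suc n" c]
    by (intro grp_comm_central_mod[OF lower_central_normal]) (auto intro: lower_central_carrier)
  have gen: "generate G ((\<lambda>x. grp_comm G x a) ` lower_central G n \<union>
      (\<lambda>x. grp_comm G x b) ` lower_central G n \<union> ?K) = ?L"
  proof (rule lower_central_Suc_generators[OF ab Suc.hyps order_refl])
    have "lower_central G n \<union> lower_central G (Suc n) = lower_central G n"
      using lower_central_Suc_subset[of n] by blast
    then show "generate G (lower_central G n \<union> lower_central G (Suc n)) = lower_central G n"
      using generateI[OF lower_central_subgroup] by (metis order_refl)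
  qed
  have gen_le: "?L \<subseteq> S"
    if "subgroup S G" "(\<lambda>x. grp_comm G x a) ` lower_central G n \<union>
      (\<lambda>x. grp_comm G x b) ` lower_central G n \<union> ?K \<subseteq> S" for S
    using generate_subgroup_incl[OF that(2,1)] unfolding gen .
  have \<theta>K: "\<theta> x \<in> ?K" if "x \<in> ?K" for x using hom_lower_central[OF \<theta>(1) that] .
  have \<theta>comm: "\<theta> (grp_comm G x h) = grp_comm G (\<theta> x) (inv h)"
    if "x \<in> carrier G" "h \<in> {a, b}" for x h
    using that ab \<theta> by (auto simp: \<theta>.hom_grp_comm)
  have cl: "grp_comm G x h \<in> ?L" if "x \<in> lower_central G n" "h \<in> carrier G" for x h
    using that Suc.hyps by (rule grp_comm_lower_central[rotated])
  note pm = \<pi>.H.grp_comm_central_cases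
  from Suc.IH show ?case
  proof
    assume IH: "\<forall>x\<in>lower_central G n. \<theta> x \<otimes> inv x \<in> ?L"
    have *: "\<theta> (grp_comm G x h) \<otimes> grp_comm G x h \<in> ?K"
      if x: "x \<in> lower_central G n" and h: "h \<in> {a, b}" for x h
    proof -
      have carr: "x \<in> carrier G" "h \<in> carrier G" using x h ab by (auto intro: lower_central_carrier)
      \<comment> \<open>The error d of the induction hypothesis lies in \<open>?L\<close>, which is
        central modulo \<open>?K\<close>, so it drops out of the bracket.\<close>
      define d where "d = \<theta> x \<otimes> inv x"
      have d: "d \<in> ?L" "d \<in> carrier G" "\<theta> x = d \<otimes> x"
        using IH x carr by (auto simp: d_def m_assoc)
      have "?K #> grp_comm G (d \<otimes> x) (inv h) =
          grp_comm ?Q ((?K #> d) \<otimes>\<^bsub>?Q\<^esub> (?K #> x)) (inv\<^bsub>?Q\<^esub> (?K #> h))"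
        using d carr by (simp add: \<pi>.hom_grp_comm \<pi>.hom_mult[symmetric] \<pi>.hom_inv[symmetric]
            del: \<pi>.hom_mult \<pi>.hom_inv mult_FactGroup)
      also have "\<dots> = inv\<^bsub>?Q\<^esub> (grp_comm ?Q (?K #> x) (?K #> h))"
        using central[OF d(1)] central[OF cl[OF x carr(2)]] carr d
        by (intro pm(1)) (simp_all add: \<pi>.hom_grp_comm del: mult_FactGroup)
      also have "\<dots> = ?K #> inv (grp_comm G x h)"
        using carr by (simp add: \<pi>.hom_grp_comm)
      finally show ?thesis
        using carr d h by (simp add: \<theta>comm r_coset_eq_iff[OF K.subgroup_axioms]
            del: \<pi>.hom_inv)
    qed
    have "subgroup {x \<in> ?L. \<theta> x \<otimes> x \<in> ?K} G"
      by (intro subgroup_hom_inv_mod[OF \<theta>(1) lower_central_normal lower_central_subgroup]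
          grp_comm_lower_central) (auto intro: lower_central_carrier)
    moreover have "(\<lambda>x. grp_comm G x a) ` lower_central G n \<union>
      (\<lambda>x. grp_comm G x b) ` lower_central G n \<union> ?K \<subseteq> {x \<in> ?L. \<theta> x \<otimes> x \<in> ?K}"
      unfolding Un_subset_iff image_subset_iff mem_Collect_eq
      using * cl ab(1,2) subsetD[OF lower_central_Suc_subset[of "Suc n"]] K.m_closed[OF \<theta>K]
      by (intro conjI ballI subsetI CollectI) blast+
    ultimately have "?L \<subseteq> {x \<in> ?L. \<theta> x \<otimes> x \<in> ?K}"
      by (rule gen_le)
    then show ?thesis by blast
  next
    assume IH: "\<forall>x\<in>lower_central G n. \<theta> x \<otimes> x \<in> ?L"
    have *: "\<theta> (grp_comm G x h) \<otimes> inv (grp_comm G x h) \<in> ?K"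
      if x: "x \<in> lower_central G n" and h: "h \<in> {a, b}" for x h
    proof -
      have carr: "x \<in> carrier G" "h \<in> carrier G" using x h ab by (auto intro: lower_central_carrier)
      define d where "d = \<theta> x \<otimes> x"
      have d: "d \<in> ?L" "d \<in> carrier G" "\<theta> x = d \<otimes> inv x"
        using IH x carr by (auto simp: d_def m_assoc)
      have "?K #> grp_comm G (d \<otimes> inv x) (inv h) =
          grp_comm ?Q ((?K #> d) \<otimes>\<^bsub>?Q\<^esub> inv\<^bsub>?Q\<^esub> (?K #> x)) (inv\<^bsub>?Q\<^esub> (?K #> h))"
        using d carr by (simp add: \<pi>.hom_grp_comm \<pi>.hom_mult[symmetric] \<pi>.hom_inv[symmetric]
            del: \<pi>.hom_mult \<pi>.hom_inv mult_FactGroup)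
      also have "\<dots> = grp_comm ?Q (?K #> x) (?K #> h)"
        using central[OF d(1)] central[OF cl[OF x carr(2)]] carr d
        by (intro pm(2)) (simp_all add: \<pi>.hom_grp_comm del: mult_FactGroup)
      also have "\<dots> = ?K #> grp_comm G x h"
        using carr by (simp add: \<pi>.hom_grp_comm)
      finally show ?thesis
        using carr d h by (simp add: \<theta>comm r_coset_eq_iff[OF K.subgroup_axioms]
            del: \<pi>.hom_inv)
    qed
    have "(\<lambda>x. grp_comm G x a) ` lower_central G n \<union>
      (\<lambda>x. grp_comm G x b) ` lower_central G n \<union> ?K \<subseteq> {x \<in> ?L. \<theta> x \<otimes> inv x \<in> ?K}"
      unfolding Un_subset_iff image_subset_iff mem_Collect_eq
      using * cl ab(1,2) subsetD[OF lower_central_Suc_subset[of "Suc n"]] K.m_closed[OF \<theta>K K.m_inv_closed]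
      by (intro conjI ballI subsetI CollectI) blast+
    then have "?L \<subseteq> {x \<in> ?L. \<theta> x \<otimes> inv x \<in> ?K}"
      by (rule gen_le[OF subgroup_hom_eq_mod[OF \<theta>(1) lower_central_normal lower_central_subgroup]])
    then show ?thesis by blast
  qed
qed

text \<open>Modulo the lower term \<theta> sends x to x or to its inverse, and B contains that
  term.\<close>

lemma hom_layer_subgroup:
  assumes \<theta>: "\<theta> \<in> hom G G" "\<theta> a = inv a" "\<theta> b = inv b"
    and ab: "a \<in> carrier G" "b \<in> carrier G" "generate G {a, b} = carrier G"
    and B: "n \<ge> 1" "subgroup B G" "lower_central G (Suc n) \<subseteq> B" "B \<subseteq> lower_central G n"
    and x: "x \<in> B"
  shows "\<theta> x \<in> B"
proof -
  interpret B: subgroup B G by fact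
  have c: "x \<in> carrier G" "\<theta> x \<in> carrier G"
    using x hom_in_carrier[OF \<theta>(1)] by auto
  have *: "y \<in> B" if "y \<in> carrier G" "z \<in> B" "y \<otimes> z \<in> B" for y z
  proof -
    have "y \<otimes> z \<otimes> inv z \<in> B" using that by blast
    then show ?thesis using that by (simp add: m_assoc)
  qed
  show ?thesis
    using hom_on_layer[OF \<theta> ab B(1)] *[of "\<theta> x" x] *[of "\<theta> x" "inv x"] x c B by blast
qed

end

section \<open>Steps of prime index\<close>

text \<open>Dependent choice concatenates infinitely many finite paths. They come from the
  transitive, not the reflexive transitive closure, so each has positive length and the countdown to
  the next \<open>g n\<close> never starts at zero.\<close>

lemma tranclp_path_sequence:
  assumes "\<And>n::nat. R\<^sup>+\<^sup>+ (g n) (g (Suc n))"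
  shows "\<exists>N::nat \<Rightarrow> 'a. N 0 = g 0 \<and> (\<forall>i. R (N i) (N (Suc i))) \<and> (\<forall>n. \<exists>i. N i = g n)"
proof -
  have path: "\<exists>j>0. (R ^^ j) (g n) (g (Suc n))" for n
    using assms[of n] by (simp add: tranclp_power)
  then obtain j0 where j0: "j0 > 0" "(R ^^ j0) (g 0) (g (Suc 0))" by blast
  \<comment> \<open>A state \<open>(n, x, j)\<close> records that \<open>x\<close> is \<open>j > 0\<close> steps away from \<open>g (Suc n)\<close>.\<close>
  define I where "I i s \<longleftrightarrow> (case s of (n, x, j) \<Rightarrow> j > 0 \<and> (R ^^ j) x (g (Suc n)) \<and> (i = 0 \<longrightarrow> s = (0, g 0, j0)))"
    for i :: nat and s :: "nat \<times> 'a \<times> nat"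
  define next_state where "next_state s t \<longleftrightarrow> (case s of (n, x, j) \<Rightarrow> case t of (n', x', j') \<Rightarrow> R x x' \<and>
      (if j = 1 then n' = Suc n \<and> x' = g n' else n' = n \<and> Suc j' = j))"
    for s t :: "nat \<times> 'a \<times> nat"
  have "\<exists>f. \<forall>i. I i (f i) \<and> next_state (f i) (f (Suc i))"
  proof (rule dependent_nat_choice)
    show "\<exists>s. I 0 s" using j0 by (auto simp: I_def)
  next
    fix s i assume "I i s"
    then obtain n x j where s: "s = (n, x, j)" "j > 0" "(R ^^ j) x (g (Suc n))"
      by (auto simp: I_def)
    then obtain j' y where j': "j = Suc j'" "R x y" "(R ^^ j') y (g (Suc n))"
      by (metis gr0_conv_Suc relpowp_Suc_E2)
    show "\<exists>t. I (Suc i) t \<and> next_state s t"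
    proof (cases "j' = 0")
      case True
      obtain l where "l > 0" "(R ^^ l) (g (Suc n)) (g (Suc (Suc n)))" using path by blast
      then show ?thesis
        using True j' s by (intro exI[of _ "(Suc n, y, l)"]) (simp add: I_def next_state_def)
    next
      case False
      then show ?thesis
        using j' s by (intro exI[of _ "(n, y, j')"]) (simp add: I_def next_state_def)
    qed
  qed
  then obtain f where f: "\<And>i. I i (f i)" "\<And>i. next_state (f i) (f (Suc i))" by blast
  define N where "N i = fst (snd (f i))" for i
  have f0: "f 0 = (0, g 0, j0)" using f(1)[of 0] by (auto simp: I_def)
  have adv: "\<exists>i' l. f i' = (Suc n, g (Suc n), l)" if "f i = (n, x, j)" for i n x j
    using that
  proof (induction j arbitrary: i x rule: less_induct)
    case (less j)
    obtain n' x' j' where s: "f (Suc i) = (n', x', j')" using prod_cases3 by blast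
    have "next_state (n, x, j) (n', x', j')" using f(2)[of i] less.prems s by simp
    then show ?case
      using less.IH[of j' "Suc i" x'] s by (cases "j = 1") (auto simp: next_state_def)
  qed
  have hit: "\<exists>i l. f i = (n, g n, l)" for n
  proof (induction n)
    case 0
    show ?case using f0 by blast
  next
    case (Suc n)
    then show ?case using adv by blast
  qed
  show ?thesis
  proof (intro exI[of _ N] conjI allI)
    show "N 0 = g 0" by (simp add: N_def f0)
    show "R (N i) (N (Suc i))" for i
      using f(2)[of i] by (auto simp: N_def next_state_def split: prod.splits)
    show "\<exists>i. N i = g n" for n using hit[of n] by (auto simp: N_def) (metis fst_conv snd_conv)
  qed
qed

text \<open>The last conjunct confines a step to a single layer; this is what later makes each term
  normal and stable under \<theta>. For p > 0 the cardinality also asserts that the index is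
  finite.\<close>

definition layer_step :: "('a, 'b) monoid_scheme \<Rightarrow> nat \<Rightarrow> 'a set \<Rightarrow> 'a set \<Rightarrow> bool" where
  "layer_step G p H K \<longleftrightarrow> subgroup H G \<and> subgroup K G \<and> K \<subseteq> H \<and>
     card (rcosets\<^bsub>G\<lparr>carrier := H\<rparr>\<^esub> K) = p \<and>
     (\<exists>n\<ge>1. lower_central G (Suc n) \<subseteq> K \<and> H \<subseteq> lower_central G n)"

context group
begin

lemma generate_insert_generate:
  assumes "S \<subseteq> carrier G" "x \<in> carrier G"
  shows "generate G (insert x (generate G S)) = generate G (insert x S)"
proof
  have "insert x (generate G S) \<subseteq> generate G (insert x S)"
    using mono_generate[of S "insert x S"] by (auto intro: generate.incl)
  then show "generate G (insert x (generate G S)) \<subseteq> generate G (insert x S)"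
    using assms by (intro generate_subgroup_incl generate_is_subgroup) auto
  show "generate G (insert x S) \<subseteq> generate G (insert x (generate G S))"
    by (intro mono_generate) (auto intro: generate.incl)
qed

lemma rcosets_subgroup_image: "rcosets\<^bsub>G\<lparr>carrier := H\<rparr>\<^esub> K = (#>) K ` H"
  by (auto simp: RCOSETS_def)

text \<open>The cosets form the cyclic group generated by the coset of x, whose order divides p and
  is not 1.\<close>

lemma card_rcosets_generate_insert:
  assumes "K \<lhd> G" "x \<in> carrier G" "x \<notin> K" "x [^] p \<in> K" "Factorial_Ring.prime (p::nat)"
  shows "card (rcosets\<^bsub>G\<lparr>carrier := generate G (insert x K)\<rparr>\<^esub> K) = p"
proof -
  interpret K: normal K G by fact
  interpret \<pi>: group_hom G "G Mod K" "(#>) K" by (rule group_hom_r_coset[OF assms(1)])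
  have sub: "insert x K \<subseteq> carrier G" using assms(2) K.subset by blast
  have "(#>) K ` insert x K = {K #> x, \<one>\<^bsub>G Mod K\<^esub>}"
  proof -
    have "K #> y = K" if "y \<in> K" for y using K.rcos_const[OF is_group that] .
    then have "(#>) K ` K = (\<lambda>_. K) ` K" by (rule image_cong[OF HOL.refl])
    also have "\<dots> = {K}" using K.one_closed by blast
    finally show ?thesis by simp
  qed
  then have "(#>) K ` generate G (insert x K) = generate (G Mod K) {K #> x, \<one>\<^bsub>G Mod K\<^esub>}"
    using \<pi>.generate_img[OF sub] by simp
  also have "\<dots> = generate (G Mod K) {K #> x}"
  proof
    have "subgroup (generate (G Mod K) {K #> x}) (G Mod K)"
      using assms(2) by (intro \<pi>.H.generate_is_subgroup) simp
    then show "generate (G Mod K) {K #> x, \<one>\<^bsub>G Mod K\<^esub>} \<subseteq> generate (G Mod K) {K #> x}"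
      using generate.incl[of "K #> x" "{K #> x}"] generate.one[of "G Mod K" "{K #> x}"]
      by (intro \<pi>.H.generate_subgroup_incl) simp_all
    show "generate (G Mod K) {K #> x} \<subseteq> generate (G Mod K) {K #> x, \<one>\<^bsub>G Mod K\<^esub>}"
      by (rule \<pi>.H.mono_generate) simp
  qed
  finally have "card (rcosets\<^bsub>G\<lparr>carrier := generate G (insert x K)\<rparr>\<^esub> K) = \<pi>.H.ord (K #> x)"
    using \<pi>.H.generate_pow_card[of "K #> x"] assms(2) by (simp add: rcosets_subgroup_image)
  moreover have "\<pi>.H.ord (K #> x) dvd p"
    using assms(2,4) by (simp add: \<pi>.hom_nat_pow[symmetric] K.rcos_const flip: \<pi>.H.pow_eq_id)
  moreover have "\<pi>.H.ord (K #> x) \<noteq> 1"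
    using assms(2,3) \<pi>.H.ord_eq_1[of "K #> x"] r_coset_eq_self_iff[OF K.subgroup_axioms] by simp
  ultimately show ?thesis
    using assms(5) by (auto simp: prime_nat_iff)
qed

text \<open>The p-th power y of x is adjoined before x: y needs one power of p less to enter B, and
  afterwards x contributes either nothing or a single step of index p.\<close>

lemma layer_steps_insert:
  assumes p: "Factorial_Ring.prime p" and n: "n \<ge> 1"
    and B: "subgroup B G" "lower_central G (Suc n) \<subseteq> B" "B \<subseteq> lower_central G n"
    and x: "x \<in> lower_central G n" "x [^] (p ^ k) \<in> B"
  shows "(layer_step G p)\<^sup>*\<^sup>* (generate G (insert x B)) B"
  using x
proof (induction k arbitrary: x)
  case 0
  then have "x \<in> B" using lower_central_carrier by simp
  then have "generate G (insert x B) = B"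
    using generateI[OF B(1), of B] by (simp add: insert_absorb)
  then show ?case by simp
next
  case (Suc k)
  have xc: "x \<in> carrier G" using Suc.prems lower_central_carrier by blast
  define y where "y = x [^] p"
  define B' where "B' = generate G (insert y B)"
  have y: "y \<in> lower_central G n"
    unfolding y_def using Suc.prems(1) subgroup_int_pow_closed[OF lower_central_subgroup]
    by (metis int_pow_int)
  have yc: "y \<in> carrier G" using y lower_central_carrier by blast
  have "y [^] (p ^ k) \<in> B" using Suc.prems(2) xc by (simp add: y_def nat_pow_pow)
  with Suc.IH y have steps: "(layer_step G p)\<^sup>*\<^sup>* B' B" unfolding B'_def by blast
  have Bc: "B \<subseteq> carrier G" using subgroup.subset[OF B(1)] .
  have B': "subgroup B' G" "B \<subseteq> B'" "y \<in> B'" "B' \<subseteq> lower_central G n"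
    unfolding B'_def
  proof -
    show "subgroup (generate G (insert y B)) G" using yc Bc by (intro generate_is_subgroup) simp
    show "B \<subseteq> generate G (insert y B)" "y \<in> generate G (insert y B)"
      by (auto intro: generate.incl)
    show "generate G (insert y B) \<subseteq> lower_central G n"
      using y B(3) by (intro generate_subgroup_incl lower_central_subgroup) simp
  qed
  have B'n: "B' \<lhd> G"
    using layer_subgroup_normal[OF n B'(1)] B' B(2) by blast
  have sub_x: "subgroup (generate G (insert x B)) G"
    using xc Bc by (intro generate_is_subgroup) simp
  have x_in: "insert x B \<subseteq> generate G (insert x B)" by (auto intro: generate.incl)
  then have "y \<in> generate G (insert x B)"
    using subgroup_int_pow_closed[OF sub_x, of x "int p"] by (simp add: int_pow_int y_def)
  then have "B' \<subseteq> generate G (insert x B)"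
    unfolding B'_def using x_in by (intro generate_subgroup_incl[OF _ sub_x]) simp
  then have "generate G (insert x B') \<subseteq> generate G (insert x B)"
    using x_in by (intro generate_subgroup_incl[OF _ sub_x]) simp
  moreover have "generate G (insert x B) \<subseteq> generate G (insert x B')"
    using B'(2) by (intro mono_generate) auto
  ultimately have eq: "generate G (insert x B) = generate G (insert x B')" by blast
  show ?case
  proof (cases "x \<in> B'")
    case True
    then have "generate G (insert x B') = B'"
      using generateI[OF B'(1), of B'] by (simp add: insert_absorb)
    then show ?thesis using steps eq by simp
  next
    case False
    have sub: "insert x B' \<subseteq> carrier G" using xc B'(1) subgroup.subset by blast
    have "card (rcosets\<^bsub>G\<lparr>carrier := generate G (insert x B')\<rparr>\<^esub> B') = p"
      using card_rcosets_generate_insert[OF B'n xc False _ p] B'(3) y_def by blast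
    moreover have "generate G (insert x B') \<subseteq> lower_central G n"
      using B'(4) Suc.prems(1) by (intro generate_subgroup_incl lower_central_subgroup) auto
    ultimately have "layer_step G p (generate G (insert x B')) B'"
      unfolding layer_step_def using n B'(1,2) B(2) generate_is_subgroup[OF sub]
      by (auto intro: generate.incl)
    then show ?thesis using steps eq by (simp add: converse_rtranclp_into_rtranclp)
  qed
qed

lemma layer_steps_generate:
  assumes p: "Factorial_Ring.prime p" and n: "n \<ge> 1"
    and "finite Y" "Y \<subseteq> lower_central G n" "\<forall>x\<in>Y. x [^] (p ^ k) \<in> lower_central G (Suc n)"
  shows "(layer_step G p)\<^sup>*\<^sup>* (generate G (Y \<union> lower_central G (Suc n))) (lower_central G (Suc n))"
  using assms(3-)
proof (induction Y rule: finite_induct)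
  case empty
  have "generate G (lower_central G (Suc n)) = lower_central G (Suc n)"
    using generateI[OF lower_central_subgroup] by (metis order_refl)
  then show ?case by simp
next
  case (insert x Y)
  let ?B = "generate G (Y \<union> lower_central G (Suc n))"
  have sub: "Y \<union> lower_central G (Suc n) \<subseteq> lower_central G n"
    using insert.prems lower_central_Suc_subset[of n] by blast
  have "(layer_step G p)\<^sup>*\<^sup>* (generate G (insert x ?B)) ?B"
  proof (rule layer_steps_insert[OF p n])
    show "subgroup ?B G" using sub lower_central_carrier by (intro generate_is_subgroup) blast
    show "lower_central G (Suc n) \<subseteq> ?B" by (auto intro: generate.incl)
    show "?B \<subseteq> lower_central G n" by (rule generate_subgroup_incl[OF sub lower_central_subgroup])
    show "x \<in> lower_central G n" using insert.prems by blast
    show "x [^] (p ^ k) \<in> ?B" using insert.prems by (auto intro: generate.incl)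
  qed
  moreover have "generate G (insert x ?B) = generate G (insert x Y \<union> lower_central G (Suc n))"
    using sub insert.prems lower_central_carrier by (subst generate_insert_generate) auto
  ultimately show ?case using insert.IH insert.prems by (simp add: rtranclp_trans)
qed

lemma layer_steps_lower_central:
  assumes p: "Factorial_Ring.prime p" and n: "n \<ge> 1"
    and ab: "a \<in> carrier G" "b \<in> carrier G" "generate G {a, b} = carrier G"
    and q: "a [^] (p ^ k) = \<one>" "b [^] (p ^ k) = \<one>"
  shows "(layer_step G p)\<^sup>*\<^sup>* (lower_central G n) (lower_central G (Suc n))"
  using lower_central_layer_generators[OF ab q n] layer_steps_generate[OF p n] by metis

section \<open>Finite index of the terms and finiteness of the quotients\<close>

lemma finite_rcosets_trans:
  assumes "subgroup H G" "subgroup K G" "finite (rcosets H)" "finite (rcosets\<^bsub>G\<lparr>carrier := H\<rparr>\<^esub> K)"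
  shows "finite (rcosets K)"
proof -
  \<comment> \<open>A coset of K is the translate, by a representative chosen for its H-coset, of a
    coset of K inside H, so pairs of cosets cover everything. The group itself may be
    infinite.\<close>
  let ?f = "\<lambda>(C, D). C #> (SOME t. t \<in> D)"
  have "rcosets K \<subseteq> ?f ` ((rcosets\<^bsub>G\<lparr>carrier := H\<rparr>\<^esub> K) \<times> (rcosets H))"
  proof
    fix C assume "C \<in> rcosets K"
    then obtain g where g: "g \<in> carrier G" "C = K #> g" by (auto simp: RCOSETS_def)
    define t where "t = (SOME t. t \<in> H #> g)"
    have t: "t \<in> H #> g" unfolding t_def using rcos_self[OF g(1) assms(1)] by (rule someI)
    have tc: "t \<in> carrier G" using t g subgroup.elemrcos_carrier[OF assms(1) is_group] by blast
    have "g \<otimes> inv t \<in> H"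
      using t g tc assms(1) repr_independence r_coset_eq_iff by metis
    then have "K #> (g \<otimes> inv t) \<in> rcosets\<^bsub>G\<lparr>carrier := H\<rparr>\<^esub> K"
      by (simp add: rcosets_subgroup_image)
    moreover have "C = (K #> (g \<otimes> inv t)) #> t"
      using g tc subgroup.subset[OF assms(2)] by (simp add: coset_mult_assoc m_assoc)
    moreover have "H #> g \<in> rcosets H" using g by (auto simp: RCOSETS_def)
    ultimately show "C \<in> ?f ` ((rcosets\<^bsub>G\<lparr>carrier := H\<rparr>\<^esub> K) \<times> (rcosets H))"
      unfolding t_def by (intro rev_image_eqI[of "(K #> (g \<otimes> inv t), H #> g)"]) (auto simp: t_def)
  qed
  then show ?thesis using assms(3,4) finite_subset by blast
qed

lemma finite_rcosets_lower_central:
  assumes p: "Factorial_Ring.prime (p::nat)"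
    and ab: "a \<in> carrier G" "b \<in> carrier G" "generate G {a, b} = carrier G"
    and q: "a [^] (p ^ k) = \<one>" "b [^] (p ^ k) = \<one>"
  shows "finite (rcosets (lower_central G n))"
proof (induction n)
  case 0
  have "rcosets (carrier G) = {carrier G}"
    using coset_join2[OF _ subgroup_self] by (auto simp: RCOSETS_def)
  then show ?case by simp
next
  case (Suc n)
  show ?case
  proof (cases "n \<ge> 1")
    case False
    then show ?thesis using Suc by (simp add: not_less_eq_eq)
  next
    case True
    have "finite (rcosets K)" if "(layer_step G p)\<^sup>*\<^sup>* (lower_central G n) K" for K
      using that
    proof (induction rule: rtranclp_induct)
      case base
      show ?case by (rule Suc.IH)
    next
      case (step H K)
      then show ?case
        using finite_rcosets_trans prime_gt_0_nat[OF p] card_ge_0_finite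
        unfolding layer_step_def by metis
    qed
    then show ?thesis using layer_steps_lower_central[OF p True ab q] by blast
  qed
qed

lemma finite_Mod:
  assumes "finite (rcosets K)" "subgroup K G" "N \<lhd> G" "K \<subseteq> N"
  shows "finite (carrier (G Mod N))"
proof -
  interpret N: normal N G by fact
  have "carrier (G Mod N) \<subseteq> (\<lambda>C. N <#> C) ` (rcosets K)"
  proof
    fix C assume "C \<in> carrier (G Mod N)"
    then obtain g where g: "g \<in> carrier G" "C = N #> g" by (auto simp: carrier_FactGroup)
    have "N <#> K = N"
    proof
      show "N <#> K \<subseteq> N" using assms(4) by (auto simp: set_mult_def)
      show "N \<subseteq> N <#> K"
        using subgroup.one_closed[OF assms(2)] N.mem_carrier by (force simp: set_mult_def)
    qed
    then have "C = N <#> (K #> g)"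
      using g assms(2) N.subset subgroup.subset by (metis setmult_rcos_assoc)
    then show "C \<in> (\<lambda>C. N <#> C) ` (rcosets K)" using g by (auto simp: RCOSETS_def)
  qed
  then show ?thesis using assms(1) finite_subset by blast
qed

text \<open>A subgroup that generates modulo the derived subgroup maps onto every nilpotent
  quotient. In the step, B is normalized by H and by the n-th term, hence normal; modulo B the group
  is generated by the image of the n-th term, which is central. So G/B is abelian, B contains the
  derived subgroup, and B is everything.\<close>

lemma generate_Un_lower_central:
  assumes H: "subgroup H G" "generate G (H \<union> lower_central G 2) = carrier G" and "n \<ge> 2"
  shows "generate G (H \<union> lower_central G n) = carrier G"
  using \<open>n \<ge> 2\<close>
proof (induction n rule: nat_induct_at_least)
  case base
  show ?case by (rule H(2))
next
  case (Suc n)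
  let ?L = "lower_central G n" and ?L' = "lower_central G (Suc n)"
  define B where "B = generate G (H \<union> ?L')"
  have sub: "H \<union> ?L' \<subseteq> carrier G" using subgroup.subset[OF H(1)] lower_central_carrier by blast
  have B: "subgroup B G" "H \<subseteq> B" "?L' \<subseteq> B"
    unfolding B_def using generate_is_subgroup[OF sub] by (auto intro: generate.incl)
  interpret B: subgroup B G by (rule B(1))
  have conj_L: "g \<otimes> x \<otimes> inv g \<in> B" if "g \<in> ?L" "x \<in> B" for g x
  proof -
    have "grp_comm G g x \<otimes> x \<in> B"
      using that B(3) grp_comm_lower_central[of n g x] Suc.hyps by auto
    then show ?thesis
      using that lower_central_carrier[of g n] by (simp add: grp_comm_def m_assoc)
  qed
  \<comment> \<open>This is the normalizer of B. Both directions are demanded because B may be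
    infinite, where one inclusion would not be closed under inverses.\<close>
  define N where "N = {g \<in> carrier G. \<forall>x\<in>B. g \<otimes> x \<otimes> inv g \<in> B \<and> inv g \<otimes> x \<otimes> g \<in> B}"
  have "subgroup N G"
  proof (rule subgroupI)
    have "\<one> \<in> N" by (simp add: N_def)
    then show "N \<noteq> {}" by blast
  next
    fix g h assume g: "g \<in> N" and h: "h \<in> N"
    have c: "g \<in> carrier G" "h \<in> carrier G" using g h by (auto simp: N_def)
    have "g \<otimes> h \<otimes> x \<otimes> inv (g \<otimes> h) \<in> B" "inv (g \<otimes> h) \<otimes> x \<otimes> (g \<otimes> h) \<in> B" if x: "x \<in> B" for x
    proof -
      have "g \<otimes> (h \<otimes> x \<otimes> inv h) \<otimes> inv g \<in> B" "inv h \<otimes> (inv g \<otimes> x \<otimes> g) \<otimes> h \<in> B"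
        using g h x unfolding N_def by blast+
      then show "g \<otimes> h \<otimes> x \<otimes> inv (g \<otimes> h) \<in> B" "inv (g \<otimes> h) \<otimes> x \<otimes> (g \<otimes> h) \<in> B"
        using c x by (simp_all add: inv_mult_group m_assoc)
    qed
    then show "g \<otimes> h \<in> N" using c by (simp add: N_def)
  qed (auto simp: N_def)
  moreover have "H \<union> ?L \<subseteq> N"
  proof
    fix g assume g: "g \<in> H \<union> ?L"
    have gc: "g \<in> carrier G" using g subgroup.subset[OF H(1)] lower_central_carrier by blast
    show "g \<in> N"
    proof (cases "g \<in> H")
      case True
      then show ?thesis using B(2) gc by (auto simp: N_def)
    next
      case False
      then have "g \<in> ?L" "inv g \<in> ?L"
        using g subgroup.m_inv_closed[OF lower_central_subgroup] by blast+
      then show ?thesis using gc conj_L[of g] conj_L[of "inv g"] by (simp add: N_def)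
    qed
  qed
  ultimately have "carrier G \<subseteq> N" using generate_subgroup_incl Suc.IH by metis
  then have normal: "B \<lhd> G" using B(1) by (auto simp: normal_inv_iff N_def)
  have 1: "grp_comm G x y \<in> B" if "x \<in> carrier G" "y \<in> ?L" for x y
  proof -
    have "inv (grp_comm G y x) \<in> B"
      using that B(3) grp_comm_lower_central[of n y x] Suc.hyps by auto
    then show ?thesis
      using that lower_central_carrier[of y n] by (simp add: grp_comm_def inv_mult_group m_assoc)
  qed
  have 2: "grp_comm G x y \<in> B" if "x \<in> carrier G" "y \<in> H" for x y
  proof -
    have yc: "y \<in> carrier G" using that subgroup.subset[OF H(1)] by blast
    have "H \<union> ?L \<subseteq> {x \<in> carrier G. grp_comm G x y \<in> B}"
      using that B(2,3) grp_comm_lower_central[of n _ y] Suc.hyps yc subgroup.subset[OF H(1)]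
        lower_central_carrier[of _ n] by (auto simp: grp_comm_def)
    from generate_subgroup_incl[OF this subgroup_centralizer_mod_left[OF normal yc]]
    show ?thesis using that Suc.IH by auto
  qed
  have 3: "grp_comm G x y \<in> B" if "x \<in> carrier G" "y \<in> carrier G" for x y
  proof -
    have "H \<union> ?L \<subseteq> {y \<in> carrier G. grp_comm G x y \<in> B}"
      using 1[OF that(1)] 2[OF that(1)] subgroup.subset[OF H(1)] lower_central_carrier by blast
    from generate_subgroup_incl[OF this subgroup_centralizer_mod_right[OF normal that(1)]]
    show ?thesis using that Suc.IH by auto
  qed
  have "lower_central G 2 = commutator_subgroup G (carrier G) (carrier G)"
    using lower_central_Suc[of 1 G] by (simp add: numeral_2_eq_2)
  then have "lower_central G 2 \<subseteq> B"
    unfolding commutator_subgroup_eq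
    using 3 generate_subgroup_incl[OF _ B(1), of "{grp_comm G h k |h k. h \<in> carrier G \<and> k \<in> carrier G}"]
    by auto
  then have "carrier G \<subseteq> B"
    using generate_subgroup_incl[OF _ B(1), of "H \<union> lower_central G 2"] B(2) H(2) by auto
  then show ?case using B.subset unfolding B_def by blast
qed

end

section \<open>The triangle group and homomorphisms to semidirect products\<close>

definition triangle_rels :: "nat \<Rightarrow> nat \<Rightarrow> two_gens gword set" where
  "triangle_rels q r = {replicate q (gen_a, True), replicate q (gen_b, True),
     concat (replicate r [(gen_a, True), (gen_b, True)])}"

definition triangle_gen :: "nat \<Rightarrow> nat \<Rightarrow> two_gens \<Rightarrow> two_gens gword set" where
  "triangle_gen q r x = pres_class (triangle_rels q r) [(x, True)]"

lemma triangle_group_eq: "triangle_group q r = presented_group (triangle_rels q r)"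
  by (simp add: triangle_group_def triangle_rels_def)

lemma group_triangle_group: "group (triangle_group q r)"
  by (simp add: triangle_group_eq group_presented_group)

lemma triangle_gen_closed [simp]: "triangle_gen q r x \<in> carrier (triangle_group q r)"
  by (simp add: triangle_group_eq triangle_gen_def carrier_presented_group)

lemma pres_class_pow:
  "pres_class R w [^]\<^bsub>presented_group R\<^esub> n = pres_class R (concat (replicate n w))"
proof (induction n)
  case 0
  show ?case by (simp add: one_presented_group)
next
  case (Suc n)
  have "concat (replicate n w) @ w = w @ concat (replicate n w)" by (induction n) auto
  with Suc show ?case by (simp add: mult_presented_group)
qed

lemma triangle_relations:
  fixes q r :: nat
  defines "T \<equiv> triangle_group q r" and "a \<equiv> triangle_gen q r gen_a" and "b \<equiv> triangle_gen q r gen_b"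
  shows "a [^]\<^bsub>T\<^esub> q = \<one>\<^bsub>T\<^esub>" "b [^]\<^bsub>T\<^esub> q = \<one>\<^bsub>T\<^esub>" "(a \<otimes>\<^bsub>T\<^esub> b) [^]\<^bsub>T\<^esub> r = \<one>\<^bsub>T\<^esub>"
proof -
  let ?R = "triangle_rels q r"
  have c: "concat (replicate n [l]) = replicate n l" for n and l :: "two_gens \<times> bool"
    by (induction n) auto
  have rel: "pres_class ?R w = pres_class ?R []" if "w \<in> ?R" for w
    using that by (simp add: pres_class_eq_iff pres_eq.relator)
  show "a [^]\<^bsub>T\<^esub> q = \<one>\<^bsub>T\<^esub>" "b [^]\<^bsub>T\<^esub> q = \<one>\<^bsub>T\<^esub>" "(a \<otimes>\<^bsub>T\<^esub> b) [^]\<^bsub>T\<^esub> r = \<one>\<^bsub>T\<^esub>"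
    unfolding T_def a_def b_def triangle_gen_def triangle_group_eq
    by (simp_all add: mult_presented_group pres_class_pow one_presented_group c)
      (rule rel; simp add: triangle_rels_def)+
qed

lemma triangle_generate:
  fixes q r :: nat
  defines "T \<equiv> triangle_group q r" and "a \<equiv> triangle_gen q r gen_a" and "b \<equiv> triangle_gen q r gen_b"
  shows "generate T {a, b} = carrier T"
proof
  interpret T: group T unfolding T_def by (rule group_triangle_group)
  let ?R = "triangle_rels q r"
  show "generate T {a, b} \<subseteq> carrier T"
    by (intro T.generate_incl) (simp add: a_def b_def T_def)
  have letter: "pres_class ?R [(x, s)] \<in> generate T {a, b}" for x s
  proof -
    have pos: "pres_class ?R [(x, True)] \<in> {a, b}"
      by (cases x) (simp_all add: a_def b_def triangle_gen_def)
    have "pres_class ?R [(x, False)] \<otimes>\<^bsub>T\<^esub> pres_class ?R [(x, True)] = \<one>\<^bsub>T\<^esub>"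
      using pres_eq.cancel[of ?R x False]
      by (simp add: T_def triangle_group_eq mult_presented_group one_presented_group pres_class_eq_iff)
    then have "pres_class ?R [(x, False)] = inv\<^bsub>T\<^esub> pres_class ?R [(x, True)]"
      by (intro T.inv_equality[symmetric])
        (simp_all add: T_def triangle_group_eq carrier_presented_group)
    then show ?thesis
      using pos by (cases s) (auto intro: generate.incl generate.inv)
  qed
  have "pres_class ?R w \<in> generate T {a, b}" for w
  proof (induction w)
    case Nil
    show ?case using generate.one[of T "{a, b}"]
      by (simp add: T_def triangle_group_eq one_presented_group)
  next
    case (Cons l w)
    then have "pres_class ?R [l] \<otimes>\<^bsub>T\<^esub> pres_class ?R w \<in> generate T {a, b}"
      using letter[of "fst l" "snd l"] by (intro generate.eng) auto
    then show ?case by (simp add: T_def triangle_group_eq mult_presented_group)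
  qed
  then show "carrier T \<subseteq> generate T {a, b}"
    by (auto simp: T_def triangle_group_eq carrier_presented_group)
qed

lemma triangle_group_hom_exists:
  assumes "group H" "\<alpha> \<in> carrier H" "\<beta> \<in> carrier H"
    and "\<alpha> [^]\<^bsub>H\<^esub> q = \<one>\<^bsub>H\<^esub>" "\<beta> [^]\<^bsub>H\<^esub> q = \<one>\<^bsub>H\<^esub>" "(\<alpha> \<otimes>\<^bsub>H\<^esub> \<beta>) [^]\<^bsub>H\<^esub> r = \<one>\<^bsub>H\<^esub>"
  shows "\<exists>F\<in>hom (triangle_group q r) H. F (triangle_gen q r gen_a) = \<alpha> \<and> F (triangle_gen q r gen_b) = \<beta>"
proof -
  interpret H: group H by fact
  define f where "f x = (case x of gen_a \<Rightarrow> \<alpha> | gen_b \<Rightarrow> \<beta>)" for x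
  have f: "f x \<in> carrier H" for x using assms by (cases x) (simp_all add: f_def)
  have pow: "gword_eval H f (replicate n (x, True)) = f x [^]\<^bsub>H\<^esub> n" for n :: nat and x
  proof (induction n)
    case (Suc n)
    then show ?case using f[of x] H.nat_pow_Suc2[of "f x" n] by (simp add: gword_eval_def)
  qed (simp add: gword_eval_def)
  have pow2: "gword_eval H f (concat (replicate n [(gen_a, True), (gen_b, True)])) = (\<alpha> \<otimes>\<^bsub>H\<^esub> \<beta>) [^]\<^bsub>H\<^esub> n"
    for n :: nat
  proof (induction n)
    case (Suc n)
    then show ?case using assms H.nat_pow_Suc2[of "\<alpha> \<otimes>\<^bsub>H\<^esub> \<beta>" n]
      by (simp add: gword_eval_def f_def H.m_assoc)
  qed (simp add: gword_eval_def)
  have "gword_eval H f w = \<one>\<^bsub>H\<^esub>" if "w \<in> triangle_rels q r" for w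
    using that assms(4-6) unfolding triangle_rels_def by (auto simp: pow pow2) (simp_all add: f_def)
  from H.presented_group_universal[OF f this]
  obtain F where F: "F \<in> hom (presented_group (triangle_rels q r)) H"
      "\<And>w. F (pres_class (triangle_rels q r) w) = gword_eval H f w" by blast
  then show ?thesis
    using assms(2,3) unfolding triangle_group_eq triangle_gen_def
    by (intro bexI[of _ F]) (simp_all add: gword_eval_def f_def)
qed

lemma (in group_hom) hom_eq_on_generators:
  assumes "k \<in> hom G H" "S \<subseteq> carrier G" "generate G S = carrier G" "\<And>x. x \<in> S \<Longrightarrow> h x = k x"
    and "x \<in> carrier G"
  shows "h x = k x"
proof -
  interpret k: group_hom G H k using assms(1) by unfold_locales
  have "x \<in> generate G S" using assms by simp
  then show ?thesis
  proof (induction rule: generate.induct)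
    case (inv h)
    then show ?case using assms(2,4) by (metis hom_inv k.hom_inv subsetD)
  next
    case (eng h1 h2)
    then show ?case using assms(3) by simp
  qed (use assms in simp_all)
qed

text \<open>The inverses of a and b satisfy the third relator because
  \<open>inv a \<otimes> inv b\<close> is the inverse of ba, a conjugate of ab.\<close>

lemma triangle_inversion_exists:
  fixes q r :: nat
  defines "T \<equiv> triangle_group q r" and "a \<equiv> triangle_gen q r gen_a" and "b \<equiv> triangle_gen q r gen_b"
  shows "\<exists>\<theta>\<in>hom T T. \<theta> a = inv\<^bsub>T\<^esub> a \<and> \<theta> b = inv\<^bsub>T\<^esub> b \<and> (\<forall>x\<in>carrier T. \<theta> (\<theta> x) = x)"
proof -
  interpret T: group T unfolding T_def by (rule group_triangle_group)
  have ab: "a \<in> carrier T" "b \<in> carrier T" by (simp_all add: T_def a_def b_def)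
  note rel = triangle_relations[of q r, folded T_def a_def b_def]
  have "(b \<otimes>\<^bsub>T\<^esub> a) [^]\<^bsub>T\<^esub> n = inv\<^bsub>T\<^esub> a \<otimes>\<^bsub>T\<^esub> (a \<otimes>\<^bsub>T\<^esub> b) [^]\<^bsub>T\<^esub> n \<otimes>\<^bsub>T\<^esub> a" for n :: nat
    using ab by (induction n) (simp_all add: T.m_assoc)
  then have "(b \<otimes>\<^bsub>T\<^esub> a) [^]\<^bsub>T\<^esub> r = \<one>\<^bsub>T\<^esub>" using rel(3) ab by simp
  then have "(inv\<^bsub>T\<^esub> a \<otimes>\<^bsub>T\<^esub> inv\<^bsub>T\<^esub> b) [^]\<^bsub>T\<^esub> r = \<one>\<^bsub>T\<^esub>"
    using ab by (simp add: T.nat_pow_inv flip: T.inv_mult_group)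
  then have "\<exists>\<theta>\<in>hom T T. \<theta> a = inv\<^bsub>T\<^esub> a \<and> \<theta> b = inv\<^bsub>T\<^esub> b"
    using triangle_group_hom_exists[OF T.is_group, of "inv\<^bsub>T\<^esub> a" "inv\<^bsub>T\<^esub> b" q r, folded T_def a_def b_def] rel ab
    by (simp add: T.nat_pow_inv)
  then obtain \<theta> where \<theta>: "\<theta> \<in> hom T T" "\<theta> a = inv\<^bsub>T\<^esub> a" "\<theta> b = inv\<^bsub>T\<^esub> b" by blast
  interpret \<theta>: group_hom T T \<theta> using \<theta>(1) by unfold_locales
  have "group_hom T T (\<theta> \<circ> \<theta>)" by unfold_locales (simp add: hom_def)
  moreover have "(\<lambda>x. x) \<in> hom T T" by (simp add: hom_def)
  ultimately have "(\<theta> \<circ> \<theta>) x = x" if "x \<in> carrier T" for x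
  proof (rule group_hom.hom_eq_on_generators[OF _ _ _ _ _ that])
    show "generate T {a, b} = carrier T" unfolding T_def a_def b_def by (rule triangle_generate)
  qed (use ab \<theta> in auto)
  then have "\<forall>x\<in>carrier T. \<theta> (\<theta> x) = x" by simp
  then show ?thesis using \<theta> by blast
qed

text \<open>The target group is the semidirect product of W/V with Z/d. It is obtained as a quotient
  of the semidirect product of W with Z, so that computations use plain integers and elements of W;
  \<open>V_period\<close> says that d acts trivially on W/V.\<close>

locale int_action =
  fixes \<phi> :: "int \<Rightarrow> 'v::ab_group_add \<Rightarrow> 'v" and W V :: "'v set" and d :: int
  assumes action_add: "\<phi> n (v + w) = \<phi> n v + \<phi> n w"
    and action_0: "\<phi> 0 v = v"
    and action_plus: "\<phi> (m + n) v = \<phi> m (\<phi> n v)"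
    and W_0: "0 \<in> W" and W_add: "v \<in> W \<Longrightarrow> w \<in> W \<Longrightarrow> v + w \<in> W"
    and W_uminus: "v \<in> W \<Longrightarrow> - v \<in> W" and W_action: "v \<in> W \<Longrightarrow> \<phi> n v \<in> W"
    and V_0: "0 \<in> V" and V_add: "v \<in> V \<Longrightarrow> w \<in> V \<Longrightarrow> v + w \<in> V"
    and V_uminus: "v \<in> V \<Longrightarrow> - v \<in> V" and V_action: "v \<in> V \<Longrightarrow> \<phi> n v \<in> V"
    and V_subset: "V \<subseteq> W" and V_period: "v \<in> W \<Longrightarrow> \<phi> d v - v \<in> V"
begin

definition semidirect :: "(int \<times> 'v) monoid" where
  "semidirect = \<lparr>carrier = UNIV \<times> W, monoid.mult = (\<lambda>(n, v) (m, w). (n + m, v + \<phi> n w)), one = (0, 0)\<rparr>"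

definition period_subgroup :: "(int \<times> 'v) set" where
  "period_subgroup = {(n, v). d dvd n \<and> v \<in> V}"

lemma semidirect_simps [simp]:
  "(n, v) \<in> carrier semidirect \<longleftrightarrow> v \<in> W"
  "(n, v) \<otimes>\<^bsub>semidirect\<^esub> (m, w) = (n + m, v + \<phi> n w)"
  "\<one>\<^bsub>semidirect\<^esub> = (0, 0)"
  by (simp_all add: semidirect_def)

lemma action_zero [simp]: "\<phi> n 0 = 0"
  using action_add[of n 0 0] by simp

lemma action_uminus: "\<phi> n (- v) = - \<phi> n v"
  using action_add[of n v "- v"] by (simp add: eq_neg_iff_add_eq_0 add.commute)

lemma action_diff: "\<phi> n (v - w) = \<phi> n v - \<phi> n w"
  using action_add[of n v "- w"] by (simp add: action_uminus)

lemma action_cancel [simp]: "\<phi> (- n) (\<phi> n v) = v" "\<phi> n (\<phi> (- n) v) = v"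
  by (simp_all add: action_0 flip: action_plus)

lemma W_diff: "v \<in> W \<Longrightarrow> w \<in> W \<Longrightarrow> v - w \<in> W"
  using W_add[OF _ W_uminus, of v w] by simp

lemma V_diff: "v \<in> V \<Longrightarrow> w \<in> V \<Longrightarrow> v - w \<in> V"
  using V_add[OF _ V_uminus, of v w] by simp

sublocale semidirect: group semidirect
proof (rule groupI)
  fix x assume "x \<in> carrier semidirect"
  then obtain n v where x: "x = (n, v)" "v \<in> W" by (cases x) simp
  then show "\<exists>y\<in>carrier semidirect. y \<otimes>\<^bsub>semidirect\<^esub> x = \<one>\<^bsub>semidirect\<^esub>"
    by (intro bexI[of _ "(- n, - \<phi> (- n) v)"]) (simp_all add: W_uminus W_action)
qed (auto simp: action_add action_0 action_plus W_0 W_add W_action add.assoc semidirect_def)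

lemma inv_semidirect: "v \<in> W \<Longrightarrow> inv\<^bsub>semidirect\<^esub> (n, v) = (- n, - \<phi> (- n) v)"
  by (rule semidirect.inv_equality) (simp_all add: W_uminus W_action)

lemma pow_semidirect: "v \<in> W \<Longrightarrow> (n, v) [^]\<^bsub>semidirect\<^esub> (j::nat) = (n * int j, \<Sum>l<j. \<phi> (n * int l) v)"
  by (induction j) (simp_all add: algebra_simps)

lemma conj_semidirect:
  "v \<in> W \<Longrightarrow> w \<in> W \<Longrightarrow> (m, w) \<otimes>\<^bsub>semidirect\<^esub> (n, v) \<otimes>\<^bsub>semidirect\<^esub> inv\<^bsub>semidirect\<^esub> (m, w) = (n, w + \<phi> m v - \<phi> n w)"
  by (simp add: inv_semidirect action_uminus flip: action_plus)

lemma grp_comm_semidirect: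
  "v \<in> W \<Longrightarrow> w \<in> W \<Longrightarrow> grp_comm semidirect (n, v) (m, w) = (0, (v - \<phi> m v) + (\<phi> n w - w))"
  by (simp add: grp_comm_def inv_semidirect action_uminus action_0 flip: action_plus)

lemma V_period_mult:
  assumes "v \<in> W" "d dvd n"
  shows "\<phi> n v - v \<in> V"
proof -
  have nat: "\<phi> (d * int k) v - v \<in> V" for k
  proof (induction k)
    case 0
    then show ?case by (simp add: action_0 V_0)
  next
    case (Suc k)
    have "(\<phi> d (\<phi> (d * int k) v) - \<phi> (d * int k) v) + (\<phi> (d * int k) v - v) \<in> V"
      using assms Suc by (intro V_add V_period W_action)
    then show ?case by (simp add: algebra_simps action_plus)
  qed
  obtain z where n: "n = d * z" using assms(2) by (elim dvdE)
  show ?thesis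
  proof (cases "z \<ge> 0")
    case True
    then show ?thesis using nat[of "nat z"] n by simp
  next
    case False
    then have "- \<phi> n (\<phi> (- n) v - v) \<in> V"
      using nat[of "nat (- z)"] n by (intro V_uminus V_action) simp
    then show ?thesis by (simp add: action_diff)
  qed
qed

lemma period_subgroup_normal: "period_subgroup \<lhd> semidirect"
  unfolding semidirect.normal_inv_iff
proof (intro conjI ballI)
  show "subgroup period_subgroup semidirect"
    by (rule semidirect.subgroupI)
      (use V_subset V_0 in \<open>auto simp: period_subgroup_def inv_semidirect V_add V_action V_uminus subset_iff\<close>)
next
  fix x h assume x: "x \<in> carrier semidirect" and h: "h \<in> period_subgroup"
  obtain m w where x': "x = (m, w)" "w \<in> W" using x by (cases x) simp
  obtain n v where h': "h = (n, v)" "d dvd n" "v \<in> V" using h by (auto simp: period_subgroup_def)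
  have "\<phi> m v - (\<phi> n w - w) \<in> V"
    using x' h' by (intro V_diff V_action V_period_mult)
  then show "x \<otimes>\<^bsub>semidirect\<^esub> h \<otimes>\<^bsub>semidirect\<^esub> inv\<^bsub>semidirect\<^esub> x \<in> period_subgroup"
    using x' h' V_subset conj_semidirect[of v w m n]
    by (auto simp: period_subgroup_def algebra_simps simp del: semidirect_simps(2))
qed

text \<open>The quotient of the two elements has second coordinate
  \<open>v - \<phi> (n - m) w\<close>, which agrees with \<open>v - w\<close> modulo V once d
  divides n - m.\<close>

lemma coset_eq_iff:
  assumes "v \<in> W" "w \<in> W"
  shows "period_subgroup #>\<^bsub>semidirect\<^esub> (n, v) = period_subgroup #>\<^bsub>semidirect\<^esub> (m, w) \<longleftrightarrow>
    d dvd n - m \<and> v - w \<in> V"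
proof -
  have "v - w \<in> V \<longleftrightarrow> v - \<phi> (n - m) w \<in> V" if "d dvd n - m"
    using V_period_mult[OF assms(2) that] V_add[of "v - \<phi> (n - m) w" "\<phi> (n - m) w - w"]
      V_diff[of "v - w" "\<phi> (n - m) w - w"] by (auto simp: algebra_simps)
  then show ?thesis
    using assms period_subgroup_normal
    by (auto simp: semidirect.r_coset_eq_iff normal_imp_subgroup inv_semidirect period_subgroup_def
        action_uminus action_plus[symmetric])
qed

definition quotient :: "(int \<times> 'v) set monoid" where
  "quotient = semidirect Mod period_subgroup"

definition coset :: "int \<Rightarrow> 'v \<Rightarrow> (int \<times> 'v) set" where
  "coset n v = period_subgroup #>\<^bsub>semidirect\<^esub> (n, v)"

lemma coset_hom: "group_hom semidirect quotient (\<lambda>(n, v). coset n v)"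
  using semidirect.group_hom_r_coset[OF period_subgroup_normal]
  by (simp add: quotient_def coset_def case_prod_beta)

sublocale coset: group_hom semidirect quotient "\<lambda>(n, v). coset n v"
  by (rule coset_hom)

lemma coset_closed [simp]: "v \<in> W \<Longrightarrow> coset n v \<in> carrier quotient"
  using coset.hom_closed[of "(n, v)"] by simp

lemma coset_eq: "v \<in> W \<Longrightarrow> w \<in> W \<Longrightarrow> coset n v = coset m w \<longleftrightarrow> d dvd n - m \<and> v - w \<in> V"
  by (simp add: coset_def coset_eq_iff)

lemma coset_cases:
  assumes "C \<in> carrier quotient"
  obtains n v where "v \<in> W" "C = coset n v"
  using assms by (auto simp: quotient_def carrier_FactGroup coset_def)

lemma one_quotient: "\<one>\<^bsub>quotient\<^esub> = coset 0 0"
  using coset.hom_one by simp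

lemma coset_mult: "v \<in> W \<Longrightarrow> w \<in> W \<Longrightarrow> coset n v \<otimes>\<^bsub>quotient\<^esub> coset m w = coset (n + m) (v + \<phi> n w)"
  using coset.hom_mult[of "(n, v)" "(m, w)"] by simp

lemma coset_inv: "v \<in> W \<Longrightarrow> inv\<^bsub>quotient\<^esub> (coset n v) = coset (- n) (- \<phi> (- n) v)"
  using coset.hom_inv[of "(n, v)"] by (simp add: inv_semidirect)

lemma coset_pow:
  "v \<in> W \<Longrightarrow> coset n v [^]\<^bsub>quotient\<^esub> (j::nat) = coset (n * int j) (\<Sum>l<j. \<phi> (n * int l) v)"
  using coset.hom_nat_pow[of "(n, v)" j] by (simp add: pow_semidirect)

lemma coset_grp_comm:
  "v \<in> W \<Longrightarrow> w \<in> W \<Longrightarrow>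
    grp_comm quotient (coset n v) (coset m w) = coset 0 ((v - \<phi> m v) + (\<phi> n w - w))"
  using coset.hom_grp_comm[of "(n, v)" "(m, w)"] by (simp add: grp_comm_semidirect)

text \<open>Commutators have first coordinate 0, and bracketing a translation with an element of
  first coordinate m applies \<phi> m - 1 up to sign. A filtration Z that these operators push down
  one level therefore bounds the images of the lower central terms.\<close>

lemma lower_central_image:
  assumes F: "F \<in> hom T quotient" "group T"
    and Z: "\<And>n. n \<ge> 2 \<Longrightarrow> Z n \<subseteq> W" "\<And>n. n \<ge> 2 \<Longrightarrow> 0 \<in> Z n"
      "\<And>n v w. n \<ge> 2 \<Longrightarrow> v \<in> Z n \<Longrightarrow> w \<in> Z n \<Longrightarrow> v + w \<in> Z n" "\<And>n v. n \<ge> 2 \<Longrightarrow> v \<in> Z n \<Longrightarrow> - v \<in> Z n"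
      "\<And>v m. v \<in> W \<Longrightarrow> \<phi> m v - v \<in> Z 2"
      "\<And>n v m. n \<ge> 2 \<Longrightarrow> v \<in> Z n \<Longrightarrow> \<phi> m v - v \<in> Z (Suc n)"
    and "n \<ge> 2" "x \<in> lower_central T n"
  shows "\<exists>v\<in>Z n. F x = coset 0 v"
proof -
  interpret F: group_hom T quotient F
    using F by (simp add: group_hom_def group_hom_axioms_def coset.H.is_group)
  define P where "P n = {x \<in> carrier T. \<exists>v\<in>Z n. F x = coset 0 v}" for n
  have P: "subgroup (P n) T" if "n \<ge> 2" for n
  proof (rule F.G.subgroupI)
    show "P n \<noteq> {}"
      using Z(2)[OF that] F.G.one_closed by (auto simp: P_def one_quotient intro!: exI[of _ "\<one>\<^bsub>T\<^esub>"])
  next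
    fix x assume "x \<in> P n"
    then obtain v where "x \<in> carrier T" "v \<in> Z n" "F x = coset 0 v" by (auto simp: P_def)
    then show "inv\<^bsub>T\<^esub> x \<in> P n"
      using Z(1,4)[OF that] by (auto simp: P_def coset_inv action_0 subset_iff)
  next
    fix x y assume "x \<in> P n" "y \<in> P n"
    then obtain v w where "x \<in> carrier T" "v \<in> Z n" "F x = coset 0 v"
      "y \<in> carrier T" "w \<in> Z n" "F y = coset 0 w" by (auto simp: P_def)
    then show "x \<otimes>\<^bsub>T\<^esub> y \<in> P n"
      using Z(1)[OF that] Z(3)[OF that] by (auto simp: P_def coset_mult action_0 subset_iff)
  qed (auto simp: P_def)
  have "lower_central T n \<subseteq> P n" using \<open>n \<ge> 2\<close>
  proof (induction n rule: nat_induct_at_least)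
    case base
    have "grp_comm T x y \<in> P 2" if xy: "x \<in> carrier T" "y \<in> carrier T" for x y
    proof -
      obtain n v where x: "v \<in> W" "F x = coset n v" using xy F.hom_closed coset_cases by metis
      obtain m w where y: "w \<in> W" "F y = coset m w" using xy F.hom_closed coset_cases by metis
      have "(- (\<phi> m v - v)) + (\<phi> n w - w) \<in> Z 2"
        using x y by (intro Z(3,4,5)) simp_all
      then show ?thesis using x y xy by (auto simp: P_def F.hom_grp_comm coset_grp_comm)
    qed
    then have "commutator_subgroup T (carrier T) (carrier T) \<subseteq> P 2"
      unfolding commutator_subgroup_eq using P[of 2] by (intro F.G.generate_subgroup_incl) auto
    moreover have "lower_central T 2 = commutator_subgroup T (carrier T) (carrier T)"
      using lower_central_Suc[of 1 T] by (simp add: numeral_2_eq_2)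
    ultimately show ?case by simp
  next
    case (Suc n)
    have "grp_comm T x y \<in> P (Suc n)" if xy: "x \<in> lower_central T n" "y \<in> carrier T" for x y
    proof -
      obtain v where x: "x \<in> carrier T" "v \<in> Z n" "v \<in> W" "F x = coset 0 v"
        using xy(1) subsetD[OF Suc.IH] subsetD[OF Z(1)[OF Suc.hyps]] unfolding P_def by blast
      obtain m w where y: "w \<in> W" "F y = coset m w" using xy F.hom_closed coset_cases by metis
      have "- (\<phi> m v - v) \<in> Z (Suc n)"
        using x y Suc.hyps by (intro Z(4,6)) simp_all
      then show ?thesis using x y xy by (auto simp: P_def F.hom_grp_comm coset_grp_comm action_0)
    qed
    then have "{grp_comm T h k |h k. h \<in> lower_central T n \<and> k \<in> carrier T} \<subseteq> P (Suc n)" by blast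
    then show ?case
      using lower_central_Suc[of n T] F.G.generate_subgroup_incl[OF _ P[of "Suc n"]] Suc.hyps
      by (simp add: commutator_subgroup_eq)
  qed
  then show ?thesis using assms(10) by (auto simp: P_def)
qed

lemma triangle_hom_exists:
  assumes "v \<in> W" "w \<in> W"
    and "d dvd n * int q" "(\<Sum>l<q. \<phi> (n * int l) v) \<in> V"
    and "d dvd m * int q" "(\<Sum>l<q. \<phi> (m * int l) w) \<in> V"
    and "d dvd (n + m) * int r" "(\<Sum>l<r. \<phi> ((n + m) * int l) (v + \<phi> n w)) \<in> V"
  shows "\<exists>F\<in>hom (triangle_group q r) quotient.
    F (triangle_gen q r gen_a) = coset n v \<and> F (triangle_gen q r gen_b) = coset m w"
  using assms V_subset
  by (intro triangle_group_hom_exists coset.H.is_group)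
    (auto simp: coset_mult coset_pow one_quotient coset_eq W_0 W_add W_action subset_iff)

end

section \<open>The lower central series of the triangle group does not terminate\<close>

definition shift :: "int \<Rightarrow> (int \<Rightarrow> int) \<Rightarrow> int \<Rightarrow> int" where
  "shift n f = (\<lambda>j. f (j + n))"

definition fdiff :: "(int \<Rightarrow> int) \<Rightarrow> int \<Rightarrow> int" where
  "fdiff f = (\<lambda>j. f (j + 1) - f j)"

text \<open>With \<open>S\<close> the shift, the two sums are the operators \<open>1 + S + \<dots> + S\<^bsup>e-1\<^esup>\<close> and
  \<open>1 + S\<^bsup>2\<^esup> + \<dots> + S\<^bsup>2(e-1)\<^esup>\<close>, which the relators for \<open>b\<close> and \<open>ab\<close> force to vanish. For \<open>e\<close> an
  odd prime the module is a copy of the ring of integers of the \<open>e\<close>-th cyclotomic field, for \<open>e = 4\<close> of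
  the Gaussian integers.\<close>

definition cyclo_fun :: "nat \<Rightarrow> (int \<Rightarrow> int) set" where
  "cyclo_fun e = {f. (\<forall>j. f (j + int e) = f j) \<and> (\<forall>j. (\<Sum>l<e. f (j + int l)) = 0) \<and>
     (\<forall>j. (\<Sum>l<e. f (j + 2 * int l)) = 0)}"

lemma sum_fun_apply: "(\<Sum>i\<in>A. f i :: 'b \<Rightarrow> 'c::comm_monoid_add) x = (\<Sum>i\<in>A. f i x)"
  by (induction A rule: infinite_finite_induct) auto

lemma int_action_cyclo_fun: "int_action shift (cyclo_fun e) {0} (int e)"
proof
  fix v n assume v: "v \<in> cyclo_fun e"
  then have "v (j + n + int e) = v (j + n)" "(\<Sum>l<e. v (j + n + int l)) = 0"
    "(\<Sum>l<e. v (j + n + 2 * int l)) = 0" for j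
    unfolding cyclo_fun_def by blast+
  then show "shift n v \<in> cyclo_fun e" by (simp add: cyclo_fun_def shift_def ac_simps)
  show "shift (int e) v - v \<in> {0}" using v by (simp add: fun_eq_iff shift_def cyclo_fun_def)
next
  fix v w assume "v \<in> cyclo_fun e" "w \<in> cyclo_fun e"
  then show "v + w \<in> cyclo_fun e" by (simp add: cyclo_fun_def sum.distrib)
next
  fix v assume "v \<in> cyclo_fun e"
  then show "- v \<in> cyclo_fun e" by (simp add: cyclo_fun_def sum_negf)
next
  show "0 \<in> cyclo_fun e" "{0} \<subseteq> cyclo_fun e" by (simp_all add: cyclo_fun_def)
qed (simp_all add: shift_def fun_eq_iff ac_simps)

lemma fdiff_add: "fdiff (f + g) = fdiff f + fdiff g"
  and fdiff_uminus: "fdiff (- f) = - fdiff f"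
  and fdiff_minus: "fdiff (f - g) = fdiff f - fdiff g"
  and fdiff_shift: "fdiff (shift n f) = shift n (fdiff f)"
  and fdiff_0: "fdiff 0 = 0"
  by (simp_all add: fdiff_def shift_def fun_eq_iff algebra_simps)

lemma fdiff_eq_shift: "fdiff f = shift 1 f - f"
  by (simp add: fdiff_def shift_def fun_eq_iff)

lemma funpow_fdiff_add: "(fdiff ^^ n) (f + g) = (fdiff ^^ n) f + (fdiff ^^ n) g"
  and funpow_fdiff_uminus: "(fdiff ^^ n) (- f) = - (fdiff ^^ n) f"
  and funpow_fdiff_minus: "(fdiff ^^ n) (f - g) = (fdiff ^^ n) f - (fdiff ^^ n) g"
  and funpow_fdiff_shift: "(fdiff ^^ n) (shift m f) = shift m ((fdiff ^^ n) f)"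
  and funpow_fdiff_0: "(fdiff ^^ n) 0 = 0"
  by (induction n) (simp_all only: funpow.simps comp_def id_apply fdiff_add fdiff_uminus fdiff_minus fdiff_shift fdiff_0)

text \<open>The binomial theorem for the shift, written as 1 + \<open>fdiff\<close>.\<close>

lemma newton_forward: "f (j + int n) = (\<Sum>i\<le>n. int (n choose i) * (fdiff ^^ i) f j)"
proof (induction n arbitrary: j)
  case (Suc n)
  have "f (j + int (Suc n)) = f ((j + 1) + int n)" by (simp add: algebra_simps)
  also have "\<dots> = (\<Sum>i\<le>n. int (n choose i) * (fdiff ^^ i) f (j + 1))" by (rule Suc.IH)
  also have "\<dots> = (\<Sum>i\<le>n. int (n choose i) * (fdiff ^^ i) f j) + (\<Sum>i\<le>n. int (n choose i) * (fdiff ^^ Suc i) f j)"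
    by (simp add: fdiff_def algebra_simps flip: sum.distrib)
  also have "(\<Sum>i\<le>n. int (n choose i) * (fdiff ^^ i) f j) = f j + (\<Sum>i\<le>n. int (n choose Suc i) * (fdiff ^^ Suc i) f j)"
    using sum.atMost_Suc_shift[of "\<lambda>i. int (n choose i) * (fdiff ^^ i) f j" n] by (simp add: binomial_eq_0)
  also have "\<dots> + (\<Sum>i\<le>n. int (n choose i) * (fdiff ^^ Suc i) f j) =
      (\<Sum>i\<le>Suc n. int (Suc n choose i) * (fdiff ^^ i) f j)"
    unfolding sum.atMost_Suc_shift by (simp add: algebra_simps sum.distrib del: funpow.simps)
  finally show ?case .
qed simp

text \<open>The e-th power of 1 + \<open>fdiff\<close> is the identity on e-periodic functions;
  apart from the extreme terms its expansion has coefficients divisible by p.\<close>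

lemma dvd_fdiff_period:
  assumes "\<And>i. 0 < i \<Longrightarrow> i < e \<Longrightarrow> p dvd e choose i" "e > 0" "f \<in> cyclo_fun e"
  shows "int p dvd (fdiff ^^ e) f j"
proof -
  have "{..e} = insert 0 (insert e {0<..<e})" using assms(2) by auto
  then have "f (j + int e) = f j + (fdiff ^^ e) f j + (\<Sum>i\<in>{0<..<e}. int (e choose i) * (fdiff ^^ i) f j)"
    unfolding newton_forward using assms(2) by (simp add: sum.insert)
  moreover have "f (j + int e) = f j" using assms(3) by (simp add: cyclo_fun_def)
  ultimately have "(fdiff ^^ e) f j = - (\<Sum>i\<in>{0<..<e}. int (e choose i) * (fdiff ^^ i) f j)"
    by linarith
  moreover have "int p dvd (\<Sum>i\<in>{0<..<e}. int (e choose i) * (fdiff ^^ i) f j)"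
    using assms(1) by (intro dvd_sum dvd_mult2) simp
  ultimately show ?thesis by simp
qed

lemma funpow_fdiff_scale: "(fdiff ^^ n) (\<lambda>j. c * f j) = (\<lambda>j. c * (fdiff ^^ n) f j)"
  by (induction n) (simp_all add: fdiff_def fun_eq_iff algebra_simps)

text \<open>Every e differences release a factor p. The quotient by p stays in the module, so the
  argument repeats; this is the ramification of p at 1 - \<zeta>.\<close>

lemma dvd_fdiff_power:
  assumes "\<And>i. 0 < i \<Longrightarrow> i < e \<Longrightarrow> p dvd e choose i" "e > 0" "p > 0" "f \<in> cyclo_fun e"
  shows "int (p ^ t) dvd (fdiff ^^ (e * t)) f j"
  using assms(4)
proof (induction t arbitrary: f j)
  case (Suc t)
  define g where "g = (\<lambda>j. (fdiff ^^ e) f j div int p)"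
  have g: "(fdiff ^^ e) f = (\<lambda>j. int p * g j)"
    using dvd_fdiff_period[OF assms(1,2) Suc.prems] by (simp add: g_def)
  interpret int_action shift "cyclo_fun e" "{0}" "int e" by (rule int_action_cyclo_fun)
  have "fdiff h \<in> cyclo_fun e" if "h \<in> cyclo_fun e" for h
    using that by (simp add: fdiff_eq_shift W_diff W_action)
  then have "(fdiff ^^ n) f \<in> cyclo_fun e" for n
    using Suc.prems by (induction n) simp_all
  from this[of e] have "(\<lambda>j. int p * g j) \<in> cyclo_fun e" unfolding g .
  \<comment> \<open>The defining conditions are homogeneous linear equations over the integers, so
    the factor p cancels.\<close>
  then have "g \<in> cyclo_fun e"
    using assms(3) by (simp add: cyclo_fun_def flip: sum_distrib_left)
  from Suc.IH[OF this] have "int p * int (p ^ t) dvd int p * (fdiff ^^ (e * t)) g j" for j by simp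
  then show ?case
    using g by (simp add: funpow_add funpow_fdiff_scale add.commute[of e])
qed simp

text \<open>Such a function is constant, and e times the constant is one of the vanishing
  sums.\<close>

lemma fdiff_eq_0_imp:
  assumes "f \<in> cyclo_fun e" "e > 0" "fdiff f = 0"
  shows "f = 0"
proof
  fix j
  have "f (i + 1) = f i" for i using fun_cong[OF assms(3), of i] by (simp add: fdiff_def)
  then have "f (j + int l) = f j" for l
    by (induction l) (simp_all, metis add.assoc add.commute)
  then have "(\<Sum>l<e. f (j + int l)) = int e * f j" by simp
  then show "f j = 0 j" using assms(1,2) by (simp add: cyclo_fun_def)
qed

lemma cyclo_fun_sum_multiple:
  assumes "f \<in> cyclo_fun e" "e dvd n"
  shows "(\<Sum>l<n. f (j + int l)) = 0" "(\<Sum>l<n. f (j + 2 * int l)) = 0"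
proof -
  obtain c where n: "n = e * c" using assms(2) by (elim dvdE)
  have "(\<Sum>l<e * c. f (j + s * int l)) = 0" if "s = 1 \<or> s = 2" for s
  proof (induction c)
    case (Suc c)
    have split: "(\<Sum>l<m + n. g l) = (\<Sum>l<m. g l) + (\<Sum>l<n. g (m + l))" for g :: "nat \<Rightarrow> int" and m n
      by (induction n) simp_all
    have "(\<Sum>l<e * Suc c. f (j + s * int l)) =
        (\<Sum>l<e * c. f (j + s * int l)) + (\<Sum>l<e. f ((j + s * int (e * c)) + s * int l))"
      using split[of "\<lambda>l. f (j + s * int l)" "e * c" e] by (simp add: algebra_simps)
    then show ?case using Suc assms(1) that by (auto simp: cyclo_fun_def)
  qed simp
  from this[of 1] this[of 2] show "(\<Sum>l<n. f (j + int l)) = 0" "(\<Sum>l<n. f (j + 2 * int l)) = 0"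
    by (simp_all add: n)
qed

text \<open>For the indicator \<delta> of the multiples of e both sums equal 1, as the steps 1 and 2
  are invertible modulo an odd e. The difference of \<delta> and its shift makes them
  vanish.\<close>

lemma cyclo_fun_odd_nonzero:
  assumes "odd e" "e > 2"
  shows "\<exists>f\<in>cyclo_fun e. f \<noteq> 0"
proof -
  define \<delta> where "\<delta> j = (if int e dvd j then 1 else 0 :: int)" for j
  have sum: "(\<Sum>l<e. \<delta> (j + s * int l)) = 1" if s': "int e dvd s * s' - 1" for s s' j
  proof -
    define l0 where "l0 = nat ((- j * s') mod int e)"
    have l0: "l0 < e" "int l0 = (- j * s') mod int e" using assms(2) by (simp_all add: l0_def nat_less_iff)
    have "int e dvd j + s * int l \<longleftrightarrow> l = l0" if "l < e" for l
    proof -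
      have "int e dvd j + s * int l \<longleftrightarrow> int e dvd int l + j * s'"
      proof
        assume "int e dvd j + s * int l"
        then have "int e dvd s' * (j + s * int l) - (s * s' - 1) * int l"
          using s' by (intro dvd_diff) simp_all
        then show "int e dvd int l + j * s'" by (simp add: algebra_simps)
      next
        assume "int e dvd int l + j * s'"
        then have "int e dvd s * (int l + j * s') - (s * s' - 1) * j"
          using s' by (intro dvd_diff) simp_all
        then show "int e dvd j + s * int l" by (simp add: algebra_simps)
      qed
      also have "\<dots> \<longleftrightarrow> int l mod int e = (- j * s') mod int e" by (simp add: mod_eq_dvd_iff)
      also have "\<dots> \<longleftrightarrow> l = l0" using that l0 by auto
      finally show ?thesis .
    qed
    then have "(\<Sum>l<e. \<delta> (j + s * int l)) = (\<Sum>l<e. if l = l0 then 1 else 0)"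
      by (intro sum.cong) (auto simp: \<delta>_def)
    then show ?thesis using l0(1) by simp
  qed
  obtain h where h: "e = 2 * h + 1" using assms(1) by (elim oddE)
  have s1: "(\<Sum>l<e. \<delta> (j + int l)) = 1" for j using sum[of 1 1 j] by simp
  \<comment> \<open>Since 2(h + 1) = e + 1, the inverse of 2 modulo e is h + 1.\<close>
  have s2: "(\<Sum>l<e. \<delta> (j + 2 * int l)) = 1" for j
    using sum[of 2 "int h + 1" j] h by simp
  define f where "f j = \<delta> j - \<delta> (j + 1)" for j
  have s3: "(\<Sum>l<e. \<delta> (j + int l + 1)) = 1" "(\<Sum>l<e. \<delta> (j + 2 * int l + 1)) = 1" for j
    using s1[of "j + 1"] s2[of "j + 1"] by (simp_all add: algebra_simps)
  have per: "\<delta> (j + int e) = \<delta> j" "\<delta> (j + int e + 1) = \<delta> (j + 1)" for j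
    using dvd_add_left_iff[of "int e" "int e" "j + 1"] by (auto simp: \<delta>_def algebra_simps)
  have "f \<in> cyclo_fun e"
    by (simp add: cyclo_fun_def f_def sum_subtractf s1 s2 s3 per)
  moreover have "f 0 = 1" using assms(2) by (simp add: f_def \<delta>_def)
  ultimately show ?thesis by (metis zero_fun_apply zero_neq_one)
qed

text \<open>The pattern 1, 1, -1, -1 satisfies f(j + 2) = -f(j), the relation \<zeta>^2 = -1, which
  kills both sums.\<close>

lemma cyclo_fun_4_nonzero: "\<exists>f\<in>cyclo_fun 4. f \<noteq> 0"
proof -
  define f where "f j = (if j mod 4 = 0 \<or> j mod 4 = 1 then 1 else - 1 :: int)" for j :: int
  have anti: "f (j + 2) = - f j" for j unfolding f_def by (simp split: if_splits) presburger
  have "f (j + 4) = f j" "f (j + 3) = - f (j + 1)" "f (j + 6) = f (j + 2)" for j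
    using anti[of j] anti[of "j + 2"] anti[of "j + 1"] anti[of "j + 4"] by (simp_all add: add.commute[of j])
  moreover have "(\<Sum>l<4::nat. g l) = g 0 + g 1 + g 2 + g 3" for g :: "nat \<Rightarrow> int"
    by (simp add: eval_nat_numeral)
  ultimately have "f \<in> cyclo_fun 4" by (simp add: cyclo_fun_def anti)
  moreover have "f 0 = 1" by (simp add: f_def)
  ultimately show ?thesis by (metis zero_fun_apply zero_neq_one)
qed

text \<open>If two consecutive terms agree, the series is constant from there on. The nth difference
  of v, which occurs in the image of the term of index n + 1, is then an N-th difference for all N
  >= n, hence divisible by every power of p and so zero. As \<open>fdiff\<close> is injective on the
  module, v = 0.\<close>

lemma lower_central_strict_aux:
  assumes binom: "\<And>i. 0 < i \<Longrightarrow> i < e \<Longrightarrow> p dvd e choose i" and e: "e > 0" and p: "p > 1"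
    and v: "v \<in> cyclo_fun e" "v \<noteq> 0" and dvd: "e dvd q" "e dvd r" and "n \<ge> 1"
  shows "lower_central (triangle_group q r) n \<noteq> lower_central (triangle_group q r) (Suc n)"
proof
  let ?T = "triangle_group q r"
  interpret T: group ?T by (rule group_triangle_group)
  interpret int_action shift "cyclo_fun e" "{0}" "int e" by (rule int_action_cyclo_fun)
  assume eq: "lower_central ?T n = lower_central ?T (Suc n)"
  have stable: "lower_central ?T N = lower_central ?T n" if "N \<ge> n" for N
    using that
  proof (induction N rule: nat_induct_at_least)
    case (Suc N)
    have "lower_central ?T (Suc N) = commutator_subgroup ?T (lower_central ?T N) (carrier ?T)"
      using Suc.hyps \<open>n \<ge> 1\<close> by (intro lower_central_Suc) simp
    also have "\<dots> = lower_central ?T (Suc n)"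
      unfolding Suc.IH using \<open>n \<ge> 1\<close> by (intro lower_central_Suc[symmetric])
    finally show ?case unfolding eq[symmetric] .
  qed simp
  \<comment> \<open>With a sent to (1, 0) and b to (1, v), the product ab shifts by 2. Its relator
    calls for the sums with step 2 in \<open>cyclo_fun\<close>, that of b for those with step
    1.\<close>
  have "(\<Sum>l<q. shift (1 * int l) v) = 0"
    using cyclo_fun_sum_multiple(1)[OF v(1) dvd(1)] by (simp add: fun_eq_iff sum_fun_apply shift_def)
  moreover have "(\<Sum>l<r. shift ((1 + 1) * int l) (0 + shift 1 v)) = 0"
  proof
    fix j
    show "(\<Sum>l<r. shift ((1 + 1) * int l) (0 + shift 1 v)) j = 0 j"
      using cyclo_fun_sum_multiple(2)[OF v(1) dvd(2), of "j + 1"]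
      by (simp add: sum_fun_apply shift_def ac_simps)
  qed
  ultimately obtain F where F: "F \<in> hom ?T quotient"
      "F (triangle_gen q r gen_a) = coset 1 0" "F (triangle_gen q r gen_b) = coset 1 v"
    using triangle_hom_exists[where v = 0 and w = v and n = 1 and m = 1 and q = q and r = r] v(1) dvd W_0
    by auto
  interpret F: group_hom ?T quotient F
    using F(1) by (simp add: group_hom_def group_hom_axioms_def coset.H.is_group T.is_group)
  have diffW: "fdiff h \<in> cyclo_fun e" if "h \<in> cyclo_fun e" for h
    using that by (simp add: fdiff_eq_shift W_diff W_action)
  then have powW: "(fdiff ^^ k) h \<in> cyclo_fun e" if "h \<in> cyclo_fun e" for h k
    using that by (induction k) simp_all
  define Z where "Z n = (fdiff ^^ (n - 1)) ` cyclo_fun e" for n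
  have Z2: "shift m h - h \<in> fdiff ` cyclo_fun e" if h: "h \<in> cyclo_fun e" for h m
  proof -
    have nat: "\<exists>g\<in>cyclo_fun e. shift (int k) h - h = fdiff g" for k
    proof (induction k)
      case 0
      then show ?case using fdiff_0 W_0 by (metis action_0 diff_self of_nat_0)
    next
      case (Suc k)
      then obtain g where g: "g \<in> cyclo_fun e" "shift (int k) h - h = fdiff g" by blast
      have "shift (int (Suc k)) h - h = fdiff (shift (int k) h + g)"
        unfolding fdiff_add g(2)[symmetric] by (simp add: fdiff_eq_shift add.commute flip: action_plus)
      then show ?case using g(1) h W_add W_action by blast
    qed
    show ?thesis
    proof (cases "m \<ge> 0")
      case True
      then show ?thesis using nat[of "nat m"] by auto
    next
      case False
      then obtain g where g: "g \<in> cyclo_fun e" "shift (- m) h - h = fdiff g"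
        using nat[of "nat (- m)"] by auto
      have "shift m h - h = - shift m (shift (- m) h - h)" by (simp add: action_diff)
      also have "\<dots> = fdiff (- shift m g)" by (simp add: g(2) fdiff_uminus fdiff_shift)
      finally show ?thesis using g(1) W_uminus W_action by blast
    qed
  qed
  have image: "\<exists>u\<in>Z N. F x = coset 0 u" if "N \<ge> 2" "x \<in> lower_central ?T N" for N x
  proof (rule lower_central_image[OF F(1) T.is_group _ _ _ _ _ _ that])
    show "Z k \<subseteq> cyclo_fun e" for k using powW by (auto simp: Z_def)
    show "0 \<in> Z k" for k unfolding Z_def using funpow_fdiff_0 W_0 by (metis imageI)
    show "u + w \<in> Z k" if "u \<in> Z k" "w \<in> Z k" for k u w
      using that W_add by (auto simp: Z_def simp flip: funpow_fdiff_add)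
    show "- u \<in> Z k" if "u \<in> Z k" for k u
      using that W_uminus by (auto simp: Z_def simp flip: funpow_fdiff_uminus)
    show "shift m u - u \<in> Z 2" if "u \<in> cyclo_fun e" for u m
      using Z2[OF that] by (simp add: Z_def)
    show "shift m u - u \<in> Z (Suc k)" if k: "k \<ge> 2" and "u \<in> Z k" for k u m
    proof -
      obtain h where h: "h \<in> cyclo_fun e" "u = (fdiff ^^ (k - 1)) h" using \<open>u \<in> Z k\<close> by (auto simp: Z_def)
      obtain g where g: "g \<in> cyclo_fun e" "shift m h - h = fdiff g" using Z2[OF h(1)] by blast
      have "shift m u - u = (fdiff ^^ (k - 1)) (fdiff g)"
        by (simp add: h(2) funpow_fdiff_shift funpow_fdiff_minus flip: g(2))
      also have "\<dots> = (fdiff ^^ (Suc k - 1)) g"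
        using k by (metis Suc_diff_1 comp_apply diff_Suc_1 funpow_Suc_right less_le_trans zero_less_numeral)
      finally show ?thesis using g(1) by (auto simp: Z_def)
    qed
  qed
  have nontriv: "\<exists>x\<in>lower_central ?T (Suc (Suc k)). F x = coset 0 ((fdiff ^^ Suc k) v)" for k
  proof (induction k)
    case 0
    let ?x = "grp_comm ?T (triangle_gen q r gen_a) (triangle_gen q r gen_b)"
    have "?x \<in> lower_central ?T (Suc 1)" by (rule T.grp_comm_lower_central) simp_all
    moreover have "F ?x = coset 0 (fdiff v)"
      using F v(1) by (simp add: F.hom_grp_comm coset_grp_comm W_0 fdiff_eq_shift)
    ultimately show ?case by (intro bexI[of _ ?x]) (simp_all only: One_nat_def funpow.simps comp_def id_apply)
  next
    case (Suc k)
    then obtain x where x: "x \<in> lower_central ?T (Suc (Suc k))" "F x = coset 0 ((fdiff ^^ Suc k) v)" by blast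
    let ?y = "grp_comm ?T x (triangle_gen q r gen_a)"
    have xc: "x \<in> carrier ?T" using x(1) T.lower_central_carrier by blast
    have "?y \<in> lower_central ?T (Suc (Suc (Suc k)))" by (rule T.grp_comm_lower_central) (use x in simp_all)
    \<comment> \<open>The bracket with a applies 1 minus the shift; the inverse restores the sign of
      \<open>fdiff\<close>.\<close>
    then have "inv\<^bsub>?T\<^esub> ?y \<in> lower_central ?T (Suc (Suc (Suc k)))"
      using subgroup.m_inv_closed[OF T.lower_central_subgroup] by metis
    moreover have "F (inv\<^bsub>?T\<^esub> ?y) = coset 0 (fdiff ((fdiff ^^ Suc k) v))"
      using F x xc powW[OF v(1), of "Suc k"] W_action W_diff
      by (simp add: F.hom_grp_comm coset_grp_comm coset_inv W_0 fdiff_eq_shift action_0 del: funpow.simps)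
    ultimately show ?case by (intro bexI[of _ "inv\<^bsub>?T\<^esub> ?y"]) (simp_all only: funpow.simps comp_def)
  qed
  obtain x where x: "x \<in> lower_central ?T (Suc n)" "F x = coset 0 ((fdiff ^^ n) v)"
    using nontriv[of "n - 1"] \<open>n \<ge> 1\<close> by auto
  have "\<exists>h\<in>cyclo_fun e. (fdiff ^^ n) v = (fdiff ^^ N) h" if "N \<ge> n" for N
  proof -
    have "x \<in> lower_central ?T (Suc N)" using x(1) stable[of "Suc N"] that unfolding eq[symmetric] by simp
    then obtain u where "u \<in> Z (Suc N)" "F x = coset 0 u" using image[of "Suc N" x] le_trans[OF \<open>n \<ge> 1\<close> \<open>N \<ge> n\<close>] by auto
    then show ?thesis using x(2) powW v(1) by (auto simp: Z_def coset_eq)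
  qed
  moreover have "e * t \<ge> n" if "t \<ge> n" for t
    using that e by (cases e) simp_all
  ultimately have big: "int (p ^ t) dvd (fdiff ^^ n) v j" if "t \<ge> n" for t j
  proof -
    obtain h where "h \<in> cyclo_fun e" "(fdiff ^^ n) v = (fdiff ^^ (e * t)) h"
      using \<open>\<And>N. n \<le> N \<Longrightarrow> \<exists>h\<in>cyclo_fun e. (fdiff ^^ n) v = (fdiff ^^ N) h\<close>
        \<open>\<And>t. n \<le> t \<Longrightarrow> n \<le> e * t\<close>[OF \<open>t \<ge> n\<close>] by blast
    then show ?thesis using dvd_fdiff_power[OF binom e, of h t j] p by simp
  qed
  have "(fdiff ^^ n) v j = 0" for j
  proof (rule ccontr)
    assume nz: "(fdiff ^^ n) v j \<noteq> 0"
    \<comment> \<open>This t is at least n, as \<open>big\<close> requires, and p^t > t is at least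
      the absolute value, contradicting divisibility of a nonzero integer.\<close>
    define t where "t = n + nat \<bar>(fdiff ^^ n) v j\<bar>"
    have "int (p ^ t) \<le> \<bar>(fdiff ^^ n) v j\<bar>"
      using big[of t j] nz dvd_imp_le_int[of "(fdiff ^^ n) v j" "int (p ^ t)"] by (simp add: t_def)
    moreover have "t < p ^ t" using p by (simp add: power_gt_expt)
    ultimately show False unfolding t_def by linarith
  qed
  then have "(fdiff ^^ n) v = 0" by (simp add: fun_eq_iff)
  then have "v = 0"
  proof (induction n)
    case (Suc n)
    then have "fdiff ((fdiff ^^ n) v) = 0" by (simp only: funpow.simps comp_def)
    then have "(fdiff ^^ n) v = 0" by (rule fdiff_eq_0_imp[OF powW[OF v(1)] e])
    then show ?case by (rule Suc.IH)
  qed (simp only: funpow.simps id_apply)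
  with v(2) show False by simp
qed

text \<open>For p = 2 the choice e = 2 fails: on 2-periodic functions the step 2 sum is 2 f(j),
  which forces f = 0. The hypothesis q > 2 provides 4 dvd q and thus e = 4.\<close>

lemma triangle_lower_central_strict:
  assumes p: "Factorial_Ring.prime p" and q: "q = p ^ k" "q > 2" and r: "q dvd r" and "n \<ge> 1"
  shows "lower_central (triangle_group q r) n \<noteq> lower_central (triangle_group q r) (Suc n)"
proof (cases "p = 2")
  case True
  have "k \<ge> 2"
  proof (rule ccontr)
    assume "\<not> k \<ge> 2"
    then have "k = 0 \<or> k = 1" by auto
    then show False using True q by auto
  qed
  then have "4 dvd q" using q True le_imp_power_dvd[of 2 k "2::nat"] by simp
  moreover have "(2::nat) dvd 4 choose i" if "0 < i" "i < 4" for i :: nat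
  proof -
    have "i = 1 \<or> i = 2 \<or> i = 3" using that by auto
    moreover have "(4::nat) choose 1 = 4" "(4::nat) choose 2 = 6" "(4::nat) choose 3 = 4"
      by (simp_all add: numeral_eq_Suc)
    ultimately show ?thesis by auto
  qed
  moreover obtain v where "v \<in> cyclo_fun 4" "v \<noteq> 0" using cyclo_fun_4_nonzero by blast
  ultimately show ?thesis
    using lower_central_strict_aux[of 4 2 v q r n] dvd_trans[OF _ r] \<open>n \<ge> 1\<close> by simp
next
  case False
  have k: "k > 0" using q by (cases k) auto
  have p2: "p > 2" "odd p" using False prime_ge_2_nat[OF p] prime_odd_nat[OF p] by auto
  have "p dvd q" using q k by (simp add: dvd_power)
  moreover have "p dvd p choose i" if "0 < i" "i < p" for i
    using that p by (intro dvd_choose_prime) auto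
  moreover obtain v where "v \<in> cyclo_fun p" "v \<noteq> 0" using cyclo_fun_odd_nonzero[OF p2(2,1)] by blast
  ultimately show ?thesis
    using lower_central_strict_aux[of p p v q r n] dvd_trans[OF _ r] \<open>n \<ge> 1\<close> p2 by simp
qed

section \<open>Nilpotent quotients of class three\<close>

text \<open>The binomial coefficient n over 2 extended to negative n, that is, the coefficient of
  t^2 in (1 + t)^n.\<close>

definition tri :: "int \<Rightarrow> int" where
  "tri n = n * (n - 1) div 2"

lemma two_tri: "2 * tri n = n * (n - 1)"
  by (simp add: tri_def)

lemma tri_add: "tri (m + n) = tri m + tri n + m * n"
  using two_tri[of m] two_tri[of n] two_tri[of "m + n"] by (simp add: algebra_simps)

lemma choose_Suc_2:
  "0 choose 2 = 0" "Suc j choose 2 = j + (j choose 2)"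
  "0 choose 3 = 0" "Suc j choose 3 = (j choose 2) + (j choose 3)"
  by (simp_all add: numeral_2_eq_2 numeral_3_eq_3)

lemma tri_mult: "tri (n * int j) = n\<^sup>2 * int (j choose 2) + tri n * int j"
proof (induction j)
  case (Suc j)
  then show ?case
    using tri_add[of "n * int j" n] by (simp add: choose_Suc_2 algebra_simps power2_eq_square)
qed (simp add: tri_def)

lemma tri_simps [simp]: "tri 0 = 0" "tri 1 = 0" "tri (- 1) = 1"
  by (simp_all add: tri_def)

text \<open>The action of \<open>\<int>\<close> on \<open>\<int>[t]/(t\<^sup>3)\<close> in which \<open>n\<close> acts as multiplication by \<open>(1 + t)\<^sup>n\<close>.\<close>

definition unip :: "int \<Rightarrow> int \<times> int \<times> int \<Rightarrow> int \<times> int \<times> int" where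
  "unip n = (\<lambda>(x, y, z). (x, y + n * x, z + n * y + tri n * x))"

lemma unip_simp [simp]: "unip n (x, y, z) = (x, y + n * x, z + n * y + tri n * x)"
  by (simp add: unip_def)

text \<open>The two conditions make (1 + t)^q trivial when constant terms are read modulo q and the
  other coefficients modulo M. For odd q one may take M = q. For even q > 0, \<open>tri q\<close> is
  divisible by q/2 but not by q, which dictates M = q/2. With M = 1 only two coordinates modulo q
  remain.\<close>

locale unip_quotient =
  fixes q M :: int
  assumes M_dvd_q: "M dvd q" and M_dvd_tri_q: "M dvd tri q"
begin

definition modulus :: "(int \<times> int \<times> int) set" where
  "modulus = {(x, y, z). q dvd x \<and> M dvd y \<and> M dvd z}"

lemma modulus_iff [simp]: "(x, y, z) \<in> modulus \<longleftrightarrow> q dvd x \<and> M dvd y \<and> M dvd z"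
  by (simp add: modulus_def)

lemma M_dvd: "q dvd x \<Longrightarrow> M dvd x"
  using M_dvd_q dvd_trans by blast

lemma int_action_unip: "int_action unip UNIV modulus q"
proof
  fix v :: "int \<times> int \<times> int" and n m :: int
  obtain x y z where v: "v = (x, y, z)" by (rule prod_cases3)
  show "unip n (v + w) = unip n v + unip n w" for w
    by (cases w) (simp add: v algebra_simps)
  show "unip 0 v = v" by (simp add: v)
  show "unip (m + n) v = unip m (unip n v)" by (simp add: v tri_add algebra_simps)
  show "unip q v - v \<in> modulus" using M_dvd_q M_dvd_tri_q by (simp add: v)
  show "v \<in> modulus \<Longrightarrow> unip n v \<in> modulus" using M_dvd[of x] by (simp add: v)
  show "v \<in> modulus \<Longrightarrow> - v \<in> modulus" by (simp add: v)
  show "v \<in> modulus \<Longrightarrow> w \<in> modulus \<Longrightarrow> v + w \<in> modulus" for w by (cases w) (simp add: v)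
  show "0 \<in> modulus" by (simp add: zero_prod_def)
qed simp_all

sublocale int_action unip UNIV modulus q
  by (rule int_action_unip)

lemma sum_unip: "(\<Sum>l<j. unip (n * int l) (x, y, z)) =
  (int j * x, int j * y + n * int (j choose 2) * x,
   int j * z + n * int (j choose 2) * y + x * (n\<^sup>2 * int (j choose 3) + tri n * int (j choose 2)))"
  by (induction j) (simp_all add: zero_prod_def choose_Suc_2 tri_mult algebra_simps)

text \<open>The filtration is by powers of the variable: for n >= 2 the set \<open>Z n\<close> is
  the ideal of t^(n-1), which is zero from n = 4 on. For M = 1 the multiples of t are already
  trivial.\<close>

lemma hom_kills_lower_central:
  assumes "F \<in> hom T quotient" "group T" "x \<in> lower_central T n" "n \<ge> 4 \<or> M = 1 \<and> n \<ge> 2"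
  shows "F x = \<one>\<^bsub>quotient\<^esub>"
proof -
  define Z where "Z n = {(x, y, z). x = (0::int) \<and> (n \<ge> 3 \<longrightarrow> y = (0::int)) \<and> (n \<ge> 4 \<longrightarrow> z = (0::int))}" for n :: nat
  have "\<exists>v\<in>Z n. F x = coset 0 v"
  proof (rule lower_central_image[OF assms(1,2) _ _ _ _ _ _ _ assms(3)])
    show "2 \<le> n" using assms(4) by auto
  qed (auto simp: Z_def zero_prod_def)
  then obtain v where v: "v \<in> Z n" "F x = coset 0 v" by blast
  obtain x1 x2 x3 where x: "v = (x1, x2, x3)" by (rule prod_cases3)
  have "x1 = 0" "M dvd x2" "M dvd x3"
    using v(1) assms(4) by (auto simp: Z_def x)
  then have "v - 0 \<in> modulus" by (simp add: x)
  then show ?thesis unfolding v(2) one_quotient by (subst coset_eq) simp_all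
qed

end

section \<open>Conjugacy of powers, read off in coordinates\<close>

context group
begin

definition conj_mod :: "'a set \<Rightarrow> 'a \<Rightarrow> 'a \<Rightarrow> bool" where
  "conj_mod K x y \<longleftrightarrow> (\<exists>g\<in>carrier G. K #> x = K #> (g \<otimes> y \<otimes> inv g))"

lemma conj_mod_mono:
  assumes "conj_mod N x y" "subgroup N G" "subgroup K G" "N \<subseteq> K" "x \<in> carrier G" "y \<in> carrier G"
  shows "conj_mod K x y"
  using assms by (auto simp: conj_mod_def r_coset_eq_iff)

end

context unip_quotient
begin

text \<open>Comparison of coordinates in the equation between the power of s and the conjugate of
  the power of t. Here Y and Z are the upper coordinates of the j-th power of t, and a, u, w come
  from the conjugating element; its last coordinate cancels.\<close>

lemma conj_mod_congruences:
  assumes F: "F \<in> hom T quotient" and T: "group T" and K: "subgroup K T" "\<forall>x\<in>K. F x = \<one>\<^bsub>quotient\<^esub>"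
    and s: "s \<in> carrier T" "F s = coset n (x, y, z)" and t: "t \<in> carrier T" "F t = coset m (x', y', z')"
    and conj: "group.conj_mod T K (s [^]\<^bsub>T\<^esub> (i::nat)) (t [^]\<^bsub>T\<^esub> (j::nat))"
  defines "C \<equiv> \<lambda>k. int (j choose k)"
  defines "Y \<equiv> int j * y' + m * C 2 * x'"
  defines "Z \<equiv> int j * z' + m * C 2 * y' + x' * (m\<^sup>2 * C 3 + tri m * C 2)"
  obtains a u w where "q dvd n * int i - m * int j" "q dvd int i * x - int j * x'"
    and "M dvd (int i * y + n * int (i choose 2) * x) - (Y + a * (int j * x') - m * int j * u)"
    and "M dvd (int i * z + n * int (i choose 2) * y + x * (n\<^sup>2 * int (i choose 3) + tri n * int (i choose 2)))
      - (Z + a * Y + tri a * (int j * x') - m * int j * w - tri (m * int j) * u)"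
proof -
  interpret F: group_hom T quotient F
    using F T by (simp add: group_hom_def group_hom_axioms_def coset.H.is_group)
  obtain g where g: "g \<in> carrier T" "K #>\<^bsub>T\<^esub> s [^]\<^bsub>T\<^esub> i = K #>\<^bsub>T\<^esub> (g \<otimes>\<^bsub>T\<^esub> t [^]\<^bsub>T\<^esub> j \<otimes>\<^bsub>T\<^esub> inv\<^bsub>T\<^esub> g)"
    using conj by (auto simp: F.G.conj_mod_def)
  have "s [^]\<^bsub>T\<^esub> i \<otimes>\<^bsub>T\<^esub> inv\<^bsub>T\<^esub> (g \<otimes>\<^bsub>T\<^esub> t [^]\<^bsub>T\<^esub> j \<otimes>\<^bsub>T\<^esub> inv\<^bsub>T\<^esub> g) \<in> K"
    using g s t K(1) by (simp flip: F.G.r_coset_eq_iff)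
  then have "F (s [^]\<^bsub>T\<^esub> i \<otimes>\<^bsub>T\<^esub> inv\<^bsub>T\<^esub> (g \<otimes>\<^bsub>T\<^esub> t [^]\<^bsub>T\<^esub> j \<otimes>\<^bsub>T\<^esub> inv\<^bsub>T\<^esub> g)) = \<one>\<^bsub>quotient\<^esub>" by (rule bspec[OF K(2)])
  then have eq: "F s [^]\<^bsub>quotient\<^esub> i = F g \<otimes>\<^bsub>quotient\<^esub> F t [^]\<^bsub>quotient\<^esub> j \<otimes>\<^bsub>quotient\<^esub> inv\<^bsub>quotient\<^esub> (F g)"
    using g s t coset.H.inv_equality[of "F s [^]\<^bsub>quotient\<^esub> i"
        "inv\<^bsub>quotient\<^esub> (F g \<otimes>\<^bsub>quotient\<^esub> F t [^]\<^bsub>quotient\<^esub> j \<otimes>\<^bsub>quotient\<^esub> inv\<^bsub>quotient\<^esub> (F g))"]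
    by (simp add: F.hom_nat_pow)
  obtain a v where "F g = coset a v" using F.hom_closed[OF g(1)] coset_cases by metis
  moreover obtain u w w' where "v = (u, w, w')" by (rule prod_cases3)
  ultimately have Fg: "F g = coset a (u, w, w')" by simp
  let ?P = "(int i * x, int i * y + n * int (i choose 2) * x,
    int i * z + n * int (i choose 2) * y + x * (n\<^sup>2 * int (i choose 3) + tri n * int (i choose 2)))"
  have "coset (n * int i) ?P = coset (m * int j) ((u, w, w') + unip a (int j * x', Y, Z) - unip (m * int j) (u, w, w'))"
    using eq coset.hom_mult[of "(a, (u, w, w'))" "(m * int j, (int j * x', Y, Z))"]
      coset.hom_mult[of "(a, (u, w, w')) \<otimes>\<^bsub>semidirect\<^esub> (m * int j, (int j * x', Y, Z))" "inv\<^bsub>semidirect\<^esub> (a, (u, w, w'))"]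
      conj_semidirect[of "(int j * x', Y, Z)" "(u, w, w')" a "m * int j"]
      coset.hom_inv[of "(a, (u, w, w'))"]
    unfolding s t Fg coset_pow[OF UNIV_I] sum_unip Y_def Z_def C_def
    by (simp del: semidirect_simps(2) unip_simp add_Pair diff_Pair)
  then have "q dvd n * int i - m * int j \<and> ?P - ((u, w, w') + unip a (int j * x', Y, Z) - unip (m * int j) (u, w, w')) \<in> modulus"
    by (simp only: coset_eq UNIV_I)
  then show ?thesis
    by (intro that[of a u w]) (simp_all add: algebra_simps)
qed

end

section \<open>Strongly real Beauville quotients\<close>

context group
begin

lemma generate_quotient_image:
  assumes "N \<lhd> G" "subgroup H G" "generate G (H \<union> K) = carrier G" "K \<subseteq> N"
  shows "(#>) N ` H = carrier (G Mod N)"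
proof -
  interpret N: normal N G by fact
  interpret \<pi>: group_hom G "G Mod N" "(#>) N" by (rule group_hom_r_coset[OF assms(1)])
  have sub: "H \<union> K \<subseteq> carrier G" using assms(4) subgroup.subset[OF assms(2)] N.subset by blast
  have H: "subgroup ((#>) N ` H) (G Mod N)" by (rule \<pi>.subgroup_img_is_subgroup[OF assms(2)])
  have "N #> y = \<one>\<^bsub>G Mod N\<^esub>" if "y \<in> K" for y
    using that assms(4) N.rcos_const[OF is_group] by auto
  then have "(#>) N ` (H \<union> K) \<subseteq> (#>) N ` H"
    using subgroup.one_closed[OF H] by auto
  then have "generate (G Mod N) ((#>) N ` (H \<union> K)) \<subseteq> (#>) N ` H"
    by (rule \<pi>.H.generate_subgroup_incl[OF _ H])
  then have "(#>) N ` carrier G \<subseteq> (#>) N ` H"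
    using \<pi>.generate_img[OF sub] assms(3) by simp
  then show ?thesis
    using subgroup.subset[OF assms(2)] by (auto simp: carrier_FactGroup)
qed

text \<open>Since \<theta> preserves N and is an involution, it induces an automorphism of the
  quotient that already inverts all four elements, so trivial conjugators suffice. Disjointness
  reduces to conjugate powers after absorbing both conjugations into one.\<close>

lemma strongly_real_Beauville_quotient:
  assumes N: "N \<lhd> G" "finite (carrier (G Mod N))" and K: "lower_central G n \<subseteq> N" "n \<ge> 2"
    and ab: "a \<in> carrier G" "b \<in> carrier G" "generate G {a, b} = carrier G"
    and xy: "x \<in> carrier G" "y \<in> carrier G" "generate G (generate G {x, y} \<union> lower_central G 2) = carrier G"
    and \<theta>: "\<theta> \<in> hom G G" "\<And>g. g \<in> carrier G \<Longrightarrow> \<theta> (\<theta> g) = g" "\<And>g. g \<in> N \<Longrightarrow> \<theta> g \<in> N"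
      "\<theta> a = inv a" "\<theta> b = inv b" "\<theta> x = inv x" "\<theta> y = inv y"
    and disj: "\<And>s t i j. s \<in> {a, b, a \<otimes> b} \<Longrightarrow> t \<in> {x, y, x \<otimes> y} \<Longrightarrow>
      conj_mod N (s [^] (i::nat)) (t [^] (j::nat)) \<Longrightarrow> s [^] i = \<one>"
  shows "strongly_real_Beauville_group (G Mod N)"
proof -
  interpret N: normal N G by fact
  let ?Q = "G Mod N" and ?\<pi> = "(#>) N"
  interpret \<pi>: group_hom G ?Q ?\<pi> by (rule group_hom_r_coset[OF N(1)])
  interpret \<theta>: group_hom G G \<theta> using \<theta>(1) by unfold_locales
  have gen_ab: "generate ?Q {?\<pi> a, ?\<pi> b} = carrier ?Q"
    using \<pi>.generate_img[of "{a, b}"] ab by (simp add: carrier_FactGroup)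
  have sub_xy: "subgroup (generate G {x, y}) G" using xy by (intro generate_is_subgroup) simp
  have "generate G (generate G {x, y} \<union> lower_central G n) = carrier G"
    by (rule generate_Un_lower_central[OF sub_xy xy(3) K(2)])
  from generate_quotient_image[OF N(1) sub_xy this K(1)]
  have gen_xy: "generate ?Q {?\<pi> x, ?\<pi> y} = carrier ?Q"
    using \<pi>.generate_img[of "{x, y}"] xy by simp
  have inter: "Beauville_Sigma ?Q (?\<pi> a) (?\<pi> b) \<inter> Beauville_Sigma ?Q (?\<pi> x) (?\<pi> y) \<subseteq> {\<one>\<^bsub>?Q\<^esub>}"
  proof
    fix z assume z: "z \<in> Beauville_Sigma ?Q (?\<pi> a) (?\<pi> b) \<inter> Beauville_Sigma ?Q (?\<pi> x) (?\<pi> y)"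
    have Sigma: "\<exists>g\<in>carrier G. \<exists>s\<in>{u, v, u \<otimes> v}. \<exists>i::nat. z = ?\<pi> (inv g \<otimes> s [^] i \<otimes> g)"
      if uv: "u \<in> carrier G" "v \<in> carrier G" and zuv: "z \<in> Beauville_Sigma ?Q (?\<pi> u) (?\<pi> v)" for u v
    proof -
      have "?\<pi> u \<otimes>\<^bsub>?Q\<^esub> ?\<pi> v = ?\<pi> (u \<otimes> v)" using uv by (simp only: \<pi>.hom_mult)
      then obtain C h s where C: "C \<in> carrier ?Q" "s \<in> {u, v, u \<otimes> v}" "h \<in> generate ?Q {?\<pi> s}"
          "z = inv\<^bsub>?Q\<^esub> C \<otimes>\<^bsub>?Q\<^esub> h \<otimes>\<^bsub>?Q\<^esub> C"
        using zuv unfolding Beauville_Sigma_def by (auto simp del: mult_FactGroup)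
      obtain g where g: "g \<in> carrier G" "C = ?\<pi> g" using C(1) by (auto simp: carrier_FactGroup)
      have s: "s \<in> carrier G" using C(2) uv by auto
      \<comment> \<open>The quotient is finite, so a cyclic subgroup consists of natural powers and
        negative exponents never enter.\<close>
      obtain i :: nat where "h = ?\<pi> s [^]\<^bsub>?Q\<^esub> i"
        using \<pi>.H.generate_pow_on_finite_carrier[OF N(2) \<pi>.hom_closed[OF s]] C(3) by auto
      then have "z = ?\<pi> (inv g \<otimes> s [^] i \<otimes> g)"
        using C(4) g s by (simp add: \<pi>.hom_nat_pow del: mult_FactGroup)
      then show ?thesis using g(1) C(2) by blast
    qed
    obtain g s i where g: "g \<in> carrier G" "s \<in> {a, b, a \<otimes> b}" "z = ?\<pi> (inv g \<otimes> s [^] (i::nat) \<otimes> g)"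
      using Sigma[OF ab(1,2)] z by blast
    obtain h t j where h: "h \<in> carrier G" "t \<in> {x, y, x \<otimes> y}" "z = ?\<pi> (inv h \<otimes> t [^] (j::nat) \<otimes> h)"
      using Sigma[OF xy(1,2)] z by blast
    have st: "s \<in> carrier G" "t \<in> carrier G" using g(2) h(2) ab xy by auto
    have "?\<pi> (s [^] i) = ?\<pi> g \<otimes>\<^bsub>?Q\<^esub> ?\<pi> (inv g \<otimes> s [^] i \<otimes> g) \<otimes>\<^bsub>?Q\<^esub> ?\<pi> (inv g)"
      using g(1) st by (simp add: m_assoc del: mult_FactGroup \<pi>.hom_inv flip: \<pi>.hom_mult)
    also have "\<dots> = ?\<pi> g \<otimes>\<^bsub>?Q\<^esub> ?\<pi> (inv h \<otimes> t [^] j \<otimes> h) \<otimes>\<^bsub>?Q\<^esub> ?\<pi> (inv g)"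
      using g(3) h(3) by simp
    also have "\<dots> = ?\<pi> (g \<otimes> inv h \<otimes> t [^] j \<otimes> inv (g \<otimes> inv h))"
      using g(1) h(1) st by (simp add: m_assoc inv_mult_group del: mult_FactGroup \<pi>.hom_inv flip: \<pi>.hom_mult)
    finally have "conj_mod N (s [^] i) (t [^] j)"
      unfolding conj_mod_def using g(1) h(1) by (intro bexI[of _ "g \<otimes> inv h"]) auto
    then have "s [^] i = \<one>" using disj g(2) h(2) by blast
    then show "z \<in> {\<one>\<^bsub>?Q\<^esub>}" using g by simp
  qed
  have one: "\<one>\<^bsub>?Q\<^esub> \<in> Beauville_Sigma ?Q (?\<pi> u) (?\<pi> v)" if "u \<in> carrier G" "v \<in> carrier G" for u v
    unfolding Beauville_Sigma_def
    by (rule UN_I[of "\<one>\<^bsub>?Q\<^esub>"], simp del: one_FactGroup, rule image_eqI[of _ _ "\<one>\<^bsub>?Q\<^esub>"])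
      (simp_all add: generate.one del: one_FactGroup mult_FactGroup)
  have B: "Beauville_structure ?Q (?\<pi> a) (?\<pi> b) (?\<pi> x) (?\<pi> y)"
    unfolding Beauville_structure_def using gen_ab gen_xy inter one ab xy
    by (simp del: one_FactGroup) blast
  have image_N: "\<theta> ` N = N"
  proof
    show "\<theta> ` N \<subseteq> N" using \<theta>(3) by blast
    show "N \<subseteq> \<theta> ` N"
      using \<theta>(2,3) N.subset by (metis image_eqI subsetD subsetI)
  qed
  have \<theta>\<pi>: "\<theta> ` ?\<pi> g = ?\<pi> (\<theta> g)" if "g \<in> carrier G" for g
  proof -
    have "\<theta> ` ?\<pi> g = (\<lambda>n. \<theta> n \<otimes> \<theta> g) ` N"
      using that by (auto simp: r_coset_def image_iff)
    also have "\<dots> = ?\<pi> (\<theta> g)" using image_N by (auto simp: r_coset_def image_iff) (metis image_iff)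
    finally show ?thesis .
  qed
  have iso: "(\<lambda>C. \<theta> ` C) \<in> iso ?Q ?Q"
  proof (rule isoI)
    show "(\<lambda>C. \<theta> ` C) \<in> hom ?Q ?Q"
    proof (rule homI)
      fix C D assume "C \<in> carrier ?Q" "D \<in> carrier ?Q"
      then obtain g h where "g \<in> carrier G" "C = ?\<pi> g" "h \<in> carrier G" "D = ?\<pi> h"
        by (auto simp: carrier_FactGroup)
      then show "\<theta> ` C \<in> carrier ?Q" "\<theta> ` (C \<otimes>\<^bsub>?Q\<^esub> D) = \<theta> ` C \<otimes>\<^bsub>?Q\<^esub> \<theta> ` D"
        by (simp_all add: \<theta>\<pi> del: mult_FactGroup flip: \<pi>.hom_mult)
    qed
    have inv: "\<theta> ` (\<theta> ` C) = C \<and> \<theta> ` C \<in> carrier ?Q" if C: "C \<in> carrier ?Q" for C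
    proof -
      obtain g where "g \<in> carrier G" "C = ?\<pi> g" using C by (auto simp: carrier_FactGroup)
      then show ?thesis by (simp only: \<theta>\<pi> \<theta>(2) \<theta>.hom_closed \<pi>.hom_closed)
    qed
    show "bij_betw (\<lambda>C. \<theta> ` C) (carrier ?Q) (carrier ?Q)"
      by (rule bij_betw_byWitness[of _ "\<lambda>C. \<theta> ` C"]) (use inv in auto)
  qed
  have real: "\<one>\<^bsub>?Q\<^esub> \<otimes>\<^bsub>?Q\<^esub> \<theta> ` ?\<pi> g \<otimes>\<^bsub>?Q\<^esub> inv\<^bsub>?Q\<^esub> \<one>\<^bsub>?Q\<^esub> = inv\<^bsub>?Q\<^esub> ?\<pi> g"
    if "g \<in> carrier G" "\<theta> g = inv g" for g
    using that by (simp add: \<theta>\<pi> del: one_FactGroup mult_FactGroup)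
  have "strongly_real_Beauville_structure ?Q (?\<pi> a) (?\<pi> b) (?\<pi> x) (?\<pi> y)"
    unfolding strongly_real_Beauville_structure_def
    using B iso real ab xy \<theta> \<pi>.H.one_closed by blast
  moreover have "two_generator_group ?Q"
    unfolding two_generator_group_def using \<pi>.H.is_group gen_ab ab(1,2) \<pi>.hom_closed by blast
  ultimately show ?thesis
    unfolding strongly_real_Beauville_group_def Beauville_group_def
    using \<pi>.H.is_group N(2) B by blast
qed

end

text \<open>Cramer's rule puts the D-th powers of both generators into H, where D is the determinant
  of the exponents; Bezout with q then recovers the generators.\<close>

lemma (in comm_group) generate_of_coprime_det:
  assumes ab: "\<alpha> \<in> carrier G" "\<beta> \<in> carrier G" and q: "\<alpha> [^] (q::nat) = \<one>" "\<beta> [^] q = \<one>"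
    and "coprime (s1 * t2 - s2 * t1) (int q)"
    and H: "subgroup H G" "\<alpha> [^] s1 \<otimes> \<beta> [^] s2 \<in> H" "\<alpha> [^] t1 \<otimes> \<beta> [^] t2 \<in> H"
  shows "\<alpha> \<in> H" "\<beta> \<in> H"
proof -
  let ?D = "s1 * t2 - s2 * t1"
  have qi: "\<alpha> [^] int q = \<one>" "\<beta> [^] int q = \<one>" using q by (simp_all add: int_pow_int)
  have root: "\<gamma> \<in> H" if \<gamma>: "\<gamma> \<in> carrier G" "\<gamma> [^] int q = \<one>" "\<gamma> [^] ?D \<in> H" for \<gamma>
  proof -
    obtain u v where uv: "u * ?D + v * int q = 1"
      using assms(5) bezout_int[of ?D "int q"] by (auto simp: coprime_iff_gcd_eq_1)
    have "\<gamma> = \<gamma> [^] (?D * u + int q * v)" using uv \<gamma>(1) by (simp add: mult.commute)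
    also have "\<dots> = (\<gamma> [^] ?D) [^] u" using \<gamma> by (simp add: int_pow_mult int_pow_pow[symmetric] del: int_pow_pow)
    finally show ?thesis using \<gamma>(3) subgroup_int_pow_closed[OF H(1)] by metis
  qed
  let ?x = "\<alpha> [^] s1 \<otimes> \<beta> [^] s2" and ?y = "\<alpha> [^] t1 \<otimes> \<beta> [^] t2"
  have "?x [^] t2 \<otimes> ?y [^] (- s2) \<in> H"
    by (rule subgroup.m_closed[OF H(1) subgroup_int_pow_closed[OF H(1,2)] subgroup_int_pow_closed[OF H(1,3)]])
  moreover have "?x [^] t2 \<otimes> ?y [^] (- s2) = \<alpha> [^] (s1 * t2 + t1 * (- s2)) \<otimes> \<beta> [^] (s2 * t2 + t2 * (- s2))"
    using ab by (simp add: int_pow_distrib int_pow_pow int_pow_mult m_ac del: mult_minus_right)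
  ultimately have "\<alpha> [^] ?D \<in> H" using ab by (simp add: algebra_simps)
  then show "\<alpha> \<in> H" using root ab qi by blast
  have "?x [^] (- t1) \<otimes> ?y [^] s1 \<in> H"
    by (rule subgroup.m_closed[OF H(1) subgroup_int_pow_closed[OF H(1,2)] subgroup_int_pow_closed[OF H(1,3)]])
  moreover have "?x [^] (- t1) \<otimes> ?y [^] s1 = \<alpha> [^] (s1 * (- t1) + t1 * s1) \<otimes> \<beta> [^] (s2 * (- t1) + t2 * s1)"
    using ab by (simp add: int_pow_distrib int_pow_pow int_pow_mult m_ac del: mult_minus_right)
  ultimately have "\<beta> [^] ?D \<in> H" using ab by (simp add: algebra_simps)
  then show "\<beta> \<in> H" using root ab qi by blast
qed

section \<open>Generation detected in the abelianization\<close>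

context group
begin

lemma comm_group_abelianization: "comm_group (G Mod lower_central G 2)"
proof -
  let ?K = "lower_central G 2"
  interpret K: normal ?K G by (rule lower_central_normal)
  interpret \<pi>: group_hom G "G Mod ?K" "(#>) ?K" by (rule group_hom_r_coset[OF lower_central_normal])
  show ?thesis
  proof (rule \<pi>.H.group_comm_groupI)
    fix C D assume C: "C \<in> carrier (G Mod ?K)" and "D \<in> carrier (G Mod ?K)"
    then obtain g where "g \<in> carrier G" "D = ?K #> g" by (auto simp: carrier_FactGroup)
    then show "C \<otimes>\<^bsub>G Mod ?K\<^esub> D = D \<otimes>\<^bsub>G Mod ?K\<^esub> C"
      using grp_comm_central_mod[OF lower_central_normal, of g 2 C] C grp_comm_lower_central[of 1 g]
      by (simp add: numeral_2_eq_2 del: mult_FactGroup)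
  qed
qed

lemma generate_of_coprime_exponents:
  assumes ab: "a \<in> carrier G" "b \<in> carrier G" "generate G {a, b} = carrier G"
    and q: "a [^] (q::nat) = \<one>" "b [^] q = \<one>" and xy: "x \<in> carrier G" "y \<in> carrier G"
    and D: "coprime (s1 * t2 - s2 * t1) (int q)"
  defines "A \<equiv> G Mod lower_central G 2" and "\<pi> \<equiv> (#>) (lower_central G 2)"
  assumes x: "\<pi> x = \<pi> a [^]\<^bsub>A\<^esub> s1 \<otimes>\<^bsub>A\<^esub> \<pi> b [^]\<^bsub>A\<^esub> s2"
    and y: "\<pi> y = \<pi> a [^]\<^bsub>A\<^esub> t1 \<otimes>\<^bsub>A\<^esub> \<pi> b [^]\<^bsub>A\<^esub> t2"
  shows "generate G (generate G {x, y} \<union> lower_central G 2) = carrier G"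
proof -
  let ?K = "lower_central G 2" and ?H = "generate G {x, y}"
  interpret K: normal ?K G by (rule lower_central_normal)
  interpret \<pi>: group_hom G A \<pi>
    unfolding A_def \<pi>_def by (rule group_hom_r_coset[OF lower_central_normal])
  interpret A: comm_group A unfolding A_def by (rule comm_group_abelianization)
  have H: "subgroup ?H G" using xy by (intro generate_is_subgroup) simp
  have "subgroup (\<pi> ` ?H) A" by (rule \<pi>.subgroup_img_is_subgroup[OF H])
  moreover have "\<pi> x \<in> \<pi> ` ?H" "\<pi> y \<in> \<pi> ` ?H" by (auto intro: generate.incl)
  ultimately have im: "\<pi> a \<in> \<pi> ` ?H" "\<pi> b \<in> \<pi> ` ?H"
    using A.generate_of_coprime_det[of "\<pi> a" "\<pi> b" q s1 t2 s2 t1 "\<pi> ` ?H"] ab(1,2) q D x y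
    by (simp_all add: \<pi>.hom_nat_pow[symmetric])
  have sub: "?H \<union> ?K \<subseteq> carrier G" using subgroup.subset[OF H] K.subset by blast
  have B: "subgroup (generate G (?H \<union> ?K)) G" by (rule generate_is_subgroup[OF sub])
  have lift: "g \<in> generate G (?H \<union> ?K)" if g: "g \<in> carrier G" "\<pi> g \<in> \<pi> ` ?H" for g
  proof -
    obtain h where h: "h \<in> ?H" "?K #> g = ?K #> h" using g(2) by (auto simp: \<pi>_def)
    have hc: "h \<in> carrier G" using h(1) subgroup.mem_carrier[OF H] by blast
    then have "g \<otimes> inv h \<in> ?K" using h(2) g(1) r_coset_eq_iff[OF K.subgroup_axioms] by blast
    then have "g \<otimes> inv h \<otimes> h \<in> generate G (?H \<union> ?K)"
      using h(1) by (intro subgroup.m_closed[OF B, of "g \<otimes> inv h"] generate.incl) simp_all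
    then show ?thesis using hc g(1) by (simp add: m_assoc)
  qed
  have "generate G {a, b} \<subseteq> generate G (?H \<union> ?K)"
    using lift im ab by (intro generate_subgroup_incl[OF _ B]) blast
  then show ?thesis using ab(3) subgroup.subset[OF B] by blast
qed

end

lemma two_choose_2: "2 * int (j choose 2) = int j * (int j - 1)"
  by (induction j) (simp_all add: choose_Suc_2 algebra_simps)

lemma six_choose_3: "6 * int (j choose 3) = int j * (int j - 1) * (int j - 2)"
proof (induction j)
  case (Suc j)
  then show ?case using two_choose_2[of j] by (simp add: choose_Suc_2 algebra_simps)
qed (simp add: choose_Suc_2)

lemma odd_dvd_tri:
  assumes "odd (q::int)" "q dvd n"
  shows "q dvd tri n"
proof -
  have "q dvd 2 * tri n" using assms(2) by (simp add: two_tri)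
  then show ?thesis using assms(1) by (simp add: coprime_dvd_mult_right_iff)
qed

lemma odd_dvd_choose_2:
  assumes "odd (q::int)" "q dvd int j"
  shows "q dvd int (j choose 2)"
proof -
  have "q dvd 2 * int (j choose 2)" using assms(2) by (simp add: two_choose_2)
  then show ?thesis using assms(1) by (simp add: coprime_dvd_mult_right_iff)
qed

locale unip_hom = unip_quotient q M + group T
  for q M :: int and T (structure) +
  fixes F :: "'a \<Rightarrow> (int \<times> int \<times> int \<times> int) set" and K :: "'a set"
  assumes F_hom: "F \<in> hom T quotient" and K_subgroup: "subgroup K T"
    and F_kills: "\<forall>x\<in>K. F x = \<one>\<^bsub>quotient\<^esub>"
begin

lemmas congruences = conj_mod_congruences[OF F_hom is_group K_subgroup F_kills]

text \<open>The first two congruences are a homogeneous linear system in i and j, since conjugation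
  changes neither coordinate; its determinant is a unit modulo q.\<close>

lemma conj_mod_det:
  assumes s: "s \<in> carrier T" "F s = coset n (x, y, z)" and t: "t \<in> carrier T" "F t = coset m (x', y', z')"
    and conj: "conj_mod K (s [^] (i::nat)) (t [^] (j::nat))"
    and D: "coprime (n * x' - x * m) q"
  shows "q dvd int i \<and> q dvd int j"
proof -
  have *: "q dvd n * int i - m * int j" "q dvd int i * x - int j * x'"
    using congruences[OF s t conj] by blast+
  have "q dvd (n * int i - m * int j) * x' - (int i * x - int j * x') * m"
    by (rule dvd_diff[OF dvd_mult2[OF *(1)] dvd_mult2[OF *(2)]])
  then have "q dvd (n * x' - x * m) * int i" by (simp add: algebra_simps)
  then have "q dvd int i" using D by (simp add: coprime_commute coprime_dvd_mult_right_iff)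
  moreover have "q dvd (n * int i - m * int j) * x - (int i * x - int j * x') * n"
    by (rule dvd_diff[OF dvd_mult2[OF *(1)] dvd_mult2[OF *(2)]])
  then have "q dvd (n * x' - x * m) * int j" by (simp add: algebra_simps)
  then have "q dvd int j" using D by (simp add: coprime_commute coprime_dvd_mult_right_iff)
  ultimately show ?thesis ..
qed

text \<open>With i and j divisible by the odd q, all linear and quadratic binomials vanish modulo q,
  and with them the influence of the conjugator. The cubic ones may survive when 3 divides q, and
  they carry the extra information about i.\<close>

lemma conj_mod_cubic:
  assumes odd: "odd q" "M = q"
    and s: "s \<in> carrier T" "F s = coset n (x, y, z)" and t: "t \<in> carrier T" "F t = coset m (x', y', z')"
    and conj: "conj_mod K (s [^] (i::nat)) (t [^] (j::nat))"
    and ij: "q dvd int i" "q dvd int j"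
  shows "q dvd n\<^sup>2 * x * int (i choose 3) - m\<^sup>2 * x' * int (j choose 3)"
proof -
  define C where "C k = int (j choose k)" for k
  define Y where "Y = int j * y' + m * C 2 * x'"
  define Z where "Z = int j * z' + m * C 2 * y' + x' * (m\<^sup>2 * C 3 + tri m * C 2)"
  obtain a u w where *: "q dvd (int i * z + n * int (i choose 2) * y +
        x * (n\<^sup>2 * int (i choose 3) + tri n * int (i choose 2)))
      - (Z + a * Y + tri a * (int j * x') - m * int j * w - tri (m * int j) * u)"
    using congruences[OF s t conj] odd(2) unfolding Z_def Y_def C_def by blast
  have i2: "q dvd int (i choose 2)" and j2: "q dvd C 2"
    using odd_dvd_choose_2[OF odd(1)] ij by (auto simp: C_def)
  have Y: "q dvd Y" unfolding Y_def using ij j2 by (intro dvd_add) simp_all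
  have "q dvd tri (m * int j)" using ij odd_dvd_tri[OF odd(1)] by simp
  then have r: "q dvd (int i * z + n * int (i choose 2) * y + x * tri n * int (i choose 2))
      - (int j * z' + m * C 2 * y' + x' * tri m * C 2 + a * Y + tri a * (int j * x') - m * int j * w
         - tri (m * int j) * u)"
    using ij i2 j2 Y by (intro dvd_diff dvd_add) simp_all
  have "q dvd n\<^sup>2 * x * int (i choose 3) - m\<^sup>2 * x' * C 3"
    using dvd_diff[OF * r] by (simp add: Z_def algebra_simps)
  then show ?thesis by (simp add: C_def)
qed

text \<open>Both elements are translations with proportional constant terms. A conjugation by (1 +
  t)^a can match them only if a j x vanishes modulo q; then \<open>tri a\<close> j x vanishes too,
  so j z does, and z is a unit.\<close>

lemma conj_mod_translation_odd:
  assumes odd: "odd q" "M = q"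
    and s: "s \<in> carrier T" "F s = coset 0 (1, 0, 0)" and t: "t \<in> carrier T" "F t = coset 0 (x, 0, z)"
    and conj: "conj_mod K (s [^] (i::nat)) (t [^] (j::nat))"
    and z: "coprime z q"
  shows "q dvd int i"
proof -
  obtain a where *: "q dvd int i - int j * x" "q dvd a * (int j * x)" "q dvd int j * z + tri a * (int j * x)"
  proof (rule congruences[OF s t conj])
    fix a u w
    assume "q dvd int i * 1 - int j * x"
      and "M dvd int i * 0 + 0 * int (i choose 2) * 1 -
        (int j * 0 + 0 * int (j choose 2) * x + a * (int j * x) - 0 * int j * u)"
      and "M dvd int i * 0 + 0 * int (i choose 2) * 0 + 1 * (0\<^sup>2 * int (i choose 3) + tri 0 * int (i choose 2)) -
        (int j * z + 0 * int (j choose 2) * 0 + x * (0\<^sup>2 * int (j choose 3) + tri 0 * int (j choose 2)) +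
          a * (int j * 0 + 0 * int (j choose 2) * x) + tri a * (int j * x) - 0 * int j * w - tri (0 * int j) * u)"
    then have "q dvd int i - int j * x" "q dvd - (a * (int j * x))" "q dvd - (int j * z + tri a * (int j * x))"
      using odd(2) by simp_all
    then show ?thesis by (intro that) (simp_all only: dvd_minus_iff)
  qed
  have "q dvd (a - 1) * (a * (int j * x))" using *(2) by simp
  moreover have "2 * (tri a * (int j * x)) = (a - 1) * (a * (int j * x))"
    using arg_cong[OF two_tri[of a], of "\<lambda>c. c * (int j * x)"] by (simp only: mult_ac)
  ultimately have "q dvd 2 * (tri a * (int j * x))" by (simp only:)
  then have "q dvd tri a * (int j * x)" using odd(1) by (simp add: coprime_dvd_mult_right_iff)
  then have "q dvd int j * z" using *(3) dvd_add_left_iff by blast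
  then have "q dvd int j" using z by (simp add: coprime_commute coprime_dvd_mult_left_iff)
  then have "q dvd int j * x" by simp
  then show ?thesis using *(1) by (metis diff_add_cancel dvd_add)
qed

text \<open>The first coordinate yields only that q/2 divides j. The t^2 coordinate modulo q/2
  reduces to an odd multiple of j over 2, so q divides j(j - 1); as j is even, the missing factor 2
  is gained.\<close>

lemma conj_mod_translation_even:
  assumes k: "q = 2 * M" "M = 2 ^ k" "k \<ge> 1"
    and s: "s \<in> carrier T" "F s = coset 0 (1, 0, 0)" and t: "t \<in> carrier T" "F t = coset (2 * m) (x, y, z)"
    and odd: "odd m" "odd x"
    and conj: "conj_mod K (s [^] (i::nat)) (t [^] (j::nat))"
  shows "q dvd int i"
proof -
  define C where "C k = int (j choose k)" for k
  define Y where "Y = int j * y + 2 * m * C 2 * x"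
  define Z where "Z = int j * z + 2 * m * C 2 * y + x * ((2 * m)\<^sup>2 * C 3 + tri (2 * m) * C 2)"
  obtain a u w where *: "q dvd 0 * int i - 2 * m * int j" "q dvd int i * 1 - int j * x"
      "M dvd (int i * 0 + 0 * int (i choose 2) * 1) - (Y + a * (int j * x) - 2 * m * int j * u)"
      "M dvd (int i * 0 + 0 * int (i choose 2) * 0 + 1 * (0\<^sup>2 * int (i choose 3) + tri 0 * int (i choose 2)))
        - (Z + a * Y + tri a * (int j * x) - 2 * m * int j * w - tri (2 * m * int j) * u)"
    using congruences[OF s t conj] unfolding Z_def Y_def C_def by blast
  have cop: "coprime M (int c)" if "odd c" for c :: nat
    using that k(2) by simp
  have copi: "coprime M c" if "odd c" for c :: int
    using that k(2) by simp
  have "2 * M dvd 2 * (m * int j)" using *(1) k(1) by (simp add: mult.assoc)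
  then have "M dvd m * int j" by simp
  then have j: "M dvd int j" using copi[OF odd(1)] by (simp add: coprime_dvd_mult_right_iff)
  have C2: "2 * C 2 = int j * (int j - 1)" unfolding C_def by (rule two_choose_2)
  have mC2: "M dvd 2 * C 2" using j by (simp add: C2)
  have Y: "M dvd Y"
    unfolding Y_def using j dvd_mult2[OF mC2, of "m * x"] by (intro dvd_add) (simp_all add: mult_ac)
  have "2 * M dvd 2 * (m * int j)" using j by simp
  then have "M dvd tri (2 * m * int j)"
    using j two_tri[of "2 * m * int j"] by (simp add: mult.assoc)
  then have R: "M dvd a * Y + tri a * (int j * x) - 2 * m * int j * w - tri (2 * m * int j) * u" (is "_ dvd ?R")
    using j Y by (intro dvd_diff dvd_add) simp_all
  have "M dvd - (Z + ?R)" using *(4) by (simp add: algebra_simps)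
  then have Z: "M dvd Z" using R by (simp only: dvd_minus_iff dvd_add_left_iff)
  have eq3: "3 * ((2 * m)\<^sup>2 * C 3) = 2 * m\<^sup>2 * (int j * (int j - 1) * (int j - 2))"
    unfolding six_choose_3[symmetric] by (simp add: C_def power2_eq_square)
  have "M dvd 3 * ((2 * m)\<^sup>2 * C 3)" unfolding eq3 using j by simp
  then have "M dvd (2 * m)\<^sup>2 * C 3"
    by (subst (asm) coprime_dvd_mult_right_iff[OF copi]) simp_all
  then have "M dvd int j * z + m * y * (2 * C 2) + x * ((2 * m)\<^sup>2 * C 3)"
    using j mC2 by (intro dvd_add) simp_all
  then have "M dvd Z - (int j * z + m * y * (2 * C 2) + x * ((2 * m)\<^sup>2 * C 3))"
    using Z by (intro dvd_diff)
  \<comment> \<open>This value is odd for odd m, so the coefficient of \<open>C 2\<close> is prime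
    to M.\<close>
  moreover have "tri (2 * m) = m * (2 * m - 1)" using two_tri[of "2 * m"] by simp
  then have "Z - (int j * z + m * y * (2 * C 2) + x * ((2 * m)\<^sup>2 * C 3)) = (x * m * (2 * m - 1)) * C 2"
    unfolding Z_def by (simp only:) (simp add: algebra_simps)
  ultimately have "M dvd (x * m * (2 * m - 1)) * C 2" by (simp only:)
  moreover have "coprime M (x * m * (2 * m - 1))" using odd by (intro copi) simp
  ultimately have "M dvd C 2" by (simp add: coprime_dvd_mult_right_iff)
  then have "q dvd int j * (int j - 1)" unfolding C2[symmetric] k(1) by simp
  moreover have "2 dvd M" using k(2,3) by simp
  then have "odd (int j - 1)" using dvd_trans[OF _ j, of 2] by simp
  then have "coprime q (int j - 1)" using k(1,2) by simp
  ultimately have "q dvd int j" by (simp add: coprime_dvd_mult_left_iff)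
  then have "q dvd int j * x" by simp
  then show ?thesis using *(2) by (metis diff_add_cancel dvd_add mult.right_neutral)
qed

end

section \<open>Homomorphisms from the triangle group to the class three quotients\<close>

context unip_quotient
begin

text \<open>This homomorphism and the next two send b, a and ab, in this order, to the translation
  by 1, so any of the three can play the part of s in the translation criteria. Binomials enter
  through the one relator whose element has nonzero shift and nonzero translation.\<close>

lemma triangle_hom_shift_translation:
  assumes "q dvd int q0" "q dvd int r" "M dvd int (r choose 2)" "M dvd int (r choose 3)"
  shows "\<exists>F\<in>hom (triangle_group q0 r) quotient.
    F (triangle_gen q0 r gen_a) = coset 1 (0, 0, 0) \<and> F (triangle_gen q0 r gen_b) = coset 0 (1, 0, 0)"
proof -
  have v: "(0, 0, 0) + unip 1 (1, 0, 0) = (1, 1, 0)" by simp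
  show ?thesis
    using assms M_dvd[of "int q0"] M_dvd[of "int r"]
    by (intro triangle_hom_exists) (simp_all only: v sum_unip modulus_iff UNIV_I, simp_all)
qed

lemma triangle_hom_translation_shift:
  assumes "q dvd int q0" "q dvd int r" "M dvd int (r choose 2)" "M dvd int (r choose 3)"
  shows "\<exists>F\<in>hom (triangle_group q0 r) quotient.
    F (triangle_gen q0 r gen_a) = coset 0 (1, 0, 0) \<and> F (triangle_gen q0 r gen_b) = coset 1 (0, 0, 0)"
proof -
  have v: "(1, 0, 0) + unip 0 (0, 0, 0) = (1, 0, 0)" by simp
  show ?thesis
    using assms M_dvd[of "int q0"] M_dvd[of "int r"]
    by (intro triangle_hom_exists) (simp_all only: v sum_unip modulus_iff UNIV_I, simp_all)
qed

lemma triangle_hom_translation_product: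
  assumes "q dvd int q0" "q dvd int r" "M dvd int (q0 choose 2)" "M dvd int (q0 choose 3)"
  shows "\<exists>F\<in>hom (triangle_group q0 r) quotient.
    F (triangle_gen q0 r gen_a) = coset (- 1) (1, 0, 0) \<and> F (triangle_gen q0 r gen_b) = coset 1 (0, 0, 0)"
proof -
  have v: "(1, 0, 0) + unip (- 1) (0, 0, 0) = (1, 0, 0)" by simp
  show ?thesis
    using assms M_dvd[of "int q0"] M_dvd[of "int r"]
    by (intro triangle_hom_exists) (simp_all only: v sum_unip modulus_iff UNIV_I, simp_all)
qed

end

section \<open>A second generating pair for each prime\<close>

context comm_group
begin

lemma int_pow_2: "x \<in> carrier G \<Longrightarrow> x [^] (2::int) = x \<otimes> x"
  using int_pow_mult[of x 1 1] by simp

lemma abelianized_words: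
  assumes "\<alpha> \<in> carrier G" "\<beta> \<in> carrier G"
  shows "\<beta> \<otimes> \<alpha> \<otimes> \<beta> = \<alpha> [^] (1::int) \<otimes> \<beta> [^] (2::int)"
    and "\<alpha> \<otimes> inv \<beta> \<otimes> \<alpha> = \<alpha> [^] (2::int) \<otimes> \<beta> [^] (- 1::int)"
    and "inv \<alpha> \<otimes> inv \<beta> [^] (6::nat) \<otimes> inv \<alpha> = \<alpha> [^] (- 2::int) \<otimes> \<beta> [^] (- 6::int)"
    and "(\<beta> \<otimes> \<alpha> \<otimes> inv \<beta>) \<otimes> inv \<alpha> \<otimes> (inv \<beta> \<otimes> \<alpha> \<otimes> \<beta>) = \<alpha> [^] (1::int) \<otimes> \<beta> [^] (0::int)"
    and "(inv \<alpha> \<otimes> inv \<beta> \<otimes> \<alpha>) \<otimes> \<beta> \<otimes> (\<alpha> \<otimes> inv \<beta> \<otimes> inv \<alpha>) = \<alpha> [^] (0::int) \<otimes> \<beta> [^] (- 1::int)"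
proof -
  have c: "x \<otimes> y \<otimes> inv x = y" "inv x \<otimes> y \<otimes> x = y" if "x \<in> carrier G" "y \<in> carrier G" for x y
    using that m_comm[of x y] m_comm[of "inv x" y] by (simp_all add: m_assoc)
  show "\<beta> \<otimes> \<alpha> \<otimes> \<beta> = \<alpha> [^] (1::int) \<otimes> \<beta> [^] (2::int)"
    using assms by (simp add: int_pow_2 m_ac)
  show "\<alpha> \<otimes> inv \<beta> \<otimes> \<alpha> = \<alpha> [^] (2::int) \<otimes> \<beta> [^] (- 1::int)"
    using assms by (simp add: int_pow_2 int_pow_neg m_ac)
  have "inv \<beta> [^] (6::nat) = \<beta> [^] (- 6::int)"
    using assms int_pow_neg_int[of \<beta> 6] by (simp add: nat_pow_inv)
  then show "inv \<alpha> \<otimes> inv \<beta> [^] (6::nat) \<otimes> inv \<alpha> = \<alpha> [^] (- 2::int) \<otimes> \<beta> [^] (- 6::int)"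
    using assms int_pow_neg[of \<alpha> 2] by (simp add: int_pow_2 inv_mult m_ac)
  show "(\<beta> \<otimes> \<alpha> \<otimes> inv \<beta>) \<otimes> inv \<alpha> \<otimes> (inv \<beta> \<otimes> \<alpha> \<otimes> \<beta>) = \<alpha> [^] (1::int) \<otimes> \<beta> [^] (0::int)"
    using assms by (simp add: c)
  show "(inv \<alpha> \<otimes> inv \<beta> \<otimes> \<alpha>) \<otimes> \<beta> \<otimes> (\<alpha> \<otimes> inv \<beta> \<otimes> inv \<alpha>) = \<alpha> [^] (0::int) \<otimes> \<beta> [^] (- 1::int)"
    using assms by (simp add: c int_pow_neg)
qed

end

locale triangle = group T for T :: "two_gens gword set monoid" (structure) +
  fixes q r :: nat and a b :: "two_gens gword set"
  assumes T_eq: "T = triangle_group q r"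
    and a_eq: "a = triangle_gen q r gen_a" and b_eq: "b = triangle_gen q r gen_b"
begin

lemma gens_closed [simp]: "a \<in> carrier T" "b \<in> carrier T"
  by (simp_all add: T_eq a_eq b_eq)

lemma relations: "a [^] q = \<one>" "b [^] q = \<one>" "(a \<otimes> b) [^] r = \<one>"
  using triangle_relations[of q r] by (simp_all add: T_eq a_eq b_eq)

lemma generate_gens: "generate T {a, b} = carrier T"
  using triangle_generate[of q r] by (simp add: T_eq a_eq b_eq)

lemma pow_eq_one_of_dvd:
  assumes "x \<in> carrier T" "x [^] (n::nat) = \<one>" "n dvd i"
  shows "x [^] i = \<one>"
proof -
  obtain c where "i = n * c" using assms(3) by (elim dvdE)
  then show ?thesis using assms(1,2) nat_pow_pow[of x n c] by simp
qed

text \<open>Exactly what the choice of a second pair must provide, isolated so that the rest is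
  uniform in p. The clause on \<theta> ranges over all endomorphisms inverting a and b, so the pair
  can be found before \<theta> is fixed.\<close>

definition companion :: "nat \<Rightarrow> two_gens gword set \<Rightarrow> two_gens gword set \<Rightarrow> bool" where
  "companion m x y \<longleftrightarrow> x \<in> carrier T \<and> y \<in> carrier T \<and>
     generate T (generate T {x, y} \<union> lower_central T 2) = carrier T \<and>
     (\<forall>\<theta>\<in>hom T T. \<theta> a = inv a \<and> \<theta> b = inv b \<longrightarrow> \<theta> x = inv x \<and> \<theta> y = inv y) \<and>
     (\<forall>s\<in>{a, b, a \<otimes> b}. \<forall>t\<in>{x, y, x \<otimes> y}. \<forall>(i::nat) (j::nat).
        conj_mod (lower_central T m) (s [^] i) (t [^] j) \<longrightarrow> s [^] i = \<one>)"

lemma companionI: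
  assumes "x \<in> carrier T" "y \<in> carrier T"
    and "generate T (generate T {x, y} \<union> lower_central T 2) = carrier T"
    and \<theta>: "\<And>\<theta>. \<theta> \<in> hom T T \<Longrightarrow> \<theta> a = inv a \<Longrightarrow> \<theta> b = inv b \<Longrightarrow> \<theta> x = inv x \<and> \<theta> y = inv y"
    and disj: "\<And>s t i j. s \<in> {a, b, a \<otimes> b} \<Longrightarrow> t \<in> {x, y, x \<otimes> y} \<Longrightarrow>
      conj_mod (lower_central T m) (s [^] (i::nat)) (t [^] (j::nat)) \<Longrightarrow> s [^] i = \<one>"
  shows "companion m x y"
  unfolding companion_def
proof (intro conjI assms(1-3))
  show "\<forall>\<theta>\<in>hom T T. \<theta> a = inv a \<and> \<theta> b = inv b \<longrightarrow> \<theta> x = inv x \<and> \<theta> y = inv y"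
    by (intro ballI impI) (elim conjE, rule \<theta>)
  show "\<forall>s\<in>{a, b, a \<otimes> b}. \<forall>t\<in>{x, y, x \<otimes> y}. \<forall>(i::nat) (j::nat).
      conj_mod (lower_central T m) (s [^] i) (t [^] j) \<longrightarrow> s [^] i = \<one>"
    by (intro ballI allI impI) (rule disj)
qed

lemma companionD:
  assumes "companion m x y"
  shows "x \<in> carrier T" "y \<in> carrier T"
    and "generate T (generate T {x, y} \<union> lower_central T 2) = carrier T"
    and "\<lbrakk>\<theta> \<in> hom T T; \<theta> a = inv a; \<theta> b = inv b\<rbrakk> \<Longrightarrow> \<theta> x = inv x \<and> \<theta> y = inv y"
    and "\<lbrakk>s \<in> {a, b, a \<otimes> b}; t \<in> {x, y, x \<otimes> y}; conj_mod (lower_central T m) (s [^] (i::nat)) (t [^] (j::nat))\<rbrakk>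
      \<Longrightarrow> s [^] i = \<one>"
proof -
  note c = assms[unfolded companion_def]
  show "x \<in> carrier T" by (rule c[THEN conjunct1])
  show "y \<in> carrier T" by (rule c[THEN conjunct2, THEN conjunct1])
  show "generate T (generate T {x, y} \<union> lower_central T 2) = carrier T"
    by (rule c[THEN conjunct2, THEN conjunct2, THEN conjunct1])
  show "\<theta> x = inv x \<and> \<theta> y = inv y" if "\<theta> \<in> hom T T" "\<theta> a = inv a" "\<theta> b = inv b"
    using bspec[OF c[THEN conjunct2, THEN conjunct2, THEN conjunct2, THEN conjunct1] that(1)] that(2,3) by (simp only: simp_thms)
  show "s [^] i = \<one>" if "s \<in> {a, b, a \<otimes> b}" "t \<in> {x, y, x \<otimes> y}"
    "conj_mod (lower_central T m) (s [^] i) (t [^] j)"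
    using bspec[OF bspec[OF c[THEN conjunct2, THEN conjunct2, THEN conjunct2, THEN conjunct2] that(1)] that(2)] that(3)
    by iprover
qed

lemma generate_of_abelianized_exponents:
  assumes "x \<in> carrier T" "y \<in> carrier T" "coprime (s1 * t2 - s2 * t1) (int q)"
    and "\<And>(A :: two_gens gword set set monoid) \<pi>. comm_group A \<Longrightarrow> group_hom T A \<pi> \<Longrightarrow> \<pi> x = \<pi> a [^]\<^bsub>A\<^esub> s1 \<otimes>\<^bsub>A\<^esub> \<pi> b [^]\<^bsub>A\<^esub> s2 \<and>
      \<pi> y = \<pi> a [^]\<^bsub>A\<^esub> t1 \<otimes>\<^bsub>A\<^esub> \<pi> b [^]\<^bsub>A\<^esub> t2"
  shows "generate T (generate T {x, y} \<union> lower_central T 2) = carrier T"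
  using assms(4)[OF comm_group_abelianization group_hom_r_coset[OF lower_central_normal[of 2]]]
  by (intro generate_of_coprime_exponents[OF gens_closed generate_gens relations(1,2) assms(1-3)]) auto

text \<open>Since N lies in the m-th term, conjugacy modulo N passes up to that term, where the
  companion property applies.\<close>

lemma layer_strongly_real:
  assumes p: "Factorial_Ring.prime p" "q = p ^ k" and m: "m \<ge> 2" "companion m x y"
    and N: "subgroup N T" "lower_central T (Suc n) \<subseteq> N" "N \<subseteq> lower_central T n" "n \<ge> m"
  shows "strongly_real_Beauville_group (T Mod N)"
proof -
  have n: "n \<ge> 1" using m N by simp
  have NT: "N \<lhd> T" by (rule layer_subgroup_normal[OF n N(1-3)])
  have "finite (rcosets (lower_central T (Suc n)))"
    using finite_rcosets_lower_central[OF p(1) gens_closed generate_gens] relations p(2) by simp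
  then have fin: "finite (carrier (T Mod N))"
    by (rule finite_Mod[OF _ lower_central_subgroup NT N(2)])
  have "\<exists>\<theta>\<in>hom T T. \<theta> a = inv a \<and> \<theta> b = inv b \<and> (\<forall>x\<in>carrier T. \<theta> (\<theta> x) = x)"
    using triangle_inversion_exists[of q r, folded T_eq a_eq b_eq] .
  then obtain \<theta> where \<theta>0: "\<theta> \<in> hom T T"
    "\<theta> a = inv a \<and> \<theta> b = inv b \<and> (\<forall>x\<in>carrier T. \<theta> (\<theta> x) = x)" by (elim bexE)
  have \<theta>: "\<theta> \<in> hom T T" "\<theta> a = inv a" "\<theta> b = inv b"
    and invol: "\<And>x. x \<in> carrier T \<Longrightarrow> \<theta> (\<theta> x) = x" using \<theta>0 by simp_all
  have xy: "x \<in> carrier T" "y \<in> carrier T"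
    "generate T (generate T {x, y} \<union> lower_central T 2) = carrier T"
    "\<theta> x = inv x" "\<theta> y = inv y"
    using companionD[OF m(2)] \<theta> by simp_all
  have NK: "N \<subseteq> lower_central T m" using N(3) lower_central_antimono[OF N(4)] by blast
  show ?thesis
  proof (rule strongly_real_Beauville_quotient[OF NT fin N(2) _ gens_closed generate_gens xy(1-3)
        \<theta>(1) invol _ \<theta>(2,3) xy(4,5)])
    show "\<theta> g \<in> N" if "g \<in> N" for g
      by (rule hom_layer_subgroup[OF \<theta>(1-3) gens_closed generate_gens n N(1-3) that])
    show "s [^] i = \<one>" if st: "s \<in> {a, b, a \<otimes> b}" "t \<in> {x, y, x \<otimes> y}"
      and conj: "conj_mod N (s [^] i) (t [^] j)" for s t and i j :: nat
    proof -
      have "s \<in> carrier T" "t \<in> carrier T" using st xy(1,2) by auto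
      then have "conj_mod (lower_central T m) (s [^] i) (t [^] j)"
        using conj_mod_mono[OF conj N(1) lower_central_subgroup NK] by simp
      then show ?thesis by (rule companionD(5)[OF m(2) st])
    qed
  qed (use n m N in simp_all)
qed

lemma unip_hom_lower_central:
  assumes "unip_quotient d M" "F \<in> hom T (int_action.quotient unip UNIV (unip_quotient.modulus d M) d)"
    and "n \<ge> 4 \<or> M = 1 \<and> n \<ge> 2"
  shows "unip_hom d M T F (lower_central T n)"
proof -
  interpret unip_quotient d M by fact
  show ?thesis
    using hom_kills_lower_central[OF assms(2) is_group _ assms(3)]
    by (intro unip_hom.intro unip_hom_axioms.intro assms is_group lower_central_subgroup) blast
qed

text \<open>The exponent vectors of x, y, xy are (1, 2), (-2, -6), (-1, -4), with slopes 2, 3, 4,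
  against 0, infinity, 1 for a, b, ab. The exponent 6 compensates the two letters a of the
  palindrome. All nine determinants, and the determinant -2 of the pair itself, involve only the
  primes 2 and 3.\<close>

lemma companion_ge_5:
  assumes p: "Factorial_Ring.prime p" "p > 3" "q = p ^ k" "r = q"
  shows "companion 3 (b \<otimes> a \<otimes> b) (inv a \<otimes> inv b [^] (6::nat) \<otimes> inv a)"
proof -
  define x where "x = b \<otimes> a \<otimes> b"
  define y where "y = inv a \<otimes> inv b [^] (6::nat) \<otimes> inv a"
  have xy: "x \<in> carrier T" "y \<in> carrier T" by (simp_all add: x_def y_def)
  have cop: "coprime 2 (int q)" "coprime 3 (int q)"
    using p primes_coprime[OF p(1) two_is_prime_nat] primes_coprime[of p 3]
    by (simp_all add: coprime_commute coprime_int_iff[symmetric] del: coprime_int_iff) 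
  then have cops: "coprime 4 (int q)" "coprime 6 (int q)"
    using coprime_mult_left_iff[of 2 2 "int q"] coprime_mult_left_iff[of 2 3 "int q"] by simp_all
  interpret U: unip_quotient "int q" 1 by unfold_locales simp_all
  obtain F where F: "F \<in> hom T U.quotient" "F a = U.coset 1 (0, 0, 0)" "F b = U.coset 0 (1, 0, 0)"
    using U.triangle_hom_shift_translation[of q r] p(4) by (auto simp: T_eq a_eq b_eq)
  interpret H: unip_hom "int q" 1 T F "lower_central T 3"
    by (rule unip_hom_lower_central[OF U.unip_quotient_axioms F(1)]) simp
  interpret F: group_hom T U.quotient F
    using F(1) by (simp add: group_hom_def group_hom_axioms_def U.coset.H.is_group)
  have inv_F: "F (inv a) = U.coset (- 1) (0, 0, 0)" "F (inv b) = U.coset 0 (- 1, 0, 0)"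
    by (simp_all add: F U.coset_inv)
  have Fs: "F (a \<otimes> b) = U.coset 1 (1, 1, 0)" by (simp add: F U.coset_mult)
  have pow6: "U.coset 0 (- 1, 0, 0) [^]\<^bsub>U.quotient\<^esub> (6::nat) = U.coset 0 (- 6, 0, 0)"
    unfolding U.coset_pow[OF UNIV_I] U.sum_unip by simp
  have Ft: "F x = U.coset 1 (2, 1, 0)" "F y = U.coset (- 2) (- 6, 6, - 6)"
    "F (x \<otimes> y) = U.coset (- 1) (- 4, 1, 0)"
    by (simp_all add: x_def y_def F inv_F F.hom_nat_pow pow6 U.coset_mult U.coset_inv tri_def del: F.hom_inv)
  have div: "int q dvd int i"
    if s: "s \<in> {a, b, a \<otimes> b}" and t: "t \<in> {x, y, x \<otimes> y}"
      and conj: "conj_mod (lower_central T 3) (s [^] i) (t [^] j)" for s t and i j :: nat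
  proof -
    consider "s = a" "t = x" | "s = a" "t = y" | "s = a" "t = x \<otimes> y" |
      "s = b" "t = x" | "s = b" "t = y" | "s = b" "t = x \<otimes> y" |
      "s = a \<otimes> b" "t = x" | "s = a \<otimes> b" "t = y" | "s = a \<otimes> b" "t = x \<otimes> y"
      using s t by (elim insertE emptyE) (erule (1) that)+
    then show ?thesis
    proof cases
      case 1
      then show ?thesis using H.conj_mod_det[OF _ F(2) _ Ft(1), of i j] conj xy cop cops by simp
    next
      case 2
      then show ?thesis using H.conj_mod_det[OF _ F(2) _ Ft(2), of i j] conj xy cop cops by simp
    next
      case 3
      then show ?thesis using H.conj_mod_det[OF _ F(2) _ Ft(3), of i j] conj xy cop cops by simp
    next
      case 4
      then show ?thesis using H.conj_mod_det[OF _ F(3) _ Ft(1), of i j] conj xy cop cops by simp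
    next
      case 5
      then show ?thesis using H.conj_mod_det[OF _ F(3) _ Ft(2), of i j] conj xy cop cops by simp
    next
      case 6
      then show ?thesis using H.conj_mod_det[OF _ F(3) _ Ft(3), of i j] conj xy cop cops by simp
    next
      case 7
      then show ?thesis using H.conj_mod_det[OF _ Fs _ Ft(1), of i j] conj xy cop cops by simp
    next
      case 8
      then show ?thesis using H.conj_mod_det[OF _ Fs _ Ft(2), of i j] conj xy cop cops by simp
    next
      case 9
      then show ?thesis using H.conj_mod_det[OF _ Fs _ Ft(3), of i j] conj xy cop cops by simp
    qed
  qed
  have disj: "s [^] i = \<one>"
    if "s \<in> {a, b, a \<otimes> b}" "t \<in> {x, y, x \<otimes> y}" "conj_mod (lower_central T 3) (s [^] i) (t [^] j)"
    for s t and i j :: nat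
    using that(1) div[OF that] relations p(4) pow_eq_one_of_dvd[of _ q i] by auto
  have gen: "generate T (generate T {x, y} \<union> lower_central T 2) = carrier T"
  proof (rule generate_of_abelianized_exponents[OF xy])
    show "coprime (1 * (- 6) - 2 * (- 2)) (int q)" using cop by simp
    fix A :: "two_gens gword set set monoid" and \<pi> assume "comm_group A" "group_hom T A \<pi>"
    then interpret \<pi>: group_hom T A \<pi> by simp
    interpret A: comm_group A by fact
    show "\<pi> x = \<pi> a [^]\<^bsub>A\<^esub> (1::int) \<otimes>\<^bsub>A\<^esub> \<pi> b [^]\<^bsub>A\<^esub> (2::int) \<and>
        \<pi> y = \<pi> a [^]\<^bsub>A\<^esub> (- 2::int) \<otimes>\<^bsub>A\<^esub> \<pi> b [^]\<^bsub>A\<^esub> (- 6::int)"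
      using A.abelianized_words(1,3)[of "\<pi> a" "\<pi> b"] by (simp add: x_def y_def \<pi>.hom_nat_pow)
  qed
  have real: "\<theta> x = inv x \<and> \<theta> y = inv y" if "\<theta> \<in> hom T T" "\<theta> a = inv a" "\<theta> b = inv b" for \<theta>
  proof -
    interpret \<theta>: group_hom T T \<theta> using that(1) by unfold_locales
    have "inv (b [^] (6::nat)) = inv b [^] (6::nat)" by (simp add: nat_pow_inv)
    then show ?thesis
      using that by (simp add: x_def y_def inv_mult_group m_assoc \<theta>.hom_nat_pow nat_pow_inv)
  qed
  have "companion 3 x y" by (rule companionI[OF xy gen real disj])
  then show ?thesis by (simp only: x_def y_def)
qed

text \<open>In 6 C(i, 3) = i(i - 1)(i - 2) the last two factors are prime to 3 because 3 divides i.
  After cancelling d, the factor 3 of the left side must divide i/d.\<close>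

lemma dvd_3_of_choose_3:
  assumes "3 dvd d" "d > 0" "d dvd i" "d dvd (i choose 3)"
  shows "3 * d dvd i"
proof -
  obtain c where c: "i = d * c" using assms(3) by (elim dvdE)
  obtain e where e: "i choose 3 = d * e" using assms(4) by (elim dvdE)
  have ci: "int i = int d * int c" by (simp add: c)
  have "int d * (6 * int e) = 6 * int (i choose 3)" by (simp add: e)
  also have "\<dots> = int i * (int i - 1) * (int i - 2)" by (rule six_choose_3)
  also have "\<dots> = int d * (int c * (int i - 1) * (int i - 2))" by (subst (1) ci) (simp only: mult.assoc)
  finally have "int d * (6 * int e) = int d * (int c * (int i - 1) * (int i - 2))" .
  then have "6 * int e = int c * (int i - 1) * (int i - 2)" using assms(2) by simp
  moreover have "3 dvd 6 * int e" by simp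
  ultimately have "3 dvd int c * (int i - 1) * (int i - 2)" by (simp only:)
  moreover have "3 dvd int i" using assms(1,3) by (metis dvd_trans int_dvd_int_iff of_nat_numeral)
  then have "\<not> 3 dvd int i - 1" "\<not> 3 dvd int i - 2" by presburger+
  ultimately have "3 dvd int c" by (simp add: prime_dvd_mult_iff)
  then have "3 dvd c" by presburger
  then show ?thesis by (simp add: c mult.commute)
qed

text \<open>In the abelianization x is a and y is the inverse of b, so xy takes the fourth line and
  only the comparisons of a with x and of b with y degenerate. There the three conjugates in x add
  up to (1 + t) - 1 + (1 + t)^(-1) = 1 + t^2, and those in y to its negative; the unit coefficient
  of t^2 separates them. For s = ab the determinants only give q dvd i, while the order needs 3q,
  and the cubic binomials supply the rest.\<close>

lemma companion_3:
  assumes q: "q = 3 ^ k" "k \<ge> 1" "r = 3 ^ (k + 1)"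
  shows "companion 4 ((b \<otimes> a \<otimes> inv b) \<otimes> inv a \<otimes> (inv b \<otimes> a \<otimes> b))
    ((inv a \<otimes> inv b \<otimes> a) \<otimes> b \<otimes> (a \<otimes> inv b \<otimes> inv a))"
proof -
  define x where "x = (b \<otimes> a \<otimes> inv b) \<otimes> inv a \<otimes> (inv b \<otimes> a \<otimes> b)"
  define y where "y = (inv a \<otimes> inv b \<otimes> a) \<otimes> b \<otimes> (a \<otimes> inv b \<otimes> inv a)"
  have xy: "x \<in> carrier T" "y \<in> carrier T" by (simp_all add: x_def y_def)
  have odd: "odd (int q)" using q by simp
  have r: "r = 3 * q" using q by simp
  have q3: "3 dvd q" "q > 0" using q by (simp_all add: dvd_power)
  interpret U: unip_quotient "int q" "int q"
    by unfold_locales (use odd_dvd_tri[OF odd] in simp_all)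
  have C2: "int q dvd int (r choose 2)" using odd_dvd_choose_2[OF odd] r by simp
  have "3 * (2 * int (r choose 3)) = 3 * (int q * ((3 * int q - 1) * (3 * int q - 2)))"
    using six_choose_3[of r] by (simp add: r)
  then have "int q dvd 2 * int (r choose 3)" by simp
  then have C3: "int q dvd int (r choose 3)" using odd by (simp add: coprime_dvd_mult_right_iff)
  obtain F1 where F1: "F1 \<in> hom T U.quotient" "F1 a = U.coset 1 (0, 0, 0)" "F1 b = U.coset 0 (1, 0, 0)"
    using U.triangle_hom_shift_translation[of q r] C2 C3 r by (auto simp: T_eq a_eq b_eq)
  obtain F2 where F2: "F2 \<in> hom T U.quotient" "F2 a = U.coset 0 (1, 0, 0)" "F2 b = U.coset 1 (0, 0, 0)"
    using U.triangle_hom_translation_shift[of q r] C2 C3 r by (auto simp: T_eq a_eq b_eq)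
  interpret H1: unip_hom "int q" "int q" T F1 "lower_central T 4"
    by (rule unip_hom_lower_central[OF U.unip_quotient_axioms F1(1)]) simp
  interpret H2: unip_hom "int q" "int q" T F2 "lower_central T 4"
    by (rule unip_hom_lower_central[OF U.unip_quotient_axioms F2(1)]) simp
  interpret F1: group_hom T U.quotient F1
    using F1(1) by (simp add: group_hom_def group_hom_axioms_def U.coset.H.is_group)
  interpret F2: group_hom T U.quotient F2
    using F2(1) by (simp add: group_hom_def group_hom_axioms_def U.coset.H.is_group)
  have F1s: "F1 (a \<otimes> b) = U.coset 1 (1, 1, 0)" "F1 x = U.coset 1 (0, 0, 0)"
    "F1 y = U.coset 0 (- 1, 0, - 1)" "F1 (x \<otimes> y) = U.coset 1 (- 1, - 1, - 1)"
    by (simp_all add: x_def y_def F1 U.coset_mult U.coset_inv)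
  have F2s: "F2 (a \<otimes> b) = U.coset 1 (1, 0, 0)" "F2 x = U.coset 0 (1, 0, 1)"
    "F2 y = U.coset (- 1) (0, 0, 0)" "F2 (x \<otimes> y) = U.coset (- 1) (1, 0, 1)"
    by (simp_all add: x_def y_def F2 U.coset_mult U.coset_inv)
  let ?K = "lower_central T 4"
  have disj: "s [^] i = \<one>"
    if s: "s \<in> {a, b, a \<otimes> b}" and t: "t \<in> {x, y, x \<otimes> y}"
      and conj: "conj_mod ?K (s [^] i) (t [^] j)" for s t and i j :: nat
  proof -
    have det: "int q dvd int i \<and> int q dvd int j"
      if indep: "s = a \<and> t \<in> {y, x \<otimes> y} \<or> s = b \<and> t \<in> {x, x \<otimes> y} \<or> s = a \<otimes> b"
    proof -
      consider "s = a" "t = y" | "s = a" "t = x \<otimes> y" | "s = b" "t = x" | "s = b" "t = x \<otimes> y" |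
        "s = a \<otimes> b" "t = x" | "s = a \<otimes> b" "t = y" | "s = a \<otimes> b" "t = x \<otimes> y"
        using t indep by (elim disjE conjE insertE emptyE) (erule (1) that)+
      then show ?thesis
      proof cases
        case 1
        then show ?thesis using H1.conj_mod_det[OF _ F1(2) _ F1s(3), of i j] conj xy by simp
      next
        case 2
        then show ?thesis using H1.conj_mod_det[OF _ F1(2) _ F1s(4), of i j] conj xy by simp
      next
        case 3
        then show ?thesis using H1.conj_mod_det[OF _ F1(3) _ F1s(2), of i j] conj xy by simp
      next
        case 4
        then show ?thesis using H1.conj_mod_det[OF _ F1(3) _ F1s(4), of i j] conj xy by simp
      next
        case 5
        then show ?thesis using H1.conj_mod_det[OF _ F1s(1) _ F1s(2), of i j] conj xy by simp
      next
        case 6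
        then show ?thesis using H1.conj_mod_det[OF _ F1s(1) _ F1s(3), of i j] conj xy by simp
      next
        case 7
        then show ?thesis using H1.conj_mod_det[OF _ F1s(1) _ F1s(4), of i j] conj xy odd by simp
      qed
    qed
    consider "s = a" | "s = b" | "s = a \<otimes> b"
      using s by (elim insertE emptyE) (erule that)+
    then show ?thesis
    proof cases
      case 1
      have "int q dvd int i"
      proof (cases "t = x")
        case True
        show ?thesis
          using H2.conj_mod_translation_odd[OF odd HOL.refl _ F2(2) _ F2s(2), of i j] 1 True conj xy by simp
      next
        case False
        then have "t \<in> {y, x \<otimes> y}" using t by (elim insertE) simp_all
        then show ?thesis using det 1 by simp
      qed
      then show ?thesis using 1 relations pow_eq_one_of_dvd[of a q i] by simp
    next
      case 2
      have "int q dvd int i"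
      proof (cases "t = y")
        case True
        show ?thesis
          using H1.conj_mod_translation_odd[OF odd HOL.refl _ F1(3) _ F1s(3), of i j] 2 True conj xy by simp
      next
        case False
        then have "t \<in> {x, x \<otimes> y}" using t by (elim insertE) simp_all
        then show ?thesis using det 2 by simp
      qed
      then show ?thesis using 2 relations pow_eq_one_of_dvd[of b q i] by simp
    next
      case 3
      have ij: "int q dvd int i" "int q dvd int j" using det 3 by simp_all
      have tc: "t \<in> carrier T" using t xy by (elim insertE) simp_all
      have cub1: "int q dvd 1\<^sup>2 * 1 * int (i choose 3) - n\<^sup>2 * u * int (j choose 3)"
        if "F1 t = U.coset n (u, v, w)" for n u v w
        using H1.conj_mod_cubic[OF odd HOL.refl _ F1s(1) tc that _ ij] conj 3 by simp
      have cub2: "int q dvd 1\<^sup>2 * 1 * int (i choose 3) - n\<^sup>2 * u * int (j choose 3)"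
        if "F2 t = U.coset n (u, v, w)" for n u v w
        using H2.conj_mod_cubic[OF odd HOL.refl _ F2s(1) tc that _ ij] conj 3 by simp
      have "int q dvd int (i choose 3)"
      proof -
        consider "t = x" | "t = y" | "t = x \<otimes> y"
          using t by (elim insertE emptyE) (erule that)+
        then show ?thesis
        proof cases
          case 1
          then show ?thesis using cub1[of 1 0 0 0] F1s(2) by simp
        next
          case 2
          then show ?thesis using cub1[of 0 "- 1" 0 "- 1"] F1s(3) by simp
        next
          case 3
          \<comment> \<open>For t = xy one homomorphism is not enough: the cubic term of t has
            opposite signs under \<open>F1\<close> and \<open>F2\<close>, and adding the two
            congruences eliminates j.\<close>
          have "int q dvd int (i choose 3) + int (j choose 3)" "int q dvd int (i choose 3) - int (j choose 3)"
            using cub1[of 1 "- 1" "- 1" "- 1"] cub2[of "- 1" 1 0 1] 3 F1s(4) F2s(4) by simp_all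
          from dvd_add[OF this] have "int q dvd 2 * int (i choose 3)" by simp
          then show ?thesis using odd by (simp add: coprime_dvd_mult_right_iff)
        qed
      qed
      then have "3 * q dvd i" using dvd_3_of_choose_3[OF q3] ij(1) by simp
      then show ?thesis using 3 relations(3) pow_eq_one_of_dvd[of "a \<otimes> b" r i] r by simp
    qed
  qed
  have gen: "generate T (generate T {x, y} \<union> lower_central T 2) = carrier T"
  proof (rule generate_of_abelianized_exponents[OF xy])
    show "coprime (1 * (- 1) - 0 * 0) (int q)" by simp
    fix A :: "two_gens gword set set monoid" and \<pi> assume "comm_group A" "group_hom T A \<pi>"
    then interpret \<pi>: group_hom T A \<pi> by simp
    interpret A: comm_group A by fact
    show "\<pi> x = \<pi> a [^]\<^bsub>A\<^esub> (1::int) \<otimes>\<^bsub>A\<^esub> \<pi> b [^]\<^bsub>A\<^esub> (0::int) \<and>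
        \<pi> y = \<pi> a [^]\<^bsub>A\<^esub> (0::int) \<otimes>\<^bsub>A\<^esub> \<pi> b [^]\<^bsub>A\<^esub> (- 1::int)"
      using A.abelianized_words(4,5)[of "\<pi> a" "\<pi> b"] by (simp add: x_def y_def)
  qed
  have real: "\<theta> x = inv x \<and> \<theta> y = inv y" if "\<theta> \<in> hom T T" "\<theta> a = inv a" "\<theta> b = inv b" for \<theta>
  proof -
    interpret \<theta>: group_hom T T \<theta> using that(1) by unfold_locales
    show ?thesis using that by (simp add: x_def y_def inv_mult_group m_assoc)
  qed
  have "companion 4 x y" by (rule companionI[OF xy gen real disj])
  then show ?thesis by (simp only: x_def y_def)
qed

text \<open>Modulo 2 the three lines are exhausted by a, b, ab, so x, y, xy collide with them one by
  one. In each collision the homomorphism making s a translation gives t an even shift 2m and an odd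
  constant term, with m odd. The other six determinants are 1, -1 or -3, and that of the pair is -5,
  all odd.\<close>

lemma companion_2:
  assumes q: "q = 2 ^ k" "q > 2" "r = q"
  shows "companion 4 (b \<otimes> a \<otimes> b) (a \<otimes> inv b \<otimes> a)"
proof -
  define x where "x = b \<otimes> a \<otimes> b"
  define y where "y = a \<otimes> inv b \<otimes> a"
  have xy: "x \<in> carrier T" "y \<in> carrier T" by (simp_all add: x_def y_def)
  \<comment> \<open>Half of q, the modulus permitted for the higher coefficients when q is
    even.\<close>
  define M :: int where "M = 2 ^ (k - 1)"
  have k: "k \<ge> 2"
  proof (rule ccontr)
    assume "\<not> k \<ge> 2"
    then have "k = 0 \<or> k = 1" by auto
    then show False using q by auto
  qed
  have qM: "int q = 2 * M" using k by (cases k) (simp_all add: q(1) M_def)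
  have M: "int q = 2 * M" "M = 2 ^ (k - 1)" "k - 1 \<ge> 1" using qM k by (simp_all add: M_def)
  have cop: "coprime 3 (int q)" "coprime M 3" by (simp_all add: q(1) M_def)
  interpret U: unip_quotient "int q" M
    by unfold_locales (use two_tri[of "int q"] qM in simp_all)
  have C2: "M dvd int (q choose 2)" using two_choose_2[of q] qM by simp
  have "3 * int (q choose 3) = M * ((int q - 1) * (int q - 2))"
    using six_choose_3[of q] by (simp add: qM)
  then have "M dvd 3 * int (q choose 3)" by (simp only: dvd_triv_left)
  then have C3: "M dvd int (q choose 3)" using cop(2) by (simp only: coprime_dvd_mult_right_iff)
  obtain F1 where F1: "F1 \<in> hom T U.quotient" "F1 a = U.coset 1 (0, 0, 0)" "F1 b = U.coset 0 (1, 0, 0)"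
    using U.triangle_hom_shift_translation[of q r] C2 C3 q(3) by (auto simp: T_eq a_eq b_eq)
  obtain F2 where F2: "F2 \<in> hom T U.quotient" "F2 a = U.coset 0 (1, 0, 0)" "F2 b = U.coset 1 (0, 0, 0)"
    using U.triangle_hom_translation_shift[of q r] C2 C3 q(3) by (auto simp: T_eq a_eq b_eq)
  obtain F3 where F3: "F3 \<in> hom T U.quotient" "F3 a = U.coset (- 1) (1, 0, 0)" "F3 b = U.coset 1 (0, 0, 0)"
    using U.triangle_hom_translation_product[of q r] C2 C3 q(3) by (auto simp: T_eq a_eq b_eq)
  interpret H1: unip_hom "int q" M T F1 "lower_central T 4"
    by (rule unip_hom_lower_central[OF U.unip_quotient_axioms F1(1)]) simp
  interpret H2: unip_hom "int q" M T F2 "lower_central T 4"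
    by (rule unip_hom_lower_central[OF U.unip_quotient_axioms F2(1)]) simp
  interpret H3: unip_hom "int q" M T F3 "lower_central T 4"
    by (rule unip_hom_lower_central[OF U.unip_quotient_axioms F3(1)]) simp
  interpret F1: group_hom T U.quotient F1
    using F1(1) by (simp add: group_hom_def group_hom_axioms_def U.coset.H.is_group)
  interpret F2: group_hom T U.quotient F2
    using F2(1) by (simp add: group_hom_def group_hom_axioms_def U.coset.H.is_group)
  interpret F3: group_hom T U.quotient F3
    using F3(1) by (simp add: group_hom_def group_hom_axioms_def U.coset.H.is_group)
  have F1s: "F1 (a \<otimes> b) = U.coset 1 (1, 1, 0)" "F1 x = U.coset 1 (2, 1, 0)"
    "F1 y = U.coset 2 (- 1, - 1, 0)" "F1 (x \<otimes> y) = U.coset 3 (1, - 1, - 1)"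
    by (simp_all add: x_def y_def F1 U.coset_mult U.coset_inv tri_def)
  have Ft1: "F1 y = U.coset (2 * 1) (- 1, - 1, 0)" by (simp add: F1s)
  have Ft2: "F2 x = U.coset (2 * 1) (1, 1, 0)"
    by (simp add: x_def F2 U.coset_mult U.coset_inv tri_def)
  have F3s: "F3 (a \<otimes> b) = U.coset 0 (1, 0, 0)"
    by (simp add: F3 U.coset_mult U.coset_inv tri_def)
  have Ft3: "F3 (x \<otimes> y) = U.coset (2 * (- 1)) (3, 1, 1)"
    by (simp add: x_def y_def F3 U.coset_mult U.coset_inv tri_def)
  have div: "int q dvd int i"
    if s: "s \<in> {a, b, a \<otimes> b}" and t: "t \<in> {x, y, x \<otimes> y}"
      and conj: "conj_mod (lower_central T 4) (s [^] i) (t [^] j)" for s t and i j :: nat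
  proof -
    consider "s = a" "t = x" | "s = a" "t = y" | "s = a" "t = x \<otimes> y" |
      "s = b" "t = x" | "s = b" "t = y" | "s = b" "t = x \<otimes> y" |
      "s = a \<otimes> b" "t = x" | "s = a \<otimes> b" "t = y" | "s = a \<otimes> b" "t = x \<otimes> y"
      using s t by (elim insertE emptyE) (erule (1) that)+
    then show ?thesis
    proof cases
      case 1
      then show ?thesis using H2.conj_mod_translation_even[OF M _ F2(2) _ Ft2(1), of i j] conj 1 xy by simp
    next
      case 2
      then show ?thesis using H1.conj_mod_det[OF _ F1(2) _ F1s(3), of i j] conj xy cop by simp
    next
      case 3
      then show ?thesis using H1.conj_mod_det[OF _ F1(2) _ F1s(4), of i j] conj xy cop by simp
    next
      case 4
      then show ?thesis using H1.conj_mod_det[OF _ F1(3) _ F1s(2), of i j] conj xy cop by simp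
    next
      case 5
      then show ?thesis using H1.conj_mod_translation_even[OF M _ F1(3) _ Ft1(1), of i j] conj 5 xy by simp
    next
      case 6
      then show ?thesis using H1.conj_mod_det[OF _ F1(3) _ F1s(4), of i j] conj xy cop by simp
    next
      case 7
      then show ?thesis using H1.conj_mod_det[OF _ F1s(1) _ F1s(2), of i j] conj xy cop by simp
    next
      case 8
      then show ?thesis using H1.conj_mod_det[OF _ F1s(1) _ F1s(3), of i j] conj xy cop by simp
    next
      case 9
      then show ?thesis using H3.conj_mod_translation_even[OF M _ F3s(1) _ Ft3(1), of i j] conj 9 xy by simp
    qed
  qed
  have disj: "s [^] i = \<one>"
    if "s \<in> {a, b, a \<otimes> b}" "t \<in> {x, y, x \<otimes> y}" "conj_mod (lower_central T 4) (s [^] i) (t [^] j)"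
    for s t and i j :: nat
    using that(1) div[OF that] relations q(3) pow_eq_one_of_dvd[of _ q i] by auto
  have gen: "generate T (generate T {x, y} \<union> lower_central T 2) = carrier T"
  proof (rule generate_of_abelianized_exponents[OF xy])
    have "coprime 5 (int q)" by (simp add: q(1))
    then show "coprime (1 * (- 1) - 2 * 2) (int q)" by simp
    fix A :: "two_gens gword set set monoid" and \<pi> assume "comm_group A" "group_hom T A \<pi>"
    then interpret \<pi>: group_hom T A \<pi> by simp
    interpret A: comm_group A by fact
    show "\<pi> x = \<pi> a [^]\<^bsub>A\<^esub> (1::int) \<otimes>\<^bsub>A\<^esub> \<pi> b [^]\<^bsub>A\<^esub> (2::int) \<and>
        \<pi> y = \<pi> a [^]\<^bsub>A\<^esub> (2::int) \<otimes>\<^bsub>A\<^esub> \<pi> b [^]\<^bsub>A\<^esub> (- 1::int)"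
      using A.abelianized_words(1,2)[of "\<pi> a" "\<pi> b"] by (simp add: x_def y_def)
  qed
  have real: "\<theta> x = inv x \<and> \<theta> y = inv y" if "\<theta> \<in> hom T T" "\<theta> a = inv a" "\<theta> b = inv b" for \<theta>
  proof -
    interpret \<theta>: group_hom T T \<theta> using that(1) by unfold_locales
    show ?thesis using that by (simp add: x_def y_def inv_mult_group m_assoc)
  qed
  have "companion 4 x y" by (rule companionI[OF xy gen real disj])
  then show ?thesis by (simp only: x_def y_def)
qed

end

section \<open>The refined series\<close>

theorem theoremA:
  fixes p k q r m :: nat and T :: "two_gens gword set monoid"
  assumes "Factorial_Ring.prime p" and "k \<ge> 1" and "q = p ^ k" and "q > 2"
    and "r = (if p = 3 then p ^ (k + 1) else p ^ k)"
    and "T = triangle_group q r"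
    and "m = (if p > 3 then 3 else 4)"
  shows "(\<forall>n\<ge>m. strongly_real_Beauville_group (T Mod lower_central T n)) \<and>
    (\<exists>N :: nat \<Rightarrow> two_gens gword set set.
      N 0 = lower_central T m \<and>
      (\<forall>n\<ge>m. \<exists>i. N i = lower_central T n) \<and>
      (\<forall>i. \<exists>n\<ge>m. lower_central T (n + 1) \<subseteq> N i \<and> N i \<subseteq> lower_central T n) \<and>
      (\<forall>i. N i \<lhd> T) \<and>
      (\<forall>i. N (Suc i) \<subseteq> N i \<and> card (rcosets\<^bsub>T\<lparr>carrier := N i\<rparr>\<^esub> N (Suc i)) = p) \<and>
      (\<forall>i. strongly_real_Beauville_group (T Mod N i)))"
proof -
  define a where "a = triangle_gen q r gen_a"
  define b where "b = triangle_gen q r gen_b"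
  interpret triangle T q r a b
    by (intro triangle.intro triangle_axioms.intro) (simp_all add: assms(6) group_triangle_group a_def b_def)
  have "p \<ge> 2" using assms(1) by (rule prime_ge_2_nat)
  then consider "p = 2" | "p = 3" | "p > 3" by linarith
  then have "\<exists>x y. companion m x y"
  proof cases
    case 1
    then have e: "m = 4" "q = 2 ^ k" "r = q" using assms by simp_all
    show ?thesis unfolding e(1) by (intro exI, rule companion_2[OF e(2) assms(4) e(3)])
  next
    case 2
    then have e: "m = 4" "q = 3 ^ k" "r = 3 ^ (k + 1)" using assms by simp_all
    show ?thesis unfolding e(1) by (intro exI, rule companion_3[OF e(2) assms(2) e(3)])
  next
    case 3
    then have e: "m = 3" "r = q" using assms by simp_all
    show ?thesis unfolding e(1) by (intro exI, rule companion_ge_5[OF assms(1) 3 assms(3) e(2)])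
  qed
  then obtain x y where xy: "companion m x y" by (elim exE)
  have m: "m \<ge> 3" using assms(7) by simp
  have layer: "strongly_real_Beauville_group (T Mod N)"
    if "subgroup N T" "lower_central T (Suc n) \<subseteq> N" "N \<subseteq> lower_central T n" "n \<ge> m" for N n
    using layer_strongly_real[OF assms(1,3) _ xy that] m by simp
  \<comment> \<open>Strictness of the series excludes the empty path, as required for a sequence
    that passes through every term.\<close>
  have "(layer_step T p)\<^sup>+\<^sup>+ (lower_central T (m + n)) (lower_central T (m + Suc n))" for n
  proof -
    have "q dvd r" using assms(3,5) by simp
    then have "lower_central T (m + n) \<noteq> lower_central T (Suc (m + n))"
      using triangle_lower_central_strict[OF assms(1,3,4), of r "m + n"] m by (simp add: assms(6))
    moreover have "(layer_step T p)\<^sup>*\<^sup>* (lower_central T (m + n)) (lower_central T (Suc (m + n)))"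
      using layer_steps_lower_central[OF assms(1) _ gens_closed generate_gens, of "m + n" k] relations m
      by (simp add: assms(3))
    ultimately show ?thesis by (auto dest: rtranclpD)
  qed
  from tranclp_path_sequence[of "layer_step T p" "\<lambda>n. lower_central T (m + n)", OF this]
  obtain N where N0: "N 0 = lower_central T m" and step: "\<And>i. layer_step T p (N i) (N (Suc i))"
    and hit: "\<And>n. \<exists>i. N i = lower_central T (m + n)" by auto
  have sub: "subgroup (N i) T" "N (Suc i) \<subseteq> N i" "card (rcosets\<^bsub>T\<lparr>carrier := N i\<rparr>\<^esub> N (Suc i)) = p" for i
    using step[of i] by (simp_all add: layer_step_def)
  have desc: "N i \<subseteq> lower_central T m" for i
    by (induction i) (use N0 sub(2) in auto)
  have lay: "\<exists>n\<ge>m. lower_central T (Suc n) \<subseteq> N i \<and> N i \<subseteq> lower_central T n" for i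
  proof -
    obtain n where n: "lower_central T (Suc n) \<subseteq> N i" "N i \<subseteq> lower_central T n"
      using step[of i] unfolding layer_step_def by blast
    show ?thesis
    proof (cases "n \<ge> m")
      case True
      then show ?thesis using n by blast
    next
      \<comment> \<open>The layer named by a step may have index below m only if \<open>N i\<close>
        also fits into the layer of index m, because every term is contained in the m-th
        one.\<close>
      case False
      then have "lower_central T (Suc m) \<subseteq> N i"
        using n(1) lower_central_antimono[of "Suc n" "Suc m"] by auto
      then show ?thesis using desc by blast
    qed
  qed
  have normal: "N i \<lhd> T" and real: "strongly_real_Beauville_group (T Mod N i)" for i
    using lay[of i] layer_subgroup_normal[OF _ sub(1)[of i]] layer[OF sub(1)[of i]] m
    by (meson le_trans one_le_numeral)+
  show ?thesis
  proof (intro conjI exI[of _ N] allI impI)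
    show "strongly_real_Beauville_group (T Mod lower_central T n)" if "n \<ge> m" for n
      using layer[OF lower_central_subgroup lower_central_Suc_subset order_refl that] .
    show "\<exists>i. N i = lower_central T n" if "n \<ge> m" for n
      using hit[of "n - m"] that by simp
    show "\<exists>n\<ge>m. lower_central T (n + 1) \<subseteq> N i \<and> N i \<subseteq> lower_central T n" for i
      using lay[of i] by simp
  qed (use N0 normal sub(2,3) real in simp_all)
qed

end
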